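(* For $c\ge 0$, $0\le\alpha\le 1$ and $\Lambda>0$, consider on $\mathbb{R}^2$ the vector field $$X^E_c(x,y)=y\frac{\partial}{\partial x}+\frac{1}{\Lambda}\big(cy+\mathrm{sign}(x)|x|^\alpha\big)\frac{\partial}{\partial y}.$$ The phase portrait of $X^E_c$ is independent of $c$, $\alpha$ and even of $\Lambda>0$. In other words, $X^E_c$ is topologically equivalent on $\mathbb{R}^2$ to the linear saddle type vector field $X_0=y\frac{\partial}{\partial x}+x\frac{\partial}{\partial y}$ corresponding to $\Lambda=1$, $\alpha=1$, $c=0$.
   Context: Two vector fields $X$ and $Y$ on the same manifold $M$ are topologically equivalent if there exists a homeomorphism $H$ of $M$ which sends the orbits of $X$ onto the orbits of $Y$, preserving time-orientation; a phase portrait is an equivalence class for this relation. Conventions: $\mathrm{sign}(0)=0$ and $\mathrm{sign}(x)=\pm1$ otherwise, so that the origin is an equilibrium (singular) point also when $\alpha=0$; in that case $X^E_c$ is discontinuous along the $y$-axis outside the origin, and trajectories are understood to cross the $y$-axis at points $(0,y)$, $y\ne0$, continuously. The origin is an orbit by itself, and the other orbits are the oriented images of maximal trajectories in $\mathbb{R}^2\setminus\{(0,0)\}$ (trajectories reaching or leaving the origin, possibly in finite time, are stopped there). *)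

theory Defs
  imports "HOL-Analysis.Analysis"
begin

text \<open>
  A vector field on a normed space is a function on it. A trajectory is a continuous curve avoiding
  the equilibria. It solves the differential equation at each time at which it sits at a point of
  continuity of the field. Points of discontinuity outside the equilibria may only be crossed, that
  is, met at isolated times, and there only continuity of the curve is required. For a continuous
  field these are the usual integral curves in the complement of the equilibria, including those of
  a field that is not Lipschitz at an equilibrium, which are stopped if they reach it in finite time.
\<close>

definition trajectory :: "('a::real_normed_vector \<Rightarrow> 'a) \<Rightarrow> real set \<Rightarrow> (real \<Rightarrow> 'a) \<Rightarrow> bool" where
  "trajectory X I \<gamma> \<longleftrightarrow>
     I \<noteq> {} \<and> open I \<and> is_interval I \<and> continuous_on I \<gamma> \<and>
     (\<forall>t\<in>I. X (\<gamma> t) \<noteq> 0) \<and>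
     (\<forall>t\<in>I. if isCont X (\<gamma> t) then (\<gamma> has_vector_derivative X (\<gamma> t)) (at t)
            else (\<forall>\<^sub>F s in at t. isCont X (\<gamma> s)))"

definition maximal_trajectory ::
    "('a::real_normed_vector \<Rightarrow> 'a) \<Rightarrow> real set \<Rightarrow> (real \<Rightarrow> 'a) \<Rightarrow> bool" where
  "maximal_trajectory X I \<gamma> \<longleftrightarrow>
     trajectory X I \<gamma> \<and>
     (\<forall>J \<delta>. trajectory X J \<delta> \<and> I \<subseteq> J \<and> (\<forall>t\<in>I. \<delta> t = \<gamma> t) \<longrightarrow> J = I)"

definition orbits :: "('a::real_normed_vector \<Rightarrow> 'a) \<Rightarrow> 'a set set" where
  "orbits X = {{p} | p. X p = 0} \<union> {\<gamma> ` I | \<gamma> I. maximal_trajectory X I \<gamma>}"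

text \<open>The strictly increasing surjection \<open>h\<close> between open intervals is a time change, necessarily
  a homeomorphism; the speed along orbits need not be preserved.\<close>

definition preserves_time_orientation ::
    "('a::real_normed_vector \<Rightarrow> 'a) \<Rightarrow> ('a \<Rightarrow> 'a) \<Rightarrow> ('a \<Rightarrow> 'a) \<Rightarrow> bool" where
  "preserves_time_orientation X Y H \<longleftrightarrow>
     (\<forall>I \<gamma>. maximal_trajectory X I \<gamma> \<longrightarrow>
        (\<exists>J \<delta> h. maximal_trajectory Y J \<delta> \<and> strict_mono_on I h \<and> h ` I = J \<and>
                 (\<forall>t\<in>I. H (\<gamma> t) = \<delta> (h t))))"

text \<open>Orientation is required to be preserved in both directions, so that the relation is symmetric
  for arbitrary fields, without assuming uniqueness of trajectories.\<close>

definition topologically_equivalent ::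
    "('a::real_normed_vector \<Rightarrow> 'a) \<Rightarrow> ('a \<Rightarrow> 'a) \<Rightarrow> bool" where
  "topologically_equivalent X Y \<longleftrightarrow>
     (\<exists>H K. homeomorphism UNIV UNIV H K \<and> (`) H ` orbits X = orbits Y \<and>
            preserves_time_orientation X Y H \<and> preserves_time_orientation Y X K)"

lemma preserves_time_orientation_comp:
  assumes "preserves_time_orientation X Y H" "preserves_time_orientation Y Z G"
  shows "preserves_time_orientation X Z (G \<circ> H)"
  unfolding preserves_time_orientation_def
proof (intro allI impI)
  fix I \<gamma> assume "maximal_trajectory X I \<gamma>"
  then obtain J \<delta> h where 1: "maximal_trajectory Y J \<delta>" "strict_mono_on I h" "h ` I = J"
      "\<forall>t\<in>I. H (\<gamma> t) = \<delta> (h t)"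
    using assms(1) unfolding preserves_time_orientation_def by blast
  then obtain L \<epsilon> g where 2: "maximal_trajectory Z L \<epsilon>" "strict_mono_on J g" "g ` J = L"
      "\<forall>t\<in>J. G (\<delta> t) = \<epsilon> (g t)"
    using assms(2) unfolding preserves_time_orientation_def by blast
  have "strict_mono_on I (g \<circ> h)"
    using 1(2,3) 2(2) by (auto simp: monotone_on_def)
  moreover have "(g \<circ> h) ` I = L" using 1(3) 2(3) by auto
  moreover have "\<forall>t\<in>I. (G \<circ> H) (\<gamma> t) = \<epsilon> ((g \<circ> h) t)" using 1(3,4) 2(4) by auto
  ultimately show "\<exists>J \<delta> h. maximal_trajectory Z J \<delta> \<and> strict_mono_on I h \<and> h ` I = J \<and>
                 (\<forall>t\<in>I. (G \<circ> H) (\<gamma> t) = \<delta> (h t))"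
    using 2(1) by blast
qed

lemma equivp_topologically_equivalent:
  "equivp (topologically_equivalent :: ('a::real_normed_vector \<Rightarrow> 'a) \<Rightarrow> ('a \<Rightarrow> 'a) \<Rightarrow> bool)"
proof (rule equivpI)
  show "reflp (topologically_equivalent :: ('a \<Rightarrow> 'a) \<Rightarrow> _)"
  proof (rule reflpI)
    fix X :: "'a \<Rightarrow> 'a"
    have "preserves_time_orientation X X id"
      unfolding preserves_time_orientation_def
    proof (intro allI impI)
      fix I and \<gamma> :: "real \<Rightarrow> 'a" assume "maximal_trajectory X I \<gamma>"
      then show "\<exists>J \<delta> h. maximal_trajectory X J \<delta> \<and> strict_mono_on I h \<and> h ` I = J \<and>
                 (\<forall>t\<in>I. id (\<gamma> t) = \<delta> (h t))"
        by (intro exI[of _ I] exI[of _ \<gamma>] exI[of _ id]) (simp add: monotone_on_def)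
    qed
    moreover have "homeomorphism UNIV UNIV (id :: 'a \<Rightarrow> 'a) id"
      by (simp add: homeomorphism_def continuous_on_id)
    moreover have "(`) id ` orbits X = orbits X" by simp
    ultimately show "topologically_equivalent X X"
      unfolding topologically_equivalent_def by blast
  qed
  show "symp (topologically_equivalent :: ('a \<Rightarrow> 'a) \<Rightarrow> _)"
  proof (rule sympI)
    fix X Y :: "'a \<Rightarrow> 'a" assume "topologically_equivalent X Y"
    then obtain H K where HK: "homeomorphism UNIV UNIV H K" "(`) H ` orbits X = orbits Y"
        "preserves_time_orientation X Y H" "preserves_time_orientation Y X K"
      unfolding topologically_equivalent_def by blast
    have "K (H x) = x" for x using HK(1) by (simp add: homeomorphism_def)
    then have "(`) K ` orbits Y = orbits X"
      unfolding HK(2)[symmetric] by (simp add: image_image)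
    moreover have "homeomorphism UNIV UNIV K H" using HK(1) homeomorphism_sym by fast
    ultimately show "topologically_equivalent Y X"
      unfolding topologically_equivalent_def
      by (intro exI[of _ K] exI[of _ H] conjI HK(3,4))
  qed
  show "transp (topologically_equivalent :: ('a \<Rightarrow> 'a) \<Rightarrow> _)"
  proof (rule transpI)
    fix X Y Z :: "'a \<Rightarrow> 'a"
    assume XY: "topologically_equivalent X Y" and YZ: "topologically_equivalent Y Z"
    obtain H K where 1: "homeomorphism UNIV UNIV H K" "(`) H ` orbits X = orbits Y"
        "preserves_time_orientation X Y H" "preserves_time_orientation Y X K"
      using XY unfolding topologically_equivalent_def by blast
    obtain G F where 2: "homeomorphism UNIV UNIV G F" "(`) G ` orbits Y = orbits Z"
        "preserves_time_orientation Y Z G" "preserves_time_orientation Z Y F"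
      using YZ unfolding topologically_equivalent_def by blast
    have "(`) (G \<circ> H) ` orbits X = orbits Z"
      unfolding 2(2)[symmetric] 1(2)[symmetric] by (simp add: image_image)
    then show "topologically_equivalent X Z"
      unfolding topologically_equivalent_def
      by (intro exI[of _ "G \<circ> H"] exI[of _ "K \<circ> F"] conjI homeomorphism_compose[OF 1(1) 2(1)]
          preserves_time_orientation_comp[OF 1(3) 2(3)]
          preserves_time_orientation_comp[OF 2(4) 1(4)])
  qed
qed

definition phase_portrait :: "('a::real_normed_vector \<Rightarrow> 'a) \<Rightarrow> ('a \<Rightarrow> 'a) set" where
  "phase_portrait X = {Y. topologically_equivalent X Y}"

text \<open>Since \<open>sgn 0 = 0\<close>, the origin is an equilibrium also for \<open>\<alpha> = 0\<close>, when the field is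
  discontinuous exactly on the \<open>y\<close>-axis.\<close>

definition XE :: "real \<Rightarrow> real \<Rightarrow> real \<Rightarrow> real \<times> real \<Rightarrow> real \<times> real" where
  "XE \<Lambda> \<alpha> c = (\<lambda>(x, y). (y, (1 / \<Lambda>) * (c * y + sgn x * \<bar>x\<bar> powr \<alpha>)))"

definition X0 :: "real \<times> real \<Rightarrow> real \<times> real" where
  "X0 = (\<lambda>(x, y). (y, x))"

lemma XE_eq_0_iff: "\<Lambda> > 0 \<Longrightarrow> XE \<Lambda> \<alpha> c p = 0 \<longleftrightarrow> p = (0, 0)"
  by (cases p) (auto simp: XE_def zero_prod_def sgn_zero_iff)

lemma X0_eq_0_iff: "X0 p = 0 \<longleftrightarrow> p = (0, 0)"
  by (cases p) (auto simp: X0_def zero_prod_def)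

lemma XE_eq_X0: "XE 1 1 0 = X0"
  by (auto simp: XE_def X0_def sgn_mult_abs)

end

theory Submission
  imports Defs
begin

text \<open>
  In the coordinates \<open>(u, w)\<close> with \<open>x = u \<bar>u\<bar> / (1 + \<bar>u\<bar>)\<close> and \<open>w = y - c x / \<Lambda>\<close>, the orbits of \<open>X\<^sup>E\<^sub>c\<close>
  are those of a Lienard system \<open>u' = w + G u\<close>, \<open>w' = h u\<close> in which \<open>G\<close> and \<open>h\<close> are odd and globally
  Lipschitz and \<open>h\<close> is strictly increasing, for all \<open>\<alpha>\<close> between 0 and 1. Such a system has a global flow
  and is cooperative: the forward flow is strongly monotone for the componentwise order, and so is
  the backward flow after the reflection \<open>w \<mapsto> - w\<close>. The time after which an orbit enters the region
  \<open>u \<ge> 1\<close>, \<open>w \<ge> K + 1\<close>, or its negative, yields a continuous function \<open>a\<close> that grows like \<open>exp t\<close> along the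
  flow and vanishes exactly on the stable set of the origin; time reversal yields \<open>b\<close>, which decays
  like \<open>exp (- t)\<close>. By monotonicity \<open>(a, b)\<close> is injective, and after a rescaling by a function of the
  invariant \<open>a b\<close> it is a homeomorphism of the plane conjugating the flow with that of the linear
  saddle. It remains to see that maximal trajectories of \<open>X\<^sup>E\<^sub>c\<close> are exactly the complete orbits of the
  Lienard flow, run with another clock; the point is uniqueness at the crossings of the \<open>y\<close>-axis,
  where \<open>X\<^sup>E\<^sub>c\<close> is not Lipschitz.
\<close>

section \<open>Flows of globally Lipschitz fields\<close>

text \<open>For \<alpha> > 0 both \<open>G\<close> and \<open>h\<close> have derivative 0 at the
  origin, so the Lienard system has a nilpotent linearization there: hyperbolic theory yields
  neither stable and unstable curves nor a local conjugacy. Preservation of order is a global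
  substitute that treats all exponents alike. Entrance times depend continuously on the point
  because the flow crosses the boundary of the region strictly inwards, and they shift by
  \<open>t\<close> along the flow, which is the source of the exponential weights. The conjugacy
  with the saddle respects the time of the Lienard flow; speed changes only in the passage to the
  original time. Since \<open>X0\<close> is the member \<open>XE 1 1 0\<close> of the family, it
  suffices to compare two members, by going through the same linear saddle in its
  eigencoordinates.\<close>

lemma gronwall_norm:
  fixes d :: "real \<Rightarrow> 'a::real_inner"
  assumes "a \<le> b"
    and d: "\<And>t. a \<le> t \<Longrightarrow> t \<le> b \<Longrightarrow> (d has_vector_derivative d' t) (at t)"
    and bd: "\<And>t. a \<le> t \<Longrightarrow> t \<le> b \<Longrightarrow> norm (d' t) \<le> K * norm (d t)"
  shows "norm (d b) \<le> exp (K * (b - a)) * norm (d a)"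
    and "norm (d a) \<le> exp (K * (b - a)) * norm (d b)"
proof -
  \<comment> \<open>The weights \<open>C = - 2 * K\<close> and \<open>C = 2 * K\<close> make the
    squared norm nonincreasing and nondecreasing respectively, by Cauchy-Schwarz: one estimate
    forwards and one backwards in time.\<close>
  have deriv: "((\<lambda>t. exp (C * t) * (d t \<bullet> d t)) has_real_derivative
      exp (C * t) * (C * (d t \<bullet> d t) + 2 * (d t \<bullet> d' t))) (at t)" if "a \<le> t" "t \<le> b" for C t
  proof -
    have "((\<lambda>t. d t \<bullet> d t) has_real_derivative (2 * (d t \<bullet> d' t))) (at t)"
      using has_derivative_inner[OF d[OF that, unfolded has_vector_derivative_def]
          d[OF that, unfolded has_vector_derivative_def]]
      unfolding has_field_derivative_def
      by (rule has_derivative_eq_rhs) (auto simp: inner_commute algebra_simps)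
    then show ?thesis
      by (auto intro!: derivative_eq_intros simp: algebra_simps)
  qed
  have cs: "\<bar>d t \<bullet> d' t\<bar> \<le> K * (d t \<bullet> d t)" if "a \<le> t" "t \<le> b" for t
  proof -
    have "\<bar>d t \<bullet> d' t\<bar> \<le> norm (d t) * norm (d' t)" by (rule Cauchy_Schwarz_ineq2)
    also have "\<dots> \<le> norm (d t) * (K * norm (d t))"
      by (rule mult_left_mono[OF bd[OF that]]) simp
    also have "\<dots> = K * (d t \<bullet> d t)" by (simp add: dot_square_norm power2_eq_square)
    finally show ?thesis .
  qed
  have sq: "norm u \<le> exp (K * (b - a)) * norm v"
    if "u \<bullet> u \<le> exp (2 * K * (b - a)) * (v \<bullet> v)" for u v :: 'a
  proof -
    have "exp (2 * K * (b - a)) = (exp (K * (b - a)))\<^sup>2"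
      by (simp add: power2_eq_square flip: exp_add)
    then have "(norm u)\<^sup>2 \<le> (exp (K * (b - a)) * norm v)\<^sup>2"
      using that by (simp add: dot_square_norm power_mult_distrib)
    then show ?thesis by (rule power2_le_imp_le) simp
  qed
  have "exp ((-2 * K) * b) * (d b \<bullet> d b) \<le> exp ((-2 * K) * a) * (d a \<bullet> d a)"
    using \<open>a \<le> b\<close>
  proof (rule DERIV_nonpos_imp_nonincreasing, intro exI conjI)
    fix t assume t: "a \<le> t" "t \<le> b"
    show "exp ((-2 * K) * t) * ((-2 * K) * (d t \<bullet> d t) + 2 * (d t \<bullet> d' t)) \<le> 0"
      using cs[OF t] by (intro mult_nonneg_nonpos) auto
  qed (rule deriv)
  then have "d b \<bullet> d b \<le> exp (2 * K * (b - a)) * (d a \<bullet> d a)"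
    by (simp add: exp_minus exp_diff right_diff_distrib divide_simps) (simp add: mult_ac)
  then show "norm (d b) \<le> exp (K * (b - a)) * norm (d a)" by (rule sq)
  have "exp ((2 * K) * a) * (d a \<bullet> d a) \<le> exp ((2 * K) * b) * (d b \<bullet> d b)"
    using \<open>a \<le> b\<close>
  proof (rule DERIV_nonneg_imp_nondecreasing, intro exI conjI)
    fix t assume t: "a \<le> t" "t \<le> b"
    show "0 \<le> exp ((2 * K) * t) * ((2 * K) * (d t \<bullet> d t) + 2 * (d t \<bullet> d' t))"
      using cs[OF t] by (intro mult_nonneg_nonneg) auto
  qed (rule deriv)
  then have "d a \<bullet> d a \<le> exp (2 * K * (b - a)) * (d b \<bullet> d b)"
    by (simp add: exp_minus exp_diff right_diff_distrib divide_simps) (simp add: mult_ac)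
  then show "norm (d a) \<le> exp (K * (b - a)) * norm (d b)" by (rule sq)
qed

lemma antiderivative_UNIV:
  fixes f :: "real \<Rightarrow> 'a::euclidean_space"
  assumes "continuous_on UNIV f"
  obtains F where "F 0 = 0" "\<And>t. (F has_vector_derivative f t) (at t)"
proof -
  have "\<exists>F. \<forall>x. (- \<infinity>::ereal) < ereal x \<longrightarrow> ereal x < \<infinity> \<longrightarrow> (F has_vector_derivative f x) (at x)"
    using assms by (intro einterval_antiderivative) (auto simp: continuous_on_eq_continuous_at)
  then obtain F where F: "\<And>x. (F has_vector_derivative f x) (at x)" by auto
  have "((\<lambda>t. F t - F 0) has_vector_derivative f t) (at t)" for t
    using has_vector_derivative_diff[OF F[of t] has_vector_derivative_const[of "F 0"]] by simp
  then show thesis by (intro that[of "\<lambda>t. F t - F 0"]) auto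
qed

text \<open>The majorant is the derivative of \<open>B * exp (c * t)\<close>; negative times follow
  by reflection. Integration gains the factor \<open>1 / c\<close>, which with
  \<open>c = 2 * M\<close> outweighs the Lipschitz constant \<open>M\<close> in the Picard
  operator.\<close>

lemma norm_le_exp_of_derivative:
  fixes F :: "real \<Rightarrow> 'a::euclidean_space"
  assumes "F 0 = 0" and F: "\<And>t. (F has_vector_derivative f t) (at t)"
    and f: "\<And>t. norm (f t) \<le> B * (c * exp (c * \<bar>t\<bar>))" and "B \<ge> 0"
  shows "norm (F t) \<le> B * exp (c * \<bar>t\<bar>)"
proof -
  have *: "norm (F t) \<le> B * exp (c * t)"
    if "t > 0" "F 0 = 0" and F: "\<And>t. (F has_vector_derivative f t) (at t)"
      and f: "\<And>t. norm (f t) \<le> B * (c * exp (c * \<bar>t\<bar>))" for t F and f :: "real \<Rightarrow> 'a"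
  proof -
    have "norm (F t - F 0) \<le> B * exp (c * t) - B * exp (c * 0)"
    proof (rule differentiable_bound_general[OF \<open>t > 0\<close>])
      show "continuous_on {0..t} F"
        by (meson F continuous_at_imp_continuous_on has_vector_derivative_continuous)
      show "continuous_on {0..t} (\<lambda>t. B * exp (c * t))" by (intro continuous_intros)
      show "((\<lambda>t. B * exp (c * t)) has_vector_derivative B * (c * exp (c * s))) (at s)" for s
        by (auto intro!: derivative_eq_intros simp flip: has_real_derivative_iff_has_vector_derivative)
      show "norm (f s) \<le> B * (c * exp (c * s))" if "0 < s" for s
        using f[of s] that by simp
    qed (rule F)
    then show ?thesis using \<open>B \<ge> 0\<close> that(2) by simp
  qed
  consider "t > 0" | "t = 0" | "t < 0" by linarith
  then show ?thesis
  proof cases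
    case 1
    then show ?thesis using *[OF 1 assms(1) F f] by simp
  next
    case 2
    then show ?thesis using assms(1,4) by simp
  next
    case 3
    have "((\<lambda>s. F (- s)) has_vector_derivative - f (- s)) (at s)" for s
    proof -
      have "(uminus has_vector_derivative - 1) (at s)"
        by (auto intro!: derivative_eq_intros)
      from vector_diff_chain_at[OF this F]
      show ?thesis by (simp add: o_def)
    qed
    moreover have "norm (- f (- s)) \<le> B * (c * exp (c * \<bar>s\<bar>))" for s using f[of "- s"] by simp
    ultimately have "norm (F (- (- t))) \<le> B * exp (c * (- t))"
      using 3 assms(1) by (intro *[of "- t" "\<lambda>s. F (- s)" "\<lambda>s. - f (- s)"]) auto
    then show ?thesis using 3 by simp
  qed
qed

locale lipschitz_field =
  fixes f :: "'a::euclidean_space \<Rightarrow> 'a" and M :: real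
  assumes M_pos: "M > 0"
    and lip: "norm (f x - f y) \<le> M * norm (x - y)"
    and f_0: "f 0 = 0"
begin

lemma continuous_on_f: "continuous_on S f"
proof -
  have "M-lipschitz_on S f"
    using lip M_pos by (intro lipschitz_onI) (auto simp: dist_norm)
  then show ?thesis by (rule lipschitz_on_continuous_on)
qed

text \<open>Picard iteration contracts globally in time for the sup norm weighted by \<open>exp (2 * M * \<bar>t\<bar>)\<close>.\<close>

lemma global_solution_exists: "\<exists>Z. Z 0 = p \<and> (\<forall>t. (Z has_vector_derivative f (Z t)) (at t))"
proof -
  define E where "E t = exp (2 * M * \<bar>t\<bar>)" for t
  have E_pos: "E t > 0" and E_ge: "E t \<ge> 1" for t using M_pos by (auto simp: E_def)
  have cE: "continuous_on UNIV E" unfolding E_def by (intro continuous_intros)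
  have "\<exists>F. F 0 = 0 \<and> (\<forall>t. (F has_vector_derivative f (E t *\<^sub>R apply_bcontfun z t)) (at t))" for z :: "real \<Rightarrow>\<^sub>C 'a"
  proof -
    have "continuous_on UNIV (\<lambda>t. f (E t *\<^sub>R apply_bcontfun z t))"
      by (rule continuous_on_compose2[OF continuous_on_f[of UNIV]]) (auto intro!: continuous_intros cE)
    from antiderivative_UNIV[OF this] show ?thesis by blast
  qed
  then have "\<exists>F. \<forall>z. F z 0 = 0 \<and> (\<forall>t. (F z has_vector_derivative f (E t *\<^sub>R apply_bcontfun z t)) (at t))"
    by (intro choice allI)
  then obtain I where I0: "\<And>z. I z 0 = 0"
    and I: "\<And>z t. (I z has_vector_derivative f (E t *\<^sub>R apply_bcontfun z t)) (at t)"
    by blast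
  \<comment> \<open>A curve is encoded by the bounded function \<open>z\<close> with values
    \<open>E t *\<^sub>R z t\<close> along it, so that the sup metric of bounded continuous
    functions is the weighted metric of curves. \<open>T\<close> is the Picard operator in this
    encoding.\<close>
  define T where "T z = Bcontfun (\<lambda>t. (p + I z t) /\<^sub>R E t)" for z
  have Idiff: "norm (I y t - I z t) \<le> dist y z / 2 * E t" for y z t
    unfolding E_def
  proof (rule norm_le_exp_of_derivative)
    show "((\<lambda>t. I y t - I z t) has_vector_derivative
        f (E t *\<^sub>R apply_bcontfun y t) - f (E t *\<^sub>R apply_bcontfun z t)) (at t)" for t
      by (intro has_vector_derivative_diff I)
    show "norm (f (E t *\<^sub>R apply_bcontfun y t) - f (E t *\<^sub>R apply_bcontfun z t))
        \<le> dist y z / 2 * (2 * M * exp (2 * M * \<bar>t\<bar>))" for t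
    proof -
      have "norm (f (E t *\<^sub>R apply_bcontfun y t) - f (E t *\<^sub>R apply_bcontfun z t))
          \<le> M * norm (E t *\<^sub>R (apply_bcontfun y t - apply_bcontfun z t))"
        using lip by (simp add: scaleR_diff_right)
      also have "\<dots> = M * (E t * dist (apply_bcontfun y t) (apply_bcontfun z t))"
        using E_pos[of t] by (simp add: dist_norm)
      also have "\<dots> \<le> M * (E t * dist y z)"
        using E_pos[of t] M_pos by (intro mult_left_mono dist_bounded) auto
      finally show ?thesis by (simp add: E_def algebra_simps)
    qed
  qed (auto simp: I0)
  have cI: "continuous_on UNIV (I z)" for z
    by (meson I continuous_at_imp_continuous_on has_vector_derivative_continuous)
  \<comment> \<open>Comparison with the zero curve: since \<open>f 0 = 0\<close>, the estimate
    \<open>Idiff\<close> against \<open>z = 0\<close> bounds \<open>I z\<close> itself, and this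
    keeps \<open>T z\<close> bounded.\<close>
  have I_0: "I 0 t = 0" for t
  proof -
    have "norm (I 0 t) \<le> 0 * exp (1 * \<bar>t\<bar>)"
      by (rule norm_le_exp_of_derivative[where f = "\<lambda>_. 0"]) (use I[of 0] in \<open>auto simp: I0 f_0\<close>)
    then show ?thesis by simp
  qed
  have mem: "(\<lambda>t. (p + I z t) /\<^sub>R E t) \<in> bcontfun" for z
  proof (rule bcontfun_normI[where b = "norm p + dist z 0 / 2"])
    show "continuous_on UNIV (\<lambda>t. (p + I z t) /\<^sub>R E t)"
      using E_pos by (auto intro!: continuous_intros cI cE simp: less_imp_neq[symmetric])
    have "norm ((p + I z t) /\<^sub>R E t) \<le> (norm p + dist z 0 / 2 * E t) / E t" for t
      using Idiff[of z t 0] norm_triangle_ineq[of p "I z t"] E_pos[of t]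
      by (simp add: I_0 divide_simps)
    also have "\<dots> t \<le> norm p + dist z 0 / 2" for t
      using E_pos[of t] E_ge[of t] mult_left_mono[OF E_ge[of t], of "norm p"] by (simp add: field_simps)
    finally show "norm ((p + I z t) /\<^sub>R E t) \<le> norm p + dist z 0 / 2" for t .
  qed
  have T: "apply_bcontfun (T z) t = (p + I z t) /\<^sub>R E t" for z t
    unfolding T_def by (simp add: Bcontfun_inverse[OF mem])
  have "\<exists>!z. T z = z"
  proof (rule banach_fix_type[of "1/2"], safe)
    fix y z
    show "dist (T y) (T z) \<le> 1 / 2 * dist y z"
    proof (rule dist_bound)
      fix t
      have "dist (apply_bcontfun (T y) t) (apply_bcontfun (T z) t) = norm (I y t - I z t) / E t"
        unfolding dist_norm T using E_pos[of t]
        by (simp add: divide_inverse flip: scaleR_diff_right)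
      also have "\<dots> \<le> dist y z / 2" using Idiff[of y t z] E_pos[of t] by (simp add: divide_simps)
      finally show "dist (apply_bcontfun (T y) t) (apply_bcontfun (T z) t) \<le> 1 / 2 * dist y z" by simp
    qed
  qed auto
  then obtain z where "T z = z" by blast
  then have z: "E t *\<^sub>R apply_bcontfun z t = p + I z t" for t
    using T[of z t] E_pos[of t] by simp
  have "((\<lambda>t. p + I z t) has_vector_derivative f (p + I z t)) (at t)" for t
    using has_vector_derivative_add[OF has_vector_derivative_const[of p] I[of z t]] by (simp add: z)
  then show ?thesis by (intro exI[of _ "\<lambda>t. p + I z t"]) (auto simp: I0)
qed

definition flow :: "real \<Rightarrow> 'a \<Rightarrow> 'a" where
  "flow t p = (SOME Z. Z 0 = p \<and> (\<forall>t. (Z has_vector_derivative f (Z t)) (at t))) t"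

lemma flow_0 [simp]: "flow 0 p = p"
  and flow_deriv: "((\<lambda>t. flow t p) has_vector_derivative f (flow t p)) (at t)"
  using someI_ex[OF global_solution_exists[of p]] unfolding flow_def by auto

lemma solution_dist:
  assumes "\<And>t. (Y has_vector_derivative f (Y t)) (at t)" "\<And>t. (Z has_vector_derivative f (Z t)) (at t)"
  shows "norm (Y t - Z t) \<le> exp (M * \<bar>t\<bar>) * norm (Y 0 - Z 0)"
proof (cases "t \<ge> 0")
  case True
  have "norm (Y t - Z t) \<le> exp (M * (t - 0)) * norm (Y 0 - Z 0)"
    by (rule gronwall_norm(1)[OF True has_vector_derivative_diff[OF assms]]) (rule lip)
  then show ?thesis using True by simp
next
  case False
  then have "t \<le> 0" by simp
  have "norm (Y t - Z t) \<le> exp (M * (0 - t)) * norm (Y 0 - Z 0)"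
    by (rule gronwall_norm(2)[OF \<open>t \<le> 0\<close> has_vector_derivative_diff[OF assms]]) (rule lip)
  then show ?thesis using \<open>t \<le> 0\<close> by simp
qed

lemma flow_unique:
  assumes "\<And>t. (Z has_vector_derivative f (Z t)) (at t)"
  shows "Z t = flow t (Z 0)"
  using solution_dist[OF assms flow_deriv, of t "Z 0"] by simp

lemma flow_add: "flow (s + t) p = flow s (flow t p)"
proof -
  have "((\<lambda>s. flow (s + t) p) has_vector_derivative f (flow (s + t) p)) (at s)" for s
  proof -
    have "((\<lambda>s. s + t) has_vector_derivative 1) (at s)" by (auto intro!: derivative_eq_intros)
    from vector_diff_chain_at[OF this flow_deriv[of p "s + t"]]
    show ?thesis by (simp add: o_def)
  qed
  from flow_unique[of "\<lambda>s. flow (s + t) p", OF this] show ?thesis by simp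
qed

lemma flow_minus [simp]: "flow (- t) (flow t p) = p" "flow t (flow (- t) p) = p"
  using flow_add[of "- t" t p] flow_add[of t "- t" p] by auto

lemma flow_fixed [simp]: "flow t 0 = 0"
  using flow_unique[of "\<lambda>_. 0" t] by (simp add: f_0)

lemma flow_eq_0_iff [simp]: "flow t p = 0 \<longleftrightarrow> p = 0"
  by (metis flow_minus(1) flow_fixed)

lemma inj_flow: "flow t p = flow t q \<longleftrightarrow> p = q"
  by (metis flow_minus(1))

lemma flow_dist: "norm (flow t p - flow t q) \<le> exp (M * \<bar>t\<bar>) * norm (p - q)"
  using solution_dist[OF flow_deriv flow_deriv, of t p q] by simp

lemma continuous_flow: "continuous_on S (flow t)"
proof -
  have "lipschitz_on (exp (M * \<bar>t\<bar>)) S (flow t)"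
    using flow_dist by (intro lipschitz_onI) (auto simp: dist_norm)
  then show ?thesis by (rule lipschitz_on_continuous_on)
qed

lemma continuous_flow_time: "continuous_on S (\<lambda>t. flow t p)"
  by (intro continuous_at_imp_continuous_on ballI has_vector_derivative_continuous[OF flow_deriv])

end

section \<open>Lienard systems\<close>

text \<open>The integrating factor \<open>exp (K * (t - a))\<close> makes
  \<open>exp (K * (t - a)) * (u t - c) - m * (t - a)\<close> nondecreasing. For \<open>m > 0\<close>
  this uses that the factor is at least 1, hence \<open>K \<ge> 0\<close>; the case of negative
  \<open>K\<close> and \<open>m = 0\<close> serves for bounds on \<open>- u\<close>.\<close>

lemma exp_weighted_growth:
  fixes u u' :: "real \<Rightarrow> real"
  assumes "a \<le> b" and u: "\<And>t. a \<le> t \<Longrightarrow> t \<le> b \<Longrightarrow> (u has_real_derivative u' t) (at t)"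
    and u': "\<And>t. a \<le> t \<Longrightarrow> t \<le> b \<Longrightarrow> u' t \<ge> K * (c - u t) + m"
    and m: "m \<ge> 0" "K \<ge> 0 \<or> m = 0"
  shows "u a - c + m * (b - a) \<le> exp (K * (b - a)) * (u b - c)"
proof -
  have "exp (K * (a - a)) * (u a - c) - m * (a - a) \<le> exp (K * (b - a)) * (u b - c) - m * (b - a)"
    using \<open>a \<le> b\<close>
  proof (rule DERIV_nonneg_imp_nondecreasing, intro exI conjI)
    fix t assume t: "a \<le> t" "t \<le> b"
    show "((\<lambda>t. exp (K * (t - a)) * (u t - c) - m * (t - a)) has_real_derivative
        exp (K * (t - a)) * (K * (u t - c) + u' t) - m) (at t)"
      using u[OF t] by (auto intro!: derivative_eq_intros simp: algebra_simps)
    have "m \<le> exp (K * (t - a)) * m"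
      using m t by (cases "m = 0") (auto intro!: mult_right_mono[of 1, simplified])
    also have "\<dots> \<le> exp (K * (t - a)) * (K * (u t - c) + u' t)"
      using u'[OF t] by (intro mult_left_mono) (auto simp: algebra_simps)
    finally show "0 \<le> exp (K * (t - a)) * (K * (u t - c) + u' t) - m" by simp
  qed
  then show ?thesis by simp
qed

text \<open>If \<open>P\<close> failed, the closed set of failures would have a least element, which
  \<open>step\<close> excludes. This is used for open conditions that persist along an
  orbit.\<close>

lemma real_induct_closed:
  fixes P :: "real \<Rightarrow> bool"
  assumes "closed {t. 0 \<le> t \<and> \<not> P t}"
    and step: "\<And>t. 0 \<le> t \<Longrightarrow> (\<And>s. 0 \<le> s \<Longrightarrow> s < t \<Longrightarrow> P s) \<Longrightarrow> P t"
    and "0 \<le> t"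
  shows "P t"
proof (rule ccontr)
  assume "\<not> P t"
  let ?S = "{t. 0 \<le> t \<and> \<not> P t}"
  have ne: "?S \<noteq> {}" and bdd: "bdd_below ?S" using \<open>\<not> P t\<close> \<open>0 \<le> t\<close> by (auto intro: bdd_belowI)
  have "Inf ?S \<in> ?S" by (rule closed_contains_Inf[OF ne bdd assms(1)])
  moreover have "P s" if "0 \<le> s" "s < Inf ?S" for s
    using that cInf_lower[OF _ bdd, of s] by force
  ultimately show False using step[of "Inf ?S"] by auto
qed

text \<open>Oddness makes the point reflection a symmetry of the flow, so every statement about the
  upper right has a counterpart at the lower left. The hypotheses are also stable under replacing
  \<open>G\<close> by \<open>- G\<close>, as time reversal requires.\<close>

locale lienard =
  fixes G h :: "real \<Rightarrow> real" and K :: real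
  assumes K_ge_1: "K \<ge> 1"
    and G_lip: "\<bar>G x - G y\<bar> \<le> K * \<bar>x - y\<bar>"
    and h_lip: "\<bar>h x - h y\<bar> \<le> K * \<bar>x - y\<bar>"
    and G_odd: "G (- x) = - G x"
    and h_odd: "h (- x) = - h x"
    and h_mono: "x < y \<Longrightarrow> h x < h y"
begin

definition L :: "real \<times> real \<Rightarrow> real \<times> real" where
  "L p = (snd p + G (fst p), h (fst p))"

lemma G_0 [simp]: "G 0 = 0" and h_0 [simp]: "h 0 = 0"
  using G_odd[of 0] h_odd[of 0] by auto

lemma G_bound: "\<bar>G x\<bar> \<le> K * \<bar>x\<bar>"
  using G_lip[of x 0] by simp

lemma h_mono_le: "x \<le> y \<Longrightarrow> h x \<le> h y"
  using h_mono[of x y] by (cases "x = y") auto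

lemma h_pos: "0 < x \<Longrightarrow> 0 < h x"
  using h_mono[of 0 x] by simp

sublocale lipschitz_field L "1 + 2 * K"
proof
  show "norm (L p - L q) \<le> (1 + 2 * K) * norm (p - q)" for p q
  proof -
    let ?dx = "fst p - fst q" and ?dw = "snd p - snd q"
    have le: "\<bar>?dx\<bar> \<le> norm (p - q)" "\<bar>?dw\<bar> \<le> norm (p - q)"
      using norm_fst_le[of "fst (p - q)" "snd (p - q)"] norm_snd_le[of "snd (p - q)" "fst (p - q)"]
      by (simp_all add: minus_prod_def)
    have "norm (L p - L q) \<le> \<bar>?dw + (G (fst p) - G (fst q))\<bar> + \<bar>h (fst p) - h (fst q)\<bar>"
      using norm_Pair_le[of "?dw + (G (fst p) - G (fst q))" "h (fst p) - h (fst q)"]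
      by (simp add: L_def algebra_simps)
    also have "\<dots> \<le> \<bar>?dw\<bar> + K * \<bar>?dx\<bar> + K * \<bar>?dx\<bar>"
      using G_lip[of "fst p" "fst q"] h_lip[of "fst p" "fst q"] by linarith
    also have "\<dots> \<le> norm (p - q) + K * norm (p - q) + K * norm (p - q)"
      using le K_ge_1 by (intro add_mono mult_left_mono) auto
    finally show ?thesis by (simp add: algebra_simps)
  qed
qed (use K_ge_1 in \<open>auto simp: L_def zero_prod_def\<close>)

lemma fst_flow_deriv:
  "((\<lambda>t. fst (flow t p)) has_real_derivative snd (flow t p) + G (fst (flow t p))) (at t)"
  and snd_flow_deriv: "((\<lambda>t. snd (flow t p)) has_real_derivative h (fst (flow t p))) (at t)"
proof -
  note d = flow_deriv[of p t, unfolded has_vector_derivative_def]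
  show "((\<lambda>t. fst (flow t p)) has_real_derivative snd (flow t p) + G (fst (flow t p))) (at t)"
    using has_derivative_fst[OF d] by (simp add: L_def has_field_derivative_def mult_commute_abs)
  show "((\<lambda>t. snd (flow t p)) has_real_derivative h (fst (flow t p))) (at t)"
    using has_derivative_snd[OF d] by (simp add: L_def has_field_derivative_def mult_commute_abs)
qed

lemma continuous_fst_flow: "continuous_on S (\<lambda>t. fst (flow t p))"
  and continuous_snd_flow: "continuous_on S (\<lambda>t. snd (flow t p))"
  by (intro continuous_intros continuous_flow_time)+

lemma flow_uminus: "flow t (- p) = - flow t p"
proof -
  have "((\<lambda>t. - flow t p) has_vector_derivative L (- flow t p)) (at t)" for t
    using has_vector_derivative_minus[OF flow_deriv[of p t]]
    by (simp add: L_def G_odd h_odd uminus_prod_def)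
  from flow_unique[of "\<lambda>t. - flow t p", OF this] show ?thesis by simp
qed

lemma snd_flow_growth:
  assumes "a \<le> b" "\<And>t. a \<le> t \<Longrightarrow> t \<le> b \<Longrightarrow> fst (flow t p) \<ge> x"
  shows "snd (flow b p) \<ge> snd (flow a p) + h x * (b - a)"
proof -
  have "snd (flow a p) - h x * a \<le> snd (flow b p) - h x * b"
    using \<open>a \<le> b\<close>
  proof (rule DERIV_nonneg_imp_nondecreasing, intro exI conjI)
    fix t assume t: "a \<le> t" "t \<le> b"
    show "((\<lambda>t. snd (flow t p) - h x * t) has_real_derivative h (fst (flow t p)) - h x) (at t)"
      by (auto intro!: derivative_eq_intros snd_flow_deriv)
    show "0 \<le> h (fst (flow t p)) - h x" using assms(2)[OF t] by (simp add: h_mono_le)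
  qed
  then show ?thesis by (simp add: algebra_simps)
qed

lemma fst_flow_growth:
  assumes "a \<le> b" and "m \<ge> 0" "\<And>t. a \<le> t \<Longrightarrow> t \<le> b \<Longrightarrow> snd (flow t p) + G (fst (flow t p)) \<ge> K * (c - fst (flow t p)) + m"
  shows "fst (flow a p) - c + m * (b - a) \<le> exp (K * (b - a)) * (fst (flow b p) - c)"
  using assms K_ge_1 by (intro exp_weighted_growth[where u = "\<lambda>t. fst (flow t p)", OF _ fst_flow_deriv]) auto

text \<open>The system is cooperative, so the forward flow preserves the componentwise order.\<close>

lemma diff_growth:
  assumes "a \<le> b" and le: "\<And>t. a \<le> t \<Longrightarrow> t \<le> b \<Longrightarrow> fst (flow t p) \<le> fst (flow t q) \<and> m \<le> snd (flow t q) - snd (flow t p)"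
    and "m \<ge> 0"
  shows "fst (flow a q) - fst (flow a p) + m * (b - a) \<le> exp (K * (b - a)) * (fst (flow b q) - fst (flow b p))"
proof -
  have "fst (flow a q) - fst (flow a p) - 0 + m * (b - a) \<le> exp (K * (b - a)) * (fst (flow b q) - fst (flow b p) - 0)"
  proof (rule exp_weighted_growth[OF \<open>a \<le> b\<close>])
    show "((\<lambda>t. fst (flow t q) - fst (flow t p)) has_real_derivative
      (snd (flow t q) + G (fst (flow t q))) - (snd (flow t p) + G (fst (flow t p)))) (at t)" for t
      by (intro DERIV_diff fst_flow_deriv)
    fix t assume "a \<le> t" "t \<le> b"
    then show "K * (0 - (fst (flow t q) - fst (flow t p))) + m
        \<le> (snd (flow t q) + G (fst (flow t q))) - (snd (flow t p) + G (fst (flow t p)))"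
      using le[of t] G_lip[of "fst (flow t q)" "fst (flow t p)"] by (auto simp: algebra_simps abs_le_iff)
  qed (use K_ge_1 \<open>m \<ge> 0\<close> in auto)
  then show ?thesis by simp
qed

lemma snd_diff_mono:
  assumes "a \<le> b" and le: "\<And>t. a \<le> t \<Longrightarrow> t \<le> b \<Longrightarrow> fst (flow t p) \<le> fst (flow t q)"
  shows "snd (flow a q) - snd (flow a p) \<le> snd (flow b q) - snd (flow b p)"
  using \<open>a \<le> b\<close>
  by (rule DERIV_nonneg_imp_nondecreasing)
    (use le h_mono_le in \<open>auto intro!: exI DERIV_diff snd_flow_deriv\<close>)

text \<open>At a first time of failure the weak order still holds by continuity. Up to that time
  \<open>diff_growth\<close> keeps the gap in the first components positive, and monotonicity of
  \<open>h\<close> keeps the gap in the second ones from shrinking.\<close>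

lemma flow_strict:
  assumes "fst p < fst q" "snd p < snd q" "t \<ge> 0"
  shows "fst (flow t p) < fst (flow t q) \<and> snd (flow t p) < snd (flow t q)"
  using _ _ \<open>t \<ge> 0\<close>
proof (rule real_induct_closed)
  show "closed {t. 0 \<le> t \<and> \<not> (fst (flow t p) < fst (flow t q) \<and> snd (flow t p) < snd (flow t q))}"
    unfolding de_Morgan_conj not_less
    by (intro closed_Collect_conj closed_Collect_disj closed_Collect_le continuous_fst_flow
        continuous_snd_flow continuous_intros)
next
  fix t :: real assume "0 \<le> t"
    and IH: "\<And>s. 0 \<le> s \<Longrightarrow> s < t \<Longrightarrow> fst (flow s p) < fst (flow s q) \<and> snd (flow s p) < snd (flow s q)"
  have weak: "fst (flow t p) \<le> fst (flow t q) \<and> snd (flow t p) \<le> snd (flow t q)"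
  proof (cases "t = 0")
    case False
    then have ev: "\<forall>\<^sub>F s in at_left t. 0 \<le> s \<and> s < t"
      using \<open>0 \<le> t\<close> eventually_at_left_real[of 0 t] by (auto elim: eventually_mono)
    have lim: "((\<lambda>s. flow s r) \<longlongrightarrow> flow t r) (at_left t)" for r
      using continuous_flow_time[of UNIV r]
      by (auto simp: continuous_on_eq_continuous_at isCont_def intro: filterlim_at_split[THEN iffD1, THEN conjunct1])
    show ?thesis
      by (intro conjI tendsto_le[OF _ tendsto_fst[OF lim] tendsto_fst[OF lim]]
           tendsto_le[OF _ tendsto_snd[OF lim] tendsto_snd[OF lim]])
         (use ev in \<open>auto elim!: eventually_mono dest!: IH\<close>)
  qed (use assms in auto)
  then have le: "fst (flow s p) \<le> fst (flow s q) \<and> snd (flow s p) \<le> snd (flow s q)" if "0 \<le> s" "s \<le> t" for s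
    using IH[of s] that by (cases "s = t") auto
  have "0 < exp (K * (t - 0)) * (fst (flow t q) - fst (flow t p))"
    using diff_growth[of 0 t p q 0] le \<open>0 \<le> t\<close> assms by auto
  then have "fst (flow t p) < fst (flow t q)" by (simp add: zero_less_mult_iff)
  moreover have "snd (flow t p) < snd (flow t q)"
    using snd_diff_mono[of 0 t p q] le \<open>0 \<le> t\<close> assms by auto
  ultimately show "fst (flow t p) < fst (flow t q) \<and> snd (flow t p) < snd (flow t q)" ..
qed

text \<open>The points \<open>q + (e, e)\<close> with \<open>e > 0\<close> lie strictly above
  \<open>p\<close>, and the time map is continuous as \<open>e\<close> tends to 0.\<close>

lemma flow_mono:
  assumes "p \<le> q" "t \<ge> 0"
  shows "flow t p \<le> flow t q"
proof -
  have "((\<lambda>e. q + (e, e)) \<longlongrightarrow> q + (0, 0)) (at_right 0)"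
    by (intro tendsto_intros)
  then have lim: "((\<lambda>e. flow t (q + (e, e))) \<longlongrightarrow> flow t q) (at_right 0)"
    using continuous_on_eq_continuous_at[OF open_UNIV, THEN iffD1, rule_format, OF continuous_flow UNIV_I]
    by (intro isCont_tendsto_compose[where g = "flow t"]) (auto simp flip: zero_prod_def)
  have ev: "\<forall>\<^sub>F e in at_right 0. fst (flow t p) \<le> fst (flow t (q + (e, e))) \<and> snd (flow t p) \<le> snd (flow t (q + (e, e)))"
    using eventually_at_right_less
  proof (rule eventually_mono)
    fix e :: real assume "0 < e"
    then show "fst (flow t p) \<le> fst (flow t (q + (e, e))) \<and> snd (flow t p) \<le> snd (flow t (q + (e, e)))"
      using flow_strict[of p "q + (e, e)" t] assms by (auto simp: less_eq_prod_def)
  qed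
  have "fst (flow t p) \<le> fst (flow t q)"
    by (rule tendsto_lowerbound[OF tendsto_fst[OF lim]]) (use ev in \<open>auto elim: eventually_mono\<close>)
  moreover have "snd (flow t p) \<le> snd (flow t q)"
    by (rule tendsto_lowerbound[OF tendsto_snd[OF lim]]) (use ev in \<open>auto elim: eventually_mono\<close>)
  ultimately show ?thesis by (simp add: less_eq_prod_def)
qed

text \<open>A gap in one component spreads at once to the other: a gap in \<open>fst\<close> acts on
  \<open>snd\<close> through the strictly increasing \<open>h\<close>, and a gap in
  \<open>snd\<close> drives \<open>fst\<close> directly.\<close>

lemma flow_strong_mono:
  assumes "p \<le> q" "p \<noteq> q" "t > 0"
  shows "fst (flow t p) < fst (flow t q) \<and> snd (flow t p) < snd (flow t q)"
proof -
  have le: "fst (flow s p) \<le> fst (flow s q)" "snd (flow s p) \<le> snd (flow s q)" if "s \<ge> 0" for s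
    using flow_mono[OF assms(1) that] by (auto simp: less_eq_prod_def)
  show ?thesis
  proof (cases "fst p < fst q")
    case True
    have pos: "fst (flow s p) < fst (flow s q)" if "s \<ge> 0" for s
    proof -
      have "0 < exp (K * (s - 0)) * (fst (flow s q) - fst (flow s p))"
        using diff_growth[of 0 s p q 0] le that True by auto
      then show ?thesis by (simp add: zero_less_mult_iff)
    qed
    have "snd (flow 0 q) - snd (flow 0 p) < snd (flow t q) - snd (flow t p)"
      using \<open>t > 0\<close>
    proof (rule DERIV_pos_imp_increasing, intro exI conjI)
      fix s assume s: "0 \<le> s" "s \<le> t"
      show "((\<lambda>t. snd (flow t q) - snd (flow t p)) has_real_derivative
          h (fst (flow s q)) - h (fst (flow s p))) (at s)"
        by (intro DERIV_diff snd_flow_deriv)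
      show "0 < h (fst (flow s q)) - h (fst (flow s p))" using h_mono[OF pos[OF s(1)]] by simp
    qed
    then show ?thesis using pos[of t] assms by (auto simp: less_eq_prod_def)
  next
    case False
    then have lt: "snd p < snd q" and "fst p = fst q"
      using assms by (auto simp: less_eq_prod_def prod_eq_iff)
    have d: "snd q - snd p \<le> snd (flow s q) - snd (flow s p)" if "s \<ge> 0" for s
      using snd_diff_mono[of 0 s p q] le that by auto
    have "0 < (snd q - snd p) * t" using lt \<open>t > 0\<close> by simp
    also have "\<dots> \<le> exp (K * (t - 0)) * (fst (flow t q) - fst (flow t p))"
      using diff_growth[of 0 t p q "snd q - snd p"] le d \<open>t > 0\<close> lt \<open>fst p = fst q\<close> by auto
    finally have "fst (flow t p) < fst (flow t q)" by (simp add: zero_less_mult_iff)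
    then show ?thesis using d[of t] lt \<open>t > 0\<close> by auto
  qed
qed

section \<open>The entrance region and the entrance time\<close>

definition D :: "(real \<times> real) set" where
  "D = {p. 1 \<le> fst p \<and> K + 1 \<le> snd p}"

definition D' :: "(real \<times> real) set" where
  "D' = {p. 1 < fst p \<and> K + 1 < snd p}"

lemma closed_D: "closed D"
  unfolding D_def by (intro closed_Collect_conj closed_Collect_le continuous_intros)

lemma open_D': "open D'"
  unfolding D'_def by (intro open_Collect_conj open_Collect_less continuous_intros)

lemma D'_subset_D: "D' \<subseteq> D"
  by (auto simp: D_def D'_def)

lemma D_up: "p \<in> D \<Longrightarrow> p \<le> q \<Longrightarrow> q \<in> D"
  by (auto simp: D_def less_eq_prod_def)

text \<open>With \<open>(u, w)\<close> for the point, on the edge \<open>u = 1\<close> one has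
  \<open>u' \<ge> K + 1 - K = 1\<close>, which explains the bound \<open>K + 1\<close>, and
  \<open>w' \<ge> h 1 > 0\<close> throughout \<open>D\<close>. So the boundary is crossed strictly
  inwards.\<close>

lemma flow_D:
  assumes "p \<in> D" "t > 0"
  shows "flow t p \<in> D'"
proof -
  have "0 \<le> p" "0 \<noteq> p" using assms K_ge_1 by (auto simp: D_def less_eq_prod_def)
  then have pos: "fst (flow s p) > 0" if "s > 0" for s using flow_strong_mono[of 0 p s] that by simp
  have pos: "fst (flow s p) \<ge> 0" if "s \<ge> 0" for s
    using pos[of s] that \<open>0 \<le> p\<close> by (cases "s = 0") (auto simp: less_eq_prod_def)
  have snd: "snd (flow s p) \<ge> K + 1" if "s \<ge> 0" for s
    using snd_flow_growth[of 0 s 0 p] pos that assms by (auto simp: D_def)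
  have "0 < fst (flow 0 p) - 1 + 1 * (s - 0)" if "s > 0" for s using assms that by (auto simp: D_def)
  also have "fst (flow 0 p) - 1 + 1 * (s - 0) \<le> exp (K * (s - 0)) * (fst (flow s p) - 1)" if "s > 0" for s
  proof (rule fst_flow_growth)
    fix t :: real assume "0 \<le> t"
    then show "snd (flow t p) + G (fst (flow t p)) \<ge> K * (1 - fst (flow t p)) + 1"
      using snd[of t] pos[of t] G_bound[of "fst (flow t p)"] by (auto simp: algebra_simps abs_le_iff)
  qed (use that in auto)
  finally have fst: "fst (flow s p) > 1" if "s > 0" for s using that by (simp add: zero_less_mult_iff)
  have "fst (flow s p) \<ge> 1" if "s \<ge> 0" for s
    using fst[of s] that assms by (cases "s = 0") (auto simp: D_def)
  then have "snd (flow t p) \<ge> snd (flow 0 p) + h 1 * (t - 0)"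
    using \<open>t > 0\<close> by (intro snd_flow_growth) auto
  moreover have "h 1 * t > 0" using h_pos[of 1] \<open>t > 0\<close> by simp
  ultimately show ?thesis using fst[OF \<open>t > 0\<close>] assms by (auto simp: D_def D'_def)
qed

lemma flow_D_later:
  assumes "flow s p \<in> D" "s < t"
  shows "flow t p \<in> D'"
  using flow_D[OF assms(1), of "t - s"] assms(2) by (simp flip: flow_add)

text \<open>Every orbit enters \<open>D\<close> at most once, and \<open>A\<close> is \<open>exp (- T)\<close> for the (possibly
  negative) entrance time \<open>T\<close>, with \<open>exp (- \<infinity>) = 0\<close> for orbits that never enter.\<close>

definition A :: "real \<times> real \<Rightarrow> real" where
  "A p = Sup (insert 0 {r. 0 < r \<and> flow (- ln r) p \<in> D})"

text \<open>In \<open>D\<close> the second component grows at rate at least \<open>h 1\<close> from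
  a positive value, so an orbit that is at \<open>p\<close> now has been in \<open>D\<close> for a
  time of at most \<open>\<bar>snd p\<bar> / h 1\<close>.\<close>

lemma entrance_bdd: "bdd_above (insert 0 {r. 0 < r \<and> flow (- ln r) p \<in> D})"
proof (rule bdd_aboveI)
  fix r assume r: "r \<in> insert 0 {r. 0 < r \<and> flow (- ln r) p \<in> D}"
  show "r \<le> max 1 (exp (\<bar>snd p\<bar> / h 1))"
  proof (cases "r \<le> 1")
    case False
    let ?s = "ln r" and ?q = "flow (- ln r) p"
    have q: "?q \<in> D" and "?s > 0" using False r by auto
    have D: "flow t ?q \<in> D" if "t \<ge> 0" for t
      using flow_D[OF q, of t] q that D'_subset_D by (cases "t = 0") auto
    have "snd (flow ?s ?q) \<ge> snd (flow 0 ?q) + h 1 * (?s - 0)"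
      using D \<open>?s > 0\<close> by (intro snd_flow_growth) (auto simp: D_def)
    moreover have "snd ?q \<ge> 0" using q K_ge_1 by (auto simp: D_def)
    ultimately have "h 1 * ?s \<le> \<bar>snd p\<bar>" by simp
    then have "?s \<le> \<bar>snd p\<bar> / h 1" using h_pos[of 1] by (simp add: field_simps)
    then have "exp ?s \<le> exp (\<bar>snd p\<bar> / h 1)" by simp
    then have "r \<le> exp (\<bar>snd p\<bar> / h 1)" using False by simp
    then show ?thesis by simp
  qed simp
qed

lemma A_nonneg: "0 \<le> A p"
  unfolding A_def by (rule cSup_upper[OF _ entrance_bdd]) simp

text \<open>Forward invariance of \<open>D\<close> makes the admissible \<open>r\<close> an initial
  segment, and closedness of \<open>D\<close> makes the supremum attained. Superlevel sets of
  \<open>A\<close> are thus preimages of \<open>D\<close> under a fixed time map.\<close>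

lemma A_ge_iff:
  assumes "r > 0"
  shows "r \<le> A p \<longleftrightarrow> flow (- ln r) p \<in> D"
proof
  assume "flow (- ln r) p \<in> D"
  then show "r \<le> A p" unfolding A_def using assms by (intro cSup_upper[OF _ entrance_bdd]) simp
next
  assume r: "r \<le> A p"
  have later: "flow t p \<in> D" if "- ln r < t" for t
  proof -
    have "exp (- t) < r" using that assms by (metis exp_less_cancel_iff exp_ln minus_less_iff)
    then have "exp (- t) < A p" using r by simp
    then obtain r' where r': "r' \<in> insert 0 {r. 0 < r \<and> flow (- ln r) p \<in> D}" "exp (- t) < r'"
      unfolding A_def using less_cSup_iff[OF _ entrance_bdd] by blast
    moreover have "r' > 0" using r'(2) exp_gt_zero[of "- t"] by linarith
    moreover have "- ln r' < t" using r'(2) \<open>r' > 0\<close> by (metis exp_gt_zero ln_exp ln_less_cancel_iff minus_less_iff)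
    ultimately show ?thesis using flow_D_later[of "- ln r'" p t] D'_subset_D by auto
  qed
  have "((\<lambda>t. flow t p) \<longlongrightarrow> flow (- ln r) p) (at_right (- ln r))"
    using continuous_flow_time[of UNIV p]
    by (auto simp: continuous_on_eq_continuous_at isCont_def intro: filterlim_at_split[THEN iffD1, THEN conjunct2])
  from Lim_in_closed_set[OF closed_D eventually_mono[OF eventually_at_right_less later]
      trivial_limit_at_right_real this]
  show "flow (- ln r) p \<in> D" .
qed

text \<open>One direction is that \<open>D\<close> flows into \<open>D'\<close> at once; in the
  other, openness of \<open>D'\<close> puts the orbit into \<open>D\<close> already a little
  earlier.\<close>

lemma A_gt_iff:
  assumes "r > 0"
  shows "r < A p \<longleftrightarrow> flow (- ln r) p \<in> D'"
proof
  assume "r < A p"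
  then have "flow (- ln (A p)) p \<in> D" "- ln (A p) < - ln r"
    using A_ge_iff[of "A p" p] assms by auto
  then show "flow (- ln r) p \<in> D'" by (rule flow_D_later)
next
  assume *: "flow (- ln r) p \<in> D'"
  have "open ((\<lambda>t. flow t p) -` D')"
    using continuous_flow_time open_D' by (rule continuous_on_open_vimage[THEN iffD1, rule_format, OF open_UNIV, simplified])
  then obtain e where "e > 0" and e: "\<And>t. dist t (- ln r) < e \<Longrightarrow> flow t p \<in> D'"
    using * unfolding open_dist by (metis vimage_eq)
  have "flow (- ln r - e / 2) p \<in> D" using e[of "- ln r - e / 2"] \<open>e > 0\<close> D'_subset_D by (auto simp: dist_real_def)
  then have "exp (ln r + e / 2) \<le> A p" using A_ge_iff[of "exp (ln r + e / 2)" p] by (simp add: algebra_simps)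
  moreover have "r < exp (ln r + e / 2)" using \<open>e > 0\<close> assms by (metis exp_less_cancel_iff exp_ln less_add_same_cancel1 half_gt_zero)
  ultimately show "r < A p" by simp
qed

text \<open>\<open>A_gt_iff\<close> and \<open>A_ge_iff\<close> turn \<open>r' < A q\<close> and
  \<open>A q < r\<close> into preimages, under time maps, of the open set \<open>D'\<close> and of
  the open complement of \<open>D\<close>.\<close>

lemma continuous_A: "continuous_on UNIV A"
  unfolding continuous_on_eq_continuous_at[OF open_UNIV] isCont_def
proof (intro ballI order_tendstoI)
  fix p r assume "r < A p"
  show "\<forall>\<^sub>F q in at p. r < A q"
  proof (cases "r < 0")
    case True
    then show ?thesis by (intro always_eventually allI less_le_trans[OF _ A_nonneg])
  next
    case False
    obtain r' where r': "r < r'" "r' < A p" using dense[OF \<open>r < A p\<close>] by blast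
    then have "r' > 0" using False by simp
    have "open {q. flow (- ln r') q \<in> D'}"
      using open_vimage[OF open_D', of "flow (- ln r')"] continuous_flow by (simp add: vimage_def)
    moreover have "p \<in> {q. flow (- ln r') q \<in> D'}" using r' A_gt_iff[OF \<open>r' > 0\<close>, of p] by auto
    ultimately have "\<forall>\<^sub>F q in at p. flow (- ln r') q \<in> D'"
      using eventually_at_topological by blast
    then show ?thesis
      by (rule eventually_mono) (use A_gt_iff[OF \<open>r' > 0\<close>] r'(1) in \<open>blast intro: less_trans\<close>)
  qed
next
  fix p r assume "A p < r"
  then have "r > 0" using A_nonneg[of p] by simp
  have "open {q. flow (- ln r) q \<notin> D}"
    using open_vimage[of "- D" "flow (- ln r)"] closed_D continuous_flow by (simp add: vimage_def open_Compl)
  moreover have "p \<in> {q. flow (- ln r) q \<notin> D}" using \<open>A p < r\<close> A_ge_iff[OF \<open>r > 0\<close>, of p] by auto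
  ultimately have "\<forall>\<^sub>F q in at p. flow (- ln r) q \<notin> D"
    using eventually_at_topological by blast
  then show "\<forall>\<^sub>F q in at p. A q < r"
    using A_ge_iff[OF \<open>r > 0\<close>] by (auto elim!: eventually_mono simp: not_le[symmetric])
qed

lemma A_eqI:
  assumes "0 \<le> y" "\<And>r. 0 < r \<Longrightarrow> r \<le> A p \<longleftrightarrow> r \<le> y"
  shows "A p = y"
proof (rule antisym)
  show "A p \<le> y" using assms(2)[of "A p"] A_nonneg[of p] assms(1) by (cases "A p = 0") auto
  show "y \<le> A p" using assms(2)[of y] A_nonneg[of p] assms(1) by (cases "y = 0") auto
qed

lemma A_flow: "A (flow t p) = exp t * A p"
proof (rule A_eqI)
  fix r :: real assume "r > 0"
  have "r \<le> A (flow t p) \<longleftrightarrow> flow (- ln (r * exp (- t))) p \<in> D"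
    using A_ge_iff[OF \<open>r > 0\<close>, of "flow t p"] \<open>r > 0\<close> by (simp add: ln_mult algebra_simps flip: flow_add)
  also have "\<dots> \<longleftrightarrow> r * exp (- t) \<le> A p"
    using \<open>r > 0\<close> by (intro A_ge_iff[symmetric]) simp
  also have "\<dots> \<longleftrightarrow> r \<le> exp t * A p" by (simp add: exp_minus field_simps)
  finally show "r \<le> A (flow t p) \<longleftrightarrow> r \<le> exp t * A p" .
qed (use A_nonneg in simp)

lemma A_pos_iff: "0 < A p \<longleftrightarrow> (\<exists>t. flow t p \<in> D)"
proof
  assume "0 < A p"
  then show "\<exists>t. flow t p \<in> D" using A_ge_iff[of "A p" p] by auto
next
  assume "\<exists>t. flow t p \<in> D"
  then obtain t where "flow t p \<in> D" by blast
  then have "exp (- t) \<le> A p" using A_ge_iff[of "exp (- t)" p] by simp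
  then show "0 < A p" using exp_gt_zero[of "- t"] by linarith
qed

text \<open>The backward flow is not monotone, hence the restriction to points with a positive entrance time.\<close>

lemma A_mono:
  assumes "p \<le> q" "p \<notin> D"
  shows "A p \<le> A q"
proof (cases "A p = 0")
  case False
  then have pos: "A p > 0" using A_nonneg[of p] by simp
  have "\<not> 1 \<le> A p" using A_ge_iff[of 1 p] assms(2) by simp
  then have "flow (- ln (A p)) p \<le> flow (- ln (A p)) q"
    using assms(1) pos by (intro flow_mono) auto
  then show ?thesis using A_ge_iff[OF pos] D_up by blast
qed (simp add: A_nonneg)

section \<open>The signed entrance function and its zero set\<close>

definition a :: "real \<times> real \<Rightarrow> real" where
  "a p = A p - A (- p)"

lemma continuous_a: "continuous_on UNIV a"
  unfolding a_def
  by (intro continuous_intros continuous_A continuous_on_compose2[OF continuous_A]) auto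

lemma a_uminus: "a (- p) = - a p"
  by (simp add: a_def)

lemma a_flow: "a (flow t p) = exp t * a p"
  by (simp add: a_def A_flow right_diff_distrib flip: flow_uminus)

text \<open>An orbit entering both \<open>D\<close> and its negative would finally lie in
  \<open>D'\<close> and in the negative of \<open>D'\<close>, which are disjoint. So at most one of
  the two terms of \<open>a\<close> is nonzero, and the sign of \<open>a\<close> tells which region
  is entered.\<close>

lemma A_pos_excl: "A p > 0 \<Longrightarrow> A (- p) = 0"
proof (rule ccontr)
  assume "A p > 0" "A (- p) \<noteq> 0"
  then obtain s t where "flow s p \<in> D" "flow t (- p) \<in> D"
    using A_pos_iff[of p] A_pos_iff[of "- p"] A_nonneg[of "- p"] by force
  then have "flow (max s t + 1) p \<in> D'" "flow (max s t + 1) (- p) \<in> D'"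
    by (auto intro: flow_D_later)
  then show False by (auto simp: D'_def flow_uminus)
qed

lemma a_pos_iff: "0 < a p \<longleftrightarrow> 0 < A p"
  using A_pos_excl[of p] A_nonneg[of "- p"] unfolding a_def by fastforce

lemma a_pos_eq: "0 < a p \<Longrightarrow> a p = A p"
  using A_pos_excl[of p] by (simp add: a_pos_iff) (simp add: a_def)

lemma positive_enters:
  assumes "0 \<le> p" "p \<noteq> 0"
  shows "0 < a p"
proof -
  define q where "q = flow 1 p"
  have q: "fst q > 0" "snd q > 0"
    using flow_strong_mono[of 0 p 1] assms by (auto simp: q_def)
  \<comment> \<open>The choice \<open>K * \<xi> \<le> snd q\<close> gives
    \<open>u' \<ge> K * (\<xi> - u)\<close>, so the first component \<open>u\<close> never falls
    below \<xi> and the second one grows at the fixed rate \<open>h \<xi>\<close>.\<close>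
  define \<xi> where "\<xi> = min (fst q) (snd q / K)"
  have "\<xi> > 0" "\<xi> \<le> fst q" "K * \<xi> \<le> snd q"
    using q K_ge_1 by (auto simp: \<xi>_def min_def field_simps)
  have pos: "fst (flow t q) \<ge> 0" if "t \<ge> 0" for t
    using flow_mono[of 0 q t] q that by (auto simp: less_eq_prod_def)
  have snd: "snd (flow t q) \<ge> snd q" if "t \<ge> 0" for t
    using snd_flow_growth[of 0 t 0 q] pos that by auto
  have fst: "fst (flow t q) \<ge> \<xi>" if "t \<ge> 0" for t
  proof -
    have "fst (flow 0 q) - \<xi> + 0 * (t - 0) \<le> exp (K * (t - 0)) * (fst (flow t q) - \<xi>)"
    proof (rule fst_flow_growth)
      fix s :: real assume "0 \<le> s"
      then show "snd (flow s q) + G (fst (flow s q)) \<ge> K * (\<xi> - fst (flow s q)) + 0"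
        using snd[of s] pos[of s] G_bound[of "fst (flow s q)"] \<open>K * \<xi> \<le> snd q\<close>
        by (auto simp: algebra_simps abs_le_iff)
    qed (use that in auto)
    then have "0 \<le> exp (K * (t - 0)) * (fst (flow t q) - \<xi>)" using \<open>\<xi> \<le> fst q\<close> by simp
    then show ?thesis by (simp add: zero_le_mult_iff)
  qed
  define T where "T = (K + 1) / h \<xi>"
  have "T > 0" using K_ge_1 h_pos[OF \<open>\<xi> > 0\<close>] by (simp add: T_def)
  have sndT: "snd (flow t q) \<ge> K + 1" if "t \<ge> T" for t
  proof -
    have "snd (flow t q) \<ge> snd (flow 0 q) + h \<xi> * (t - 0)"
      using fst \<open>T > 0\<close> that by (intro snd_flow_growth) auto
    moreover have "h \<xi> * t \<ge> K + 1" using that h_pos[OF \<open>\<xi> > 0\<close>] by (simp add: T_def field_simps)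
    ultimately show ?thesis using q by simp
  qed
  \<comment> \<open>From time \<open>T\<close> on, \<open>u' \<ge> K * (1 - u) + 1\<close>. The gain
    of 1 over one unit of time makes up for the deficit \<open>u - 1 \<ge> - 1\<close> at time
    \<open>T\<close>.\<close>
  have "fst (flow T q) - 1 + 1 * (T + 1 - T) \<le> exp (K * (T + 1 - T)) * (fst (flow (T + 1) q) - 1)"
  proof (rule fst_flow_growth)
    fix s :: real assume "T \<le> s"
    then show "snd (flow s q) + G (fst (flow s q)) \<ge> K * (1 - fst (flow s q)) + 1"
      using sndT[of s] pos[of s] G_bound[of "fst (flow s q)"] \<open>T > 0\<close>
      by (auto simp: algebra_simps abs_le_iff)
  qed auto
  then have "0 \<le> exp K * (fst (flow (T + 1) q) - 1)" using pos[of T] \<open>T > 0\<close> by simp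
  then have "fst (flow (T + 1) q) \<ge> 1" by (simp add: zero_le_mult_iff)
  then have "flow (T + 1 + 1) p \<in> D"
    using sndT[of "T + 1"] unfolding flow_add[of "T + 1" 1] q_def[symmetric] by (simp add: D_def)
  then show ?thesis unfolding a_pos_iff A_pos_iff by blast
qed

lemma a_0 [simp]: "a 0 = 0"
  using a_uminus[of 0] by simp

text \<open>\<open>positive_enters\<close> for \<open>p\<close> and for \<open>- p\<close> excludes
  the closed first and third quadrants.\<close>

lemma a_eq_0_quadrant:
  assumes "a p = 0" "p \<noteq> 0"
  shows "0 < fst p \<and> snd p < 0 \<or> fst p < 0 \<and> 0 < snd p"
proof -
  have "\<not> 0 \<le> p" "\<not> 0 \<le> - p"
    using positive_enters[of p] positive_enters[of "- p"] assms by (auto simp: a_uminus)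
  then show ?thesis by (auto simp: less_eq_prod_def)
qed

text \<open>In the fourth quadrant the second component is negative and nondecreasing. If it stayed
  below \<open>- \<eta>\<close>, the first one would have to stay away from 0, lest it be pushed
  through 0, and would then lift the second one to 0 in finite time. The other quadrant follows by
  symmetry.\<close>

lemma stable_snd_small:
  assumes "a p = 0" "\<eta> > 0"
  shows "\<exists>T\<ge>0. \<forall>t\<ge>T. \<bar>snd (flow t p)\<bar> < \<eta>"
proof -
  have main: "\<exists>T\<ge>0. \<forall>t\<ge>T. \<bar>snd (flow t p)\<bar> < \<eta>" if p: "a p = 0" "fst p > 0" for p
  proof -
    have "p \<noteq> 0" using p by auto
    have ne: "fst (flow t p) \<noteq> 0" for t
      using a_eq_0_quadrant[of "flow t p"] p \<open>p \<noteq> 0\<close> by (auto simp: a_flow)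
    have pos: "fst (flow t p) > 0" if "t \<ge> 0" for t
    proof (rule ccontr)
      assume "\<not> fst (flow t p) > 0"
      then have "\<exists>s. 0 \<le> s \<and> s \<le> t \<and> fst (flow s p) = 0"
        using p that by (intro IVT2') (auto intro: continuous_fst_flow)
      then show False using ne by blast
    qed
    have neg: "snd (flow t p) < 0" if "t \<ge> 0" for t
      using a_eq_0_quadrant[of "flow t p"] pos[OF that] p \<open>p \<noteq> 0\<close> by (auto simp: a_flow)
    have mono: "snd (flow s p) \<le> snd (flow t p)" if "0 \<le> s" "s \<le> t" for s t
      using snd_flow_growth[of s t 0 p] pos that by (auto simp: less_imp_le)
    have "\<exists>T\<ge>0. snd (flow T p) > - \<eta>"
    proof (rule ccontr)
      assume "\<not> (\<exists>T\<ge>0. snd (flow T p) > - \<eta>)"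
      then have low: "snd (flow t p) \<le> - \<eta>" if "t \<ge> 0" for t using that by force
      \<comment> \<open>Below level \<open>- \<eta>\<close> the first component satisfies
        \<open>u' \<le> K * (u - 2 * \<xi>)\<close>, so \<open>2 * \<xi> - u\<close> at least
        doubles within time \<open>ln 2 / K\<close>. Once \<open>u < \<xi>\<close>, this makes
        \<open>u \<le> 0\<close>.\<close>
      define \<xi> where "\<xi> = \<eta> / (2 * K)"
      have \<xi>: "\<xi> > 0" "\<eta> / K = 2 * \<xi>" "K * \<xi> = \<eta> / 2" using \<open>\<eta> > 0\<close> K_ge_1 by (auto simp: \<xi>_def)
      have fst: "fst (flow t p) \<ge> \<xi>" if "t \<ge> 0" for t
      proof (rule ccontr)
        assume "\<not> fst (flow t p) \<ge> \<xi>"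
        define s where "s = t + ln 2 / K"
        have "s \<ge> t" using K_ge_1 by (simp add: s_def)
        have "- fst (flow t p) - (- (2 * \<xi>)) + 0 * (s - t) \<le> exp ((- K) * (s - t)) * (- fst (flow s p) - (- (2 * \<xi>)))"
        proof (rule exp_weighted_growth[OF \<open>t \<le> s\<close>])
          show "((\<lambda>t. - fst (flow t p)) has_real_derivative - (snd (flow t p) + G (fst (flow t p)))) (at t)" for t
            by (intro DERIV_minus fst_flow_deriv)
          fix r assume "t \<le> r"
          then show "(- K) * (- (2 * \<xi>) - - fst (flow r p)) + 0 \<le> - (snd (flow r p) + G (fst (flow r p)))"
            using low[of r] pos[of r] G_bound[of "fst (flow r p)"] \<xi>(3) \<open>t \<ge> 0\<close>
            by (auto simp: algebra_simps abs_le_iff)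
        qed auto
        also have "exp ((- K) * (s - t)) = 1 / 2"
          using K_ge_1 by (simp add: s_def exp_minus)
        finally have "fst (flow s p) \<le> 0"
          using \<open>\<not> fst (flow t p) \<ge> \<xi>\<close> by simp
        then show False using pos[of s] \<open>t \<le> s\<close> \<open>0 \<le> t\<close> by simp
      qed
      \<comment> \<open>At rate \<open>h \<xi>\<close> this time suffices to lift the second
        component from \<open>snd p\<close> to 0.\<close>
      define T where "T = - snd p / h \<xi>"
      have "T \<ge> 0" using neg[of 0] h_pos[OF \<xi>(1)] by (simp add: T_def field_simps)
      then have "snd (flow T p) \<ge> snd (flow 0 p) + h \<xi> * (T - 0)"
        using fst by (intro snd_flow_growth) auto
      also have "snd (flow 0 p) + h \<xi> * (T - 0) = 0" using h_pos[OF \<xi>(1)] by (simp add: T_def)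
      finally show False using neg[OF \<open>T \<ge> 0\<close>] by simp
    qed
    then obtain T where T: "T \<ge> 0" "snd (flow T p) > - \<eta>" by blast
    show ?thesis
    proof (intro exI[of _ T] conjI allI impI)
      fix t assume "T \<le> t"
      then show "\<bar>snd (flow t p)\<bar> < \<eta>" using mono[of T t] neg[of t] T by auto
    qed (rule T)
  qed
  consider "p = 0" | "fst p > 0" | "fst (- p) > 0"
    using a_eq_0_quadrant[OF assms(1)] by fastforce
  then show ?thesis
  proof cases
    case 1
    then show ?thesis using assms by (intro exI[of _ 0]) auto
  next
    case 2
    then show ?thesis using main assms(1) by blast
  next
    case 3
    from main[OF _ this] show ?thesis using assms(1) by (simp add: a_uminus flow_uminus)
  qed
qed

text \<open>Both terms of \<open>a\<close> are monotone, so without a strict increase they agree at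
  \<open>p\<close> and \<open>q\<close>. If a common value is positive, strong monotonicity puts the
  larger point into \<open>D'\<close> when the smaller one enters \<open>D\<close>, so their
  entrance times differ. If both vanish, both second components tend to 0 by
  \<open>stable_snd_small\<close>, although their gap is positive at time 1 and never shrinks
  afterwards.\<close>

lemma a_strict_mono:
  assumes "p \<le> q" "p \<noteq> q" "p \<notin> D" "- q \<notin> D"
  shows "a p < a q"
proof (rule ccontr)
  assume "\<not> a p < a q"
  have minus: "- q \<le> - p" using assms(1) by (auto simp: less_eq_prod_def)
  have eq: "A p = A q" "A (- p) = A (- q)"
    using \<open>\<not> a p < a q\<close> A_mono[OF assms(1,3)] A_mono[OF minus assms(4)] by (auto simp: a_def)
  have strict: "A p < A q" if "p \<le> q" "p \<noteq> q" "p \<notin> D" "0 < A p" for p q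
  proof -
    have "\<not> 1 \<le> A p" using A_ge_iff[of 1 p] that(3) by simp
    then have "- ln (A p) > 0" using that(4) by simp
    from flow_strong_mono[OF that(1,2) this] have "flow (- ln (A p)) q \<in> D'"
      using A_ge_iff[OF that(4), of p] by (auto simp: D_def D'_def)
    then show ?thesis using A_gt_iff[OF that(4)] by blast
  qed
  have "A p = 0" using strict[OF assms(1-3)] eq A_nonneg[of p] by force
  moreover have "A (- q) = 0" using strict[OF minus] assms eq A_nonneg[of "- q"] by force
  ultimately have a0: "a p = 0" "a q = 0" using eq by (auto simp: a_def)
  have fst: "fst (flow t p) \<le> fst (flow t q)" if "t \<ge> 0" for t
    using flow_mono[OF assms(1) that] by (auto simp: less_eq_prod_def)
  define \<epsilon> where "\<epsilon> = snd (flow 1 q) - snd (flow 1 p)"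
  have "\<epsilon> > 0" using flow_strong_mono[OF assms(1,2), of 1] by (simp add: \<epsilon>_def)
  then obtain T1 T2 where T: "T1 \<ge> 0" "\<And>t. t \<ge> T1 \<Longrightarrow> \<bar>snd (flow t p)\<bar> < \<epsilon> / 3"
     "T2 \<ge> 0" "\<And>t. t \<ge> T2 \<Longrightarrow> \<bar>snd (flow t q)\<bar> < \<epsilon> / 3"
    using stable_snd_small[OF a0(1), of "\<epsilon> / 3"] stable_snd_small[OF a0(2), of "\<epsilon> / 3"] by auto
  define t where "t = max 1 (max T1 T2)"
  have "\<epsilon> \<le> snd (flow t q) - snd (flow t p)"
    unfolding \<epsilon>_def by (rule snd_diff_mono) (auto simp: t_def intro: fst)
  moreover have "\<bar>snd (flow t p)\<bar> < \<epsilon> / 3" "\<bar>snd (flow t q)\<bar> < \<epsilon> / 3"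
    using T by (auto simp: t_def)
  ultimately show False using \<open>\<epsilon> > 0\<close> by linarith
qed

text \<open>While the first component is at least 1, the second stays above \<open>- (K + 1)\<close>
  and climbs at rate \<open>h 1\<close>, and the first has at most exponential decay; a start far
  enough to the right outlasts the climb. Applied to the dual system this gives a boundary point of
  \<open>D\<close> with \<open>b\<close> positive.\<close>

lemma enters_right: "\<exists>x\<ge>1. 0 < a (x, - (K + 1))"
proof -
  define T where "T = 2 * (K + 1) / h 1"
  have "T > 0" using h_pos[of 1] K_ge_1 by (simp add: T_def)
  \<comment> \<open>The lower bound for the velocity of the first component is
    \<open>K * (- c - u)\<close>, with rest point \<open>- c\<close>; \<open>T\<close> is the time
    of a climb from \<open>- (K + 1)\<close> to \<open>K + 1\<close> at rate \<open>h 1\<close>. The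
    factor \<open>exp (K * T)\<close> in \<open>x\<close> pays for the decay until then.\<close>
  define c where "c = (K + 1) / K"
  have "c > 0" "K * c = K + 1" using K_ge_1 by (auto simp: c_def)
  define x where "x = exp (K * T) * (2 + c)"
  have "1 * (2 + c) \<le> x" unfolding x_def using K_ge_1 \<open>T > 0\<close> \<open>c > 0\<close> by (intro mult_right_mono) auto
  then have "x > 1" using \<open>c > 0\<close> by simp
  let ?p = "(x, - (K + 1))"
  have large: "t \<le> T \<longrightarrow> fst (flow t ?p) > 1" if "0 \<le> t" for t
    using _ _ that
  proof (rule real_induct_closed)
    have "{t. 0 \<le> t \<and> \<not> (t \<le> T \<longrightarrow> fst (flow t ?p) > 1)} = {t. 0 \<le> t \<and> t \<le> T \<and> fst (flow t ?p) \<le> 1}"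
      by auto
    also have "closed \<dots>"
      by (intro closed_Collect_conj closed_Collect_le continuous_fst_flow continuous_intros)
    finally show "closed {t. 0 \<le> t \<and> \<not> (t \<le> T \<longrightarrow> fst (flow t ?p) > 1)}" .
  next
    fix t :: real
    assume "0 \<le> t" and IH: "\<And>s. 0 \<le> s \<Longrightarrow> s < t \<Longrightarrow> s \<le> T \<longrightarrow> fst (flow s ?p) > 1"
    show "t \<le> T \<longrightarrow> fst (flow t ?p) > 1"
    proof
      assume "t \<le> T"
      have fst: "fst (flow s ?p) \<ge> 1" if "0 \<le> s" "s \<le> t" for s
      proof (cases "t = 0")
        case True
        then show ?thesis using that \<open>x > 1\<close> by simp
      next
        case False
        have "continuous_on {0..t} (\<lambda>s. fst (flow s ?p))" by (rule continuous_fst_flow)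
        moreover have "closure {0..<t} = {0..t}" using False \<open>0 \<le> t\<close> by simp
        ultimately show ?thesis
          using IH \<open>t \<le> T\<close> that by (intro continuous_ge_on_closure[of "{0..<t}" "\<lambda>s. fst (flow s ?p)" s 1]) (auto intro: less_imp_le)
      qed
      have snd: "snd (flow s ?p) \<ge> - (K + 1)" if "0 \<le> s" "s \<le> t" for s
        using snd_flow_growth[of 0 s 0 ?p] fst that by force
      have "fst (flow 0 ?p) - (- c) + 0 * (t - 0) \<le> exp (K * (t - 0)) * (fst (flow t ?p) - (- c))"
      proof (rule fst_flow_growth[OF \<open>0 \<le> t\<close>])
        fix s :: real assume "0 \<le> s" "s \<le> t"
        then show "snd (flow s ?p) + G (fst (flow s ?p)) \<ge> K * (- c - fst (flow s ?p)) + 0"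
          using snd[of s] fst[of s] G_bound[of "fst (flow s ?p)"] \<open>K * c = K + 1\<close>
          by (auto simp: algebra_simps abs_le_iff)
      qed auto
      then have "x < exp (K * t) * (fst (flow t ?p) + c)" using \<open>c > 0\<close> by simp
      moreover have "exp (K * t) * (2 + c) \<le> x"
        unfolding x_def using \<open>t \<le> T\<close> \<open>c > 0\<close> K_ge_1 by (intro mult_right_mono) auto
      ultimately have "exp (K * t) * (2 + c) < exp (K * t) * (fst (flow t ?p) + c)" by linarith
      then show "fst (flow t ?p) > 1" by simp
    qed
  qed
  have "snd (flow T ?p) \<ge> snd (flow 0 ?p) + h 1 * (T - 0)"
    using large \<open>T > 0\<close> by (intro snd_flow_growth) (auto simp: less_imp_le)
  also have "snd (flow 0 ?p) + h 1 * (T - 0) = K + 1" using h_pos[of 1] by (simp add: T_def)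
  finally have "flow T ?p \<in> D" using large[of T] \<open>T > 0\<close> by (simp add: D_def)
  then have "0 < a ?p" unfolding a_pos_iff A_pos_iff by blast
  then show ?thesis using \<open>x > 1\<close> by (intro exI[of _ x]) auto
qed

text \<open>A large second component pushes the first one from - 1 to 1 within one unit of time.
  Applied to the dual system and reflected, this gives a point on the vertical edge of
  \<open>D\<close> with \<open>b\<close> negative.\<close>

lemma enters_top: "\<exists>w\<ge>K + 1. 0 < a (- 1, w)"
proof -
  \<comment> \<open>As long as \<open>u \<ge> - 2\<close>, the second component loses at most
    \<open>h 2\<close> in unit time and so stays above \<open>N\<close>, whence
    \<open>u' \<ge> K * (- 2 - u) + (N - 2 * K)\<close>. After unit time
    \<open>exp K * (u + 2) \<ge> 1 + N - 2 * K \<ge> 3 * exp K\<close>, that is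
    \<open>u \<ge> 1\<close>.\<close>
  define N where "N = 2 * K + 1 + 3 * exp K"
  define w where "w = N + h 2"
  have "N \<ge> K + 1" using K_ge_1 by (simp add: N_def)
  have "h 2 > 0" using h_pos[of 2] by simp
  let ?p = "(- 1, w) :: real \<times> real"
  have snd: "snd (flow t ?p) \<ge> N" if "0 \<le> t" "t \<le> 1" "\<And>s. 0 \<le> s \<Longrightarrow> s \<le> t \<Longrightarrow> fst (flow s ?p) \<ge> - 2" for t
  proof -
    have "snd (flow t ?p) \<ge> snd (flow 0 ?p) + h (- 2) * (t - 0)" using that by (intro snd_flow_growth) auto
    moreover have "h 2 * t \<le> h 2" using that \<open>h 2 > 0\<close> by (simp add: mult_left_le)
    ultimately show ?thesis by (simp add: w_def h_odd)
  qed
  have grow: "1 + (N - 2 * K) * t \<le> exp (K * t) * (fst (flow t ?p) + 2)"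
    if "0 \<le> t" "t \<le> 1" and fst: "\<And>s. 0 \<le> s \<Longrightarrow> s \<le> t \<Longrightarrow> fst (flow s ?p) \<ge> - 2" for t
  proof -
    have "fst (flow 0 ?p) - (- 2) + (N - 2 * K) * (t - 0) \<le> exp (K * (t - 0)) * (fst (flow t ?p) - (- 2))"
    proof (rule fst_flow_growth[OF \<open>0 \<le> t\<close>])
      show "N - 2 * K \<ge> 0" using K_ge_1 by (simp add: N_def)
      fix s :: real assume s: "0 \<le> s" "s \<le> t"
      have "\<bar>fst (flow s ?p)\<bar> \<le> fst (flow s ?p) + 4" using fst[OF s] by linarith
      then have "K * \<bar>fst (flow s ?p)\<bar> \<le> K * (fst (flow s ?p) + 4)" using K_ge_1 by (intro mult_left_mono) auto
      then show "snd (flow s ?p) + G (fst (flow s ?p)) \<ge> K * (- 2 - fst (flow s ?p)) + (N - 2 * K)"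
        using snd[of s] s fst \<open>t \<le> 1\<close> G_bound[of "fst (flow s ?p)"] by (auto simp: algebra_simps abs_le_iff)
    qed
    then show ?thesis by simp
  qed
  have large: "t \<le> 1 \<longrightarrow> fst (flow t ?p) > - 2" if "0 \<le> t" for t
    using _ _ that
  proof (rule real_induct_closed)
    have "{t. 0 \<le> t \<and> \<not> (t \<le> 1 \<longrightarrow> fst (flow t ?p) > - 2)} = {t. 0 \<le> t \<and> t \<le> 1 \<and> fst (flow t ?p) \<le> - 2}"
      by auto
    also have "closed \<dots>"
      by (intro closed_Collect_conj closed_Collect_le continuous_fst_flow continuous_intros)
    finally show "closed {t. 0 \<le> t \<and> \<not> (t \<le> 1 \<longrightarrow> fst (flow t ?p) > - 2)}" .
  next
    fix t :: real
    assume "0 \<le> t" and IH: "\<And>s. 0 \<le> s \<Longrightarrow> s < t \<Longrightarrow> s \<le> 1 \<longrightarrow> fst (flow s ?p) > - 2"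
    show "t \<le> 1 \<longrightarrow> fst (flow t ?p) > - 2"
    proof
      assume "t \<le> 1"
      have fst: "fst (flow s ?p) \<ge> - 2" if "0 \<le> s" "s \<le> t" for s
      proof (cases "t = 0")
        case False
        have "continuous_on {0..t} (\<lambda>s. fst (flow s ?p))" by (rule continuous_fst_flow)
        moreover have "closure {0..<t} = {0..t}" using False \<open>0 \<le> t\<close> by simp
        ultimately show ?thesis
          using IH \<open>t \<le> 1\<close> that by (intro continuous_ge_on_closure[of "{0..<t}" "\<lambda>s. fst (flow s ?p)" s "- 2"]) (auto intro: less_imp_le)
      qed (use that in auto)
      have "0 \<le> (N - 2 * K) * t" using \<open>0 \<le> t\<close> K_ge_1 by (simp add: N_def)
      then have "0 < exp (K * t) * (fst (flow t ?p) + 2)" using grow[OF \<open>0 \<le> t\<close> \<open>t \<le> 1\<close> fst] by linarith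
      then show "fst (flow t ?p) > - 2" by (simp add: zero_less_mult_iff)
    qed
  qed
  have "1 + (N - 2 * K) \<le> exp K * (fst (flow 1 ?p) + 2)"
    using grow[of 1] large by (auto simp: less_imp_le)
  then have "exp K * 3 \<le> exp K * (fst (flow 1 ?p) + 2)"
    unfolding N_def by linarith
  then have "fst (flow 1 ?p) \<ge> 1" by simp
  moreover have "snd (flow 1 ?p) \<ge> K + 1" using snd[of 1] large \<open>N \<ge> K + 1\<close> by (auto simp: less_imp_le intro: order_trans)
  ultimately have "flow 1 ?p \<in> D" by (simp add: D_def)
  then have "0 < a ?p" unfolding a_pos_iff A_pos_iff by blast
  then show ?thesis using \<open>N \<ge> K + 1\<close> \<open>h 2 > 0\<close> by (intro exI[of _ w]) (auto simp: w_def)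
qed

end

section \<open>Conjugacy with the linear saddle\<close>

definition mirror :: "real \<times> real \<Rightarrow> real \<times> real" where
  "mirror p = (fst p, - snd p)"

lemma mirror_mirror [simp]: "mirror (mirror p) = p"
  and mirror_0 [simp]: "mirror 0 = 0"
  and mirror_uminus: "mirror (- p) = - mirror p"
  by (auto simp: mirror_def zero_prod_def)

lemma continuous_mirror: "continuous_on S mirror"
  unfolding mirror_def by (intro continuous_intros)

lemma (in lienard) lienard_minus: "lienard (\<lambda>x. - G x) h K"
  by unfold_locales (use K_ge_1 G_lip h_lip G_odd h_odd h_mono in \<open>auto simp: abs_minus_commute\<close>)

text \<open>Reversing time and reflecting by \<open>mirror\<close> turns the system into the one with \<open>- G\<close>.\<close>

context lienard
begin

interpretation dual: lienard "\<lambda>x. - G x" h K by (rule lienard_minus)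

lemma dual_flow: "dual.flow t (mirror p) = mirror (flow (- t) p)"
proof -
  have "((\<lambda>t. mirror (flow (- t) p)) has_vector_derivative dual.L (mirror (flow (- t) p))) (at t)" for t
  proof -
    have "((\<lambda>t. fst (flow (- t) p)) has_real_derivative - (snd (flow (- t) p) + G (fst (flow (- t) p)))) (at t)"
      "((\<lambda>t. snd (flow (- t) p)) has_real_derivative - h (fst (flow (- t) p))) (at t)"
      using fst_flow_deriv[of p "- t"] snd_flow_deriv[of p "- t"]
      by (simp_all add: DERIV_mirror[of "\<lambda>t. fst (flow t p)"] DERIV_mirror[of "\<lambda>t. snd (flow t p)"])
    then show ?thesis
      unfolding mirror_def has_real_derivative_iff_has_vector_derivative dual.L_def
      by (auto intro!: has_vector_derivative_Pair has_vector_derivative_minus[where f' = "- h (fst (flow (- t) p))", simplified])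
  qed
  from dual.flow_unique[of "\<lambda>t. mirror (flow (- t) p)", OF this] show ?thesis by simp
qed

definition b :: "real \<times> real \<Rightarrow> real" where
  "b p = dual.a (mirror p)"

lemma continuous_b: "continuous_on UNIV b"
  unfolding b_def by (rule continuous_on_compose2[OF dual.continuous_a continuous_mirror]) auto

lemma b_uminus: "b (- p) = - b p"
  by (simp add: b_def mirror_uminus dual.a_uminus)

lemma b_0 [simp]: "b 0 = 0"
  by (simp add: b_def)

lemma b_flow: "b (flow t p) = exp (- t) * b p"
  using dual.a_flow[of "- t" "mirror p"] by (simp add: b_def dual_flow)

text \<open>Points with \<open>a p = 1\<close> form the boundary of \<open>D\<close>, parametrized by \<open>corner\<close>.\<close>

definition corner :: "real \<Rightarrow> real \<times> real" where
  "corner s = (1 + max s 0, K + 1 + max (- s) 0)"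

lemma a_corner: "a (corner s) = 1"
proof -
  have "1 \<le> A (corner s)" "\<not> 1 < A (corner s)"
    using A_ge_iff[of 1] A_gt_iff[of 1] by (auto simp: corner_def D_def D'_def)
  then have "A (corner s) = 1" by simp
  then show ?thesis using a_pos_iff[of "corner s"] a_pos_eq by simp
qed

lemma a_eq_1D:
  assumes "a p = 1"
  obtains s where "p = corner s"
proof -
  have "A p = 1" using a_pos_eq[of p] assms by simp
  then have "p \<in> D" "p \<notin> D'" using A_ge_iff[of 1 p] A_gt_iff[of 1 p] by auto
  then have "p = corner (fst p - snd p + K)"
    by (cases p) (auto simp: D_def D'_def corner_def max_def)
  then show thesis by (rule that)
qed

lemma corner_D: "fst (corner s) \<ge> 1" "snd (corner s) > 0" "snd (corner s) \<ge> K + 1"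
  using K_ge_1 by (auto simp: corner_def)

lemma corner_diff: "fst (corner s) - snd (corner s) = s - K"
  by (simp add: corner_def max_def)

lemma mirror_corner_notin_D: "mirror (corner s) \<notin> D" "- mirror (corner s) \<notin> D"
  using corner_D[of s] K_ge_1 by (auto simp: mirror_def D_def)

text \<open>The boundary of \<open>D\<close> descends to the right, so its mirror image is a chain
  for the componentwise order, and it avoids \<open>D\<close> and its negative. This is the
  situation of \<open>a_strict_mono\<close> for the dual system.\<close>

lemma b_corner_strict_mono:
  assumes "s < t"
  shows "b (corner s) < b (corner t)"
proof -
  have "fst (corner s) \<le> fst (corner t)" "snd (corner t) \<le> snd (corner s)"
    using assms by (simp_all add: corner_def max_def)
  then have "mirror (corner s) \<le> mirror (corner t)"
    by (simp add: mirror_def less_eq_prod_def)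
  moreover have "mirror (corner s) \<noteq> mirror (corner t)"
  proof
    assume "mirror (corner s) = mirror (corner t)"
    then have "mirror (mirror (corner s)) = mirror (mirror (corner t))" by simp
    then show False using corner_diff[of s] corner_diff[of t] assms by simp
  qed
  ultimately show ?thesis
    unfolding b_def by (rule dual.a_strict_mono) (simp_all add: mirror_corner_notin_D)
qed

lemma b_corner_bound: "\<bar>b (corner s)\<bar> < 1"
proof -
  have less: "dual.A p < 1" if "p \<notin> D" for p
    using dual.A_ge_iff[of 1 p] that by auto
  show ?thesis
    using less[OF mirror_corner_notin_D(1)[of s]] less[OF mirror_corner_notin_D(2)[of s]]
      dual.A_nonneg[of "mirror (corner s)"] dual.A_nonneg[of "- mirror (corner s)"]
    unfolding b_def dual.a_def by linarith
qed

lemma b_corner_pos: "\<exists>s. 0 < b (corner s)"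
proof -
  obtain x where "x \<ge> 1" "0 < dual.a (x, - (K + 1))" using dual.enters_right by blast
  moreover from this have "mirror (corner (x - 1)) = (x, - (K + 1))" by (simp add: mirror_def corner_def)
  ultimately show ?thesis by (intro exI[of _ "x - 1"]) (simp add: b_def)
qed

lemma b_corner_neg: "\<exists>s. b (corner s) < 0"
proof -
  obtain w where w: "w \<ge> K + 1" "0 < dual.a (- 1, w)" using dual.enters_top by blast
  then have "dual.a (1, - w) < 0" using dual.a_uminus[of "(- 1, w)"] by simp
  moreover have "mirror (corner (K + 1 - w)) = (1, - w)" using w(1) by (simp add: mirror_def corner_def)
  ultimately show ?thesis by (intro exI[of _ "K + 1 - w"]) (simp add: b_def)
qed

lemma continuous_b_corner: "continuous_on S (\<lambda>s. b (corner s))"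
  unfolding corner_def by (rule continuous_on_compose2[OF continuous_b]) (auto intro!: continuous_intros)

definition j\<^sub>1 :: real where "j\<^sub>1 = Inf (range (\<lambda>s. b (corner s)))"

definition j\<^sub>2 :: real where "j\<^sub>2 = Sup (range (\<lambda>s. b (corner s)))"

text \<open>Strict monotonicity keeps the extreme values from being attained, so the range is an
  open interval. It consists of the values of the invariant \<open>a p * b p\<close> on the section
  \<open>a p = 1\<close>.\<close>

lemma range_b_corner: "range (\<lambda>s. b (corner s)) = {j\<^sub>1<..<j\<^sub>2}"
proof -
  let ?\<beta> = "\<lambda>s. b (corner s)"
  have "- 1 \<le> ?\<beta> s" "?\<beta> s \<le> 1" for s using b_corner_bound[of s] by linarith+
  then have bdd: "bdd_above (range ?\<beta>)" "bdd_below (range ?\<beta>)"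
    unfolding bdd_above_def bdd_below_def by blast+
  show ?thesis
  proof (intro equalityI subsetI)
    fix v assume "v \<in> range ?\<beta>"
    then obtain s where v: "v = ?\<beta> s" by blast
    have "?\<beta> s < ?\<beta> (s + 1)" "?\<beta> (s - 1) < ?\<beta> s" by (auto intro: b_corner_strict_mono)
    moreover have "?\<beta> (s + 1) \<le> j\<^sub>2" "j\<^sub>1 \<le> ?\<beta> (s - 1)"
      using bdd by (auto simp: j\<^sub>1_def j\<^sub>2_def intro: cSup_upper cInf_lower)
    ultimately show "v \<in> {j\<^sub>1<..<j\<^sub>2}" by (auto simp: v)
  next
    fix v assume v: "v \<in> {j\<^sub>1<..<j\<^sub>2}"
    obtain s t where "?\<beta> s < v" "v < ?\<beta> t"
      using v bdd by (auto simp: j\<^sub>1_def j\<^sub>2_def less_cSup_iff cInf_less_iff)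
    moreover have "is_interval (range ?\<beta>)"
      using connected_continuous_image[OF continuous_b_corner connected_UNIV] by (simp add: is_interval_connected_1)
    ultimately show "v \<in> range ?\<beta>"
      unfolding is_interval_1 by (metis less_imp_le rangeI)
  qed
qed

text \<open>Having 0 inside the interval makes \<open>gauge\<close> below a nonnegative function,
  and the zero of \<open>b\<close> on the section marks the unstable curve.\<close>

lemma j_signs: "j\<^sub>1 < 0" "0 < j\<^sub>2"
proof -
  have "j\<^sub>1 < b (corner s) \<and> b (corner s) < j\<^sub>2" for s
    using rangeI[of "\<lambda>s. b (corner s)" s] by (simp add: range_b_corner)
  moreover obtain s t where "0 < b (corner s)" "b (corner t) < 0"
    using b_corner_pos b_corner_neg by blast
  ultimately show "j\<^sub>1 < 0" "0 < j\<^sub>2" by (blast intro: less_trans)+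
qed

lemma ab_flow: "a (flow t p) * b (flow t p) = a p * b p"
proof -
  have "a (flow t p) * b (flow t p) = (exp t * exp (- t)) * (a p * b p)"
    unfolding a_flow b_flow by (simp only: mult_ac)
  also have "exp t * exp (- t) = 1" by (simp add: exp_minus)
  finally show ?thesis by simp
qed

text \<open>An orbit with \<open>a\<close> positive meets the section \<open>a p = 1\<close> at time
  \<open>- ln (a p)\<close>, where the invariant \<open>a p * b p\<close> is just \<open>b\<close>.
  Questions about the pair of coordinates thus reduce to \<open>b\<close> along the boundary of
  \<open>D\<close>.\<close>

lemma reaches_corner:
  assumes "a p > 0"
  obtains s where "flow (- ln (a p)) p = corner s" "b (corner s) = a p * b p"
proof -
  have 1: "a (flow (- ln (a p)) p) = 1" using assms by (simp add: a_flow exp_minus)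
  then obtain s where s: "flow (- ln (a p)) p = corner s" by (rule a_eq_1D)
  moreover have "b (corner s) = a p * b p"
    using ab_flow[of "- ln (a p)" p] 1 unfolding s by simp
  ultimately show thesis by (rule that)
qed

lemma ab_bounds: "j\<^sub>1 < a p * b p \<and> a p * b p < j\<^sub>2"
proof -
  have *: "j\<^sub>1 < a p * b p \<and> a p * b p < j\<^sub>2" if "a p > 0" for p
  proof -
    from that obtain s where "b (corner s) = a p * b p" by (rule reaches_corner)
    then show ?thesis using rangeI[of "\<lambda>s. b (corner s)" s] by (simp add: range_b_corner)
  qed
  consider "a p > 0" | "a p = 0" | "a (- p) > 0" by (fastforce simp: a_uminus)
  then show ?thesis
    using * [of p] *[of "- p"] j_signs by cases (auto simp: a_uminus b_uminus)
qed

lemma ab_inj_nonzero: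
  assumes "a p = a q" "b p = b q" "a p \<noteq> 0"
  shows "p = q"
proof -
  have *: "p = q" if "a p = a q" "b p = b q" "a p > 0" for p q
  proof -
    have "a p > 0" "a q > 0" using that by auto
    obtain s where s: "flow (- ln (a p)) p = corner s" "b (corner s) = a p * b p"
      by (rule reaches_corner[of p]) (use \<open>a p > 0\<close> in auto)
    obtain t where t: "flow (- ln (a q)) q = corner t" "b (corner t) = a q * b q"
      by (rule reaches_corner[of q]) (use \<open>a q > 0\<close> in auto)
    have "s = t"
      using b_corner_strict_mono[of s t] b_corner_strict_mono[of t s] s(2) t(2) that
      by (cases s t rule: linorder_cases) auto
    then have "flow (- ln (a p)) p = flow (- ln (a p)) q" using s(1) t(1) that(1) by simp
    then show ?thesis by (rule inj_flow[THEN iffD1])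
  qed
  show ?thesis
  proof (cases "a p > 0")
    case False
    then have "- p = - q" using assms by (intro *) (auto simp: a_uminus b_uminus)
    then show ?thesis by simp
  qed (use * assms in auto)
qed

lemma b_eq_0_quadrant:
  assumes "b p = 0" "p \<noteq> 0"
  shows "0 < fst p \<and> 0 < snd p \<or> fst p < 0 \<and> snd p < 0"
proof -
  have "mirror p \<noteq> 0" using assms(2) by (cases p) (auto simp: mirror_def zero_prod_def)
  then show ?thesis using dual.a_eq_0_quadrant[of "mirror p"] assms(1) by (auto simp: b_def mirror_def)
qed

lemma a_b_eq_0: "a p = 0 \<Longrightarrow> b p = 0 \<Longrightarrow> p = 0"
  using a_eq_0_quadrant[of p] b_eq_0_quadrant[of p] by force

end

text \<open>Reinterpreting the locale makes the facts about \<open>b\<close> available for the dual system, too.\<close>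

context lienard
begin

interpretation dual: lienard "\<lambda>x. - G x" h K by (rule lienard_minus)

lemma dual_b: "dual.b p = a (mirror p)"
  by (simp add: dual.b_def)

text \<open>Passing to the dual system exchanges the two coordinates, so its
  \<open>ab_inj_nonzero\<close> covers the points with \<open>a p = 0\<close> and
  \<open>b p \<noteq> 0\<close>.\<close>

lemma ab_inj:
  assumes "a p = a q" "b p = b q"
  shows "p = q"
proof (cases "a p = 0")
  case False
  then show ?thesis using ab_inj_nonzero assms by blast
next
  case a0: True
  show ?thesis
  proof (cases "b p = 0")
    case True
    then show ?thesis using a_b_eq_0[of p] a_b_eq_0[of q] a0 assms by simp
  next
    case False
    have "dual.b (mirror p) = dual.b (mirror q)" using assms a0 by (simp add: dual_b)
    then have "mirror p = mirror q"
      using False assms by (intro dual.ab_inj_nonzero) (auto simp: b_def)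
    then have "mirror (mirror p) = mirror (mirror q)" by simp
    then show ?thesis by simp
  qed
qed

text \<open>A zero of \<open>dual.b\<close> on the section of the dual system is, after reflection,
  a point of the stable set with \<open>b\<close> equal to 1. Its orbit takes all positive values of
  \<open>b\<close>, and the point reflection gives the negative ones.\<close>

lemma b_axis: "\<exists>p. a p = 0 \<and> b p = y"
proof -
  have pos: "\<exists>p. a p = 0 \<and> b p = y" if "y > 0" for y
  proof -
    obtain s where s: "dual.b (corner s) = 0"
    proof -
      have "0 \<in> range (\<lambda>s. dual.b (corner s))"
        unfolding dual.range_b_corner using dual.j_signs by simp
      then show thesis using that by force
    qed
    let ?p = "flow (- ln y) (mirror (corner s))"
    have "a ?p = 0" using s by (simp add: a_flow dual_b)
    moreover have "b ?p = y" using that dual.a_corner[of s] unfolding b_flow by (simp add: b_def)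
    ultimately show ?thesis by blast
  qed
  consider "y > 0" | "y = 0" | "- y > 0" by linarith
  then show ?thesis
  proof cases
    case 3
    from pos[OF this] obtain p where "a p = 0" "b p = - y" by blast
    then show ?thesis by (intro exI[of _ "- p"]) (simp add: a_uminus b_uminus)
  next
    case 2
    then show ?thesis by (intro exI[of _ 0]) simp
  qed (rule pos)
qed

text \<open>The image of \<open>(a, b)\<close> is the region \<open>j\<^sub>1 < a b < j\<^sub>2\<close>. Since \<open>a b\<close> is invariant, the flow-equivariance
  survives the following rescaling of \<open>b\<close>, which maps that region onto the plane.\<close>

definition gauge :: "real \<Rightarrow> real" where
  "gauge v = max (v / j\<^sub>2) (v / j\<^sub>1)"

lemma gauge_scale: "r \<ge> 0 \<Longrightarrow> gauge (r * v) = r * gauge v"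
  unfolding gauge_def by (simp add: max_mult_distrib_left flip: times_divide_eq_right)

lemma gauge_nonneg: "0 \<le> gauge v"
  using j_signs unfolding gauge_def by (cases "v \<ge> 0") (auto simp: le_max_iff_disj divide_nonpos_neg)

lemma gauge_less_1_iff: "gauge v < 1 \<longleftrightarrow> j\<^sub>1 < v \<and> v < j\<^sub>2"
  using j_signs unfolding gauge_def by (auto simp: field_simps)

text \<open>\<open>gauge\<close> is the Minkowski functional of the interval from
  \<open>j\<^sub>1\<close> to \<open>j\<^sub>2\<close>. The invariant \<open>v = a p * b p\<close>
  becomes \<open>v / (1 - gauge v)\<close>, which ranges over all reals, and on both axes, where
  \<open>v = 0\<close>, nothing changes.\<close>

definition C :: "real \<times> real \<Rightarrow> real \<times> real" where
  "C p = (a p, b p / (1 - gauge (a p * b p)))"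

lemma gauge_ab: "gauge (a p * b p) < 1"
  using ab_bounds by (simp add: gauge_less_1_iff)

lemma C_flow: "C (flow t p) = (exp t * fst (C p), exp (- t) * snd (C p))"
  by (simp add: C_def ab_flow) (simp add: a_flow b_flow)

lemma C_uminus: "C (- p) = - C p"
  by (simp add: C_def a_uminus b_uminus)

lemma continuous_C: "continuous_on UNIV C"
proof -
  have "1 - gauge (a p * b p) \<noteq> 0" for p using gauge_ab[of p] by simp
  moreover have "continuous_on UNIV (\<lambda>p. gauge (a p * b p))"
    using j_signs unfolding gauge_def by (intro continuous_intros continuous_a continuous_b) auto
  ultimately show ?thesis
    unfolding C_def by (intro continuous_intros continuous_a continuous_b) auto
qed

text \<open>By positive homogeneity of \<open>gauge\<close>, the map
  \<open>v / (1 - gauge v)\<close> has the inverse \<open>u / (1 + gauge u)\<close>.\<close>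

lemma gauge_inverse:
  assumes "gauge v < 1"
  shows "v / (1 - gauge v) / (1 + gauge (v / (1 - gauge v))) = v"
proof -
  have "gauge (v / (1 - gauge v)) = gauge v / (1 - gauge v)"
    using gauge_scale[of "1 / (1 - gauge v)" v] assms by simp
  then have "1 + gauge (v / (1 - gauge v)) = 1 / (1 - gauge v)" using assms by (simp add: field_simps)
  then show ?thesis using assms by simp
qed

lemma inj_C: "inj C"
proof (rule injI)
  fix p q assume eq: "C p = C q"
  then have a: "a p = a q" by (simp add: C_def)
  have "b p = b q"
  proof (cases "a p = 0")
    case True
    then show ?thesis using eq a by (simp add: C_def gauge_def)
  next
    case False
    have "a p * b p / (1 - gauge (a p * b p)) = a q * b q / (1 - gauge (a q * b q))"
      using eq a by (simp add: C_def flip: times_divide_eq_right)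
    then have "a p * b p = a q * b q"
      using gauge_inverse[OF gauge_ab, of p] gauge_inverse[OF gauge_ab, of q] by metis
    then show ?thesis using False a by simp
  qed
  then show "p = q" using ab_inj a by blast
qed

lemma C_eq_0_iff: "C p = 0 \<longleftrightarrow> p = 0"
proof -
  have "C 0 = 0" using C_uminus[of 0] by (simp add: prod_eq_iff)
  then show ?thesis using inj_C by (metis injD)
qed

lemma surj_C: "surj C"
proof -
  have pos: "\<exists>p. C p = (x, y)" if "x > 0" for x y
  proof -
    \<comment> \<open>\<open>u\<close> is the invariant of the target point and \<open>v\<close> the
      value of \<open>a p * b p\<close> that the rescaling sends to it.\<close>
    define u where "u = x * y"
    define v where "v = u / (1 + gauge u)"
    have g: "gauge v = gauge u / (1 + gauge u)"
      using gauge_scale[of "1 / (1 + gauge u)" u] gauge_nonneg[of u] by (simp add: v_def)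
    have "gauge v < 1" and 1: "1 - gauge v = 1 / (1 + gauge u)"
      unfolding g using gauge_nonneg[of u] by (auto simp: field_simps)
    then have "v \<in> range (\<lambda>s. b (corner s))" by (simp add: range_b_corner gauge_less_1_iff)
    then obtain s where s: "b (corner s) = v" by blast
    let ?p = "flow (ln x) (corner s)"
    have "a ?p = x" "b ?p = v / x" using that s by (auto simp: a_flow b_flow a_corner exp_minus divide_inverse)
    then have "C ?p = (x, v / x / (1 - gauge v))" using that by (simp add: C_def)
    also have "v / x / (1 - gauge v) = y"
      unfolding 1 using that gauge_nonneg[of u] by (simp add: v_def u_def)
    finally show ?thesis by blast
  qed
  have "\<exists>p. C p = (x, y)" for x y
  proof -
    consider "x > 0" | "x = 0" | "- x > 0" by linarith
    then show ?thesis
    proof cases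
      case 2
      obtain p where "a p = 0" "b p = y" using b_axis by blast
      then show ?thesis using 2 by (intro exI[of _ p]) (simp add: C_def gauge_def)
    next
      case 3
      obtain p where "C p = (- x, - y)" using pos[OF 3] by blast
      then show ?thesis by (intro exI[of _ "- p"]) (simp add: C_uminus)
    qed (rule pos)
  qed
  then show ?thesis by (auto simp: surj_def) metis
qed

text \<open>Continuity of the inverse comes from invariance of domain.\<close>

lemma homeomorphism_C:
  obtains C' where "homeomorphism UNIV UNIV C C'"
proof -
  obtain C' where "homeomorphism UNIV (range C) C C'"
    by (rule invariance_of_domain_homeomorphism[OF open_UNIV continuous_C _ inj_C]) auto
  then show thesis by (intro that) (simp add: surj_C)
qed

end

section \<open>The desingularizing coordinate\<close>

lemma odd_lipschitz:
  fixes f :: "real \<Rightarrow> real"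
  assumes odd: "\<And>x. f (- x) = - f x"
    and lip: "\<And>x y. 0 \<le> x \<Longrightarrow> x < y \<Longrightarrow> \<bar>f x - f y\<bar> \<le> M * \<bar>x - y\<bar>"
  shows "\<bar>f x - f y\<bar> \<le> M * \<bar>x - y\<bar>"
proof -
  have nonneg: "\<bar>f x - f y\<bar> \<le> M * \<bar>x - y\<bar>" if "0 \<le> x" "0 \<le> y" for x y
    using lip[of x y] lip[of y x] that by (cases x y rule: linorder_cases) (auto simp: abs_minus_commute)
  have f0: "f 0 = 0" using odd[of 0] by simp
  have mixed: "\<bar>f x - f y\<bar> \<le> M * \<bar>x - y\<bar>" if "x \<le> 0" "0 \<le> y" for x y
  proof -
    have "\<bar>f x - f y\<bar> \<le> \<bar>f (- x)\<bar> + \<bar>f y\<bar>" by (simp add: odd)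
    also have "\<dots> \<le> M * (- x) + M * y" using nonneg[of "- x" 0] nonneg[of y 0] that f0 by simp
    also have "\<dots> = M * \<bar>x - y\<bar>" using that by (simp add: algebra_simps)
    finally show ?thesis .
  qed
  consider "0 \<le> x" "0 \<le> y" | "x \<le> 0" "0 \<le> y" | "0 \<le> x" "y \<le> 0" | "0 \<le> - x" "0 \<le> - y" by linarith
  then show ?thesis
  proof cases
    case 3
    then show ?thesis using mixed[of y x] by (simp add: abs_minus_commute)
  next
    case 4
    then show ?thesis using nonneg[of "- x" "- y"] by (simp add: odd abs_minus_commute)
  qed (use nonneg mixed in auto)
qed

lemma odd_strict_mono:
  fixes f :: "real \<Rightarrow> real"
  assumes odd: "\<And>x. f (- x) = - f x"
    and mono: "\<And>x y. 0 \<le> x \<Longrightarrow> x < y \<Longrightarrow> f x < f y"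
    and "x < y"
  shows "f x < f y"
proof -
  have f0: "f 0 = 0" using odd[of 0] by simp
  consider "0 \<le> x" | "x < 0" "0 \<le> y" | "y < 0" by linarith
  then show ?thesis
  proof cases
    case 2
    then have "f x < 0" using mono[of 0 "- x"] odd[of x] f0 by simp
    moreover have "0 \<le> f y" using mono[of 0 y] 2 f0 by (cases "y = 0") auto
    ultimately show ?thesis by simp
  next
    case 3
    then show ?thesis using mono[of "- y" "- x"] odd \<open>x < y\<close> by simp
  qed (use mono \<open>x < y\<close> in auto)
qed

lemma eventually_ne_of_deriv:
  fixes f :: "real \<Rightarrow> real"
  assumes "(f has_real_derivative D) (at x)" "D \<noteq> 0"
  shows "\<forall>\<^sub>F y in at x. f y \<noteq> f x"
proof -
  have "((\<lambda>y. (f y - f x) / (y - x)) \<longlongrightarrow> D) (at x)"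
    using assms(1) by (simp add: has_field_derivative_iff)
  then have "\<forall>\<^sub>F y in at x. (f y - f x) / (y - x) \<noteq> 0"
    using assms(2) by (rule tendsto_imp_eventually_ne)
  then show ?thesis by (rule eventually_mono) auto
qed

text \<open>The mean value inequality for \<open>f r - r *\<^sub>R v\<close> on either side of
  \<open>t\<close>. It recovers the derivative of a trajectory at a crossing of the axis from its
  derivative nearby.\<close>

lemma has_vector_derivative_of_limit:
  fixes f :: "real \<Rightarrow> 'a::euclidean_space"
  assumes cont: "isCont f t" and ev: "\<forall>\<^sub>F r in at t. (f has_vector_derivative f' r) (at r)"
    and lim: "(f' \<longlongrightarrow> v) (at t)"
  shows "(f has_vector_derivative v) (at t)"
  unfolding has_vector_derivative_def has_derivative_at_alt
proof (intro conjI allI impI)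
  show "bounded_linear (\<lambda>x. x *\<^sub>R v)" by (rule bounded_linear_scaleR_left)
  fix e :: real assume "e > 0"
  then have "\<forall>\<^sub>F r in at t. dist (f' r) v < e" using lim by (simp add: tendsto_iff)
  with ev have "\<forall>\<^sub>F r in at t. (f has_vector_derivative f' r) (at r) \<and> dist (f' r) v < e"
    by eventually_elim simp
  then obtain d where "d > 0"
    and d: "\<And>r. r \<noteq> t \<Longrightarrow> dist r t < d \<Longrightarrow> (f has_vector_derivative f' r) (at r) \<and> dist (f' r) v < e"
    by (auto simp: eventually_at)
  have bound: "norm (f b - f a - (b - a) *\<^sub>R v) \<le> e * (b - a)"
    if "a < b" "\<And>r. a \<le> r \<Longrightarrow> r \<le> b \<Longrightarrow> dist r t < d" "t = a \<or> t = b" for a b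
  proof -
    have "norm ((f b - b *\<^sub>R v) - (f a - a *\<^sub>R v)) \<le> e * b - e * a"
    proof (rule differentiable_bound_general[OF \<open>a < b\<close>])
      have "isCont f r" if "a \<le> r" "r \<le> b" for r
        using cont d[of r] \<open>\<And>r. a \<le> r \<Longrightarrow> r \<le> b \<Longrightarrow> dist r t < d\<close>[OF that]
        by (cases "r = t") (auto dest: has_vector_derivative_continuous)
      then show "continuous_on {a..b} (\<lambda>r. f r - r *\<^sub>R v)"
        by (intro continuous_intros continuous_at_imp_continuous_on) auto
      show "continuous_on {a..b} (\<lambda>r. e * r)" by (intro continuous_intros)
      fix r assume r: "a < r" "r < b"
      then have r': "r \<noteq> t" "dist r t < d" using that by auto
      show "((\<lambda>r. f r - r *\<^sub>R v) has_vector_derivative f' r - v) (at r)"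
        using d[OF r'] by (auto intro!: derivative_eq_intros)
      show "((\<lambda>r. e * r) has_vector_derivative e) (at r)"
        by (auto intro!: derivative_eq_intros simp flip: has_real_derivative_iff_has_vector_derivative)
      show "norm (f' r - v) \<le> e" using d[OF r'] by (simp add: dist_norm)
    qed
    then show ?thesis by (simp add: algebra_simps)
  qed
  show "\<exists>d>0. \<forall>y. norm (y - t) < d \<longrightarrow> norm (f y - f t - (y - t) *\<^sub>R v) \<le> e * norm (y - t)"
  proof (intro exI[of _ d] conjI allI impI \<open>d > 0\<close>)
    fix y assume y: "norm (y - t) < d"
    consider "t < y" | "t = y" | "y < t" by linarith
    then show "norm (f y - f t - (y - t) *\<^sub>R v) \<le> e * norm (y - t)"
    proof cases
      case 1
      then show ?thesis using bound[of t y] y by (auto simp: dist_real_def)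
    next
      case 3
      then have "norm (f t - f y - (t - y) *\<^sub>R v) \<le> e * (t - y)"
        using y by (intro bound) (auto simp: dist_real_def)
      moreover have "f y - f t - (y - t) *\<^sub>R v = - (f t - f y - (t - y) *\<^sub>R v)"
        by (simp add: algebra_simps)
      ultimately show ?thesis using 3 by (metis abs_minus_commute abs_of_pos diff_gt_0_iff_gt norm_minus_cancel real_norm_def)
    qed simp
  qed
qed

text \<open>Quadratic at 0, so that the factor \<kappa>' vanishes there and turns even the jump of
  the sign function (\<alpha> = 0) into a Lipschitz term; asymptotic to \<open>u - 1\<close> and
  \<open>u + 1\<close> at the two ends, so that Lipschitz bounds remain global.\<close>

definition \<kappa> :: "real \<Rightarrow> real" where
  "\<kappa> u = u * \<bar>u\<bar> / (1 + \<bar>u\<bar>)"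

definition \<kappa>' :: "real \<Rightarrow> real" where
  "\<kappa>' u = 1 - 1 / (1 + \<bar>u\<bar>)\<^sup>2"

lemma \<kappa>_0 [simp]: "\<kappa> 0 = 0" and \<kappa>_minus: "\<kappa> (- u) = - \<kappa> u" and \<kappa>'_minus: "\<kappa>' (- u) = \<kappa>' u"
  by (auto simp: \<kappa>_def \<kappa>'_def)

lemma \<kappa>'_pos: "u \<noteq> 0 \<Longrightarrow> \<kappa>' u > 0" and \<kappa>'_nonneg: "\<kappa>' u \<ge> 0" and \<kappa>'_le_1: "\<kappa>' u \<le> 1"
  and \<kappa>'_eq_0_iff: "\<kappa>' u = 0 \<longleftrightarrow> u = 0"
proof -
  have "(1 + \<bar>u\<bar>)\<^sup>2 \<ge> 1" by (rule one_le_power) simp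
  then show "\<kappa>' u \<ge> 0" "\<kappa>' u \<le> 1" by (auto simp: \<kappa>'_def)
  have pos: "\<kappa>' u > 0" if "u \<noteq> 0"
  proof -
    have "(1 + \<bar>u\<bar>)\<^sup>2 > 1" using that by (intro one_less_power) auto
    then show ?thesis by (simp add: \<kappa>'_def)
  qed
  then show "u \<noteq> 0 \<Longrightarrow> \<kappa>' u > 0" .
  show "\<kappa>' u = 0 \<longleftrightarrow> u = 0" proof (cases "u = 0")
    case False
    then show ?thesis using pos[OF False] by simp
  qed (simp add: \<kappa>'_def)
qed

lemma \<kappa>'_alt: "u \<ge> 0 \<Longrightarrow> \<kappa>' u = u * (2 + u) / (1 + u)\<^sup>2"
proof -
  assume "u \<ge> 0"
  then have "\<kappa>' u = ((1 + u)\<^sup>2 - 1) / (1 + u)\<^sup>2" by (simp add: \<kappa>'_def diff_divide_distrib)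
  also have "(1 + u)\<^sup>2 - 1 = u * (2 + u)" by (simp add: power2_eq_square algebra_simps)
  finally show ?thesis .
qed

lemma continuous_\<kappa>': "continuous_on S \<kappa>'"
proof -
  have "1 + \<bar>u\<bar> \<noteq> (0::real)" for u by (metis abs_ge_zero add_nonneg_eq_0_iff zero_le_one zero_neq_one)
  then show ?thesis unfolding \<kappa>'_def by (intro continuous_intros) auto
qed

lemma \<kappa>_deriv: "(\<kappa> has_real_derivative \<kappa>' u) (at u)"
proof -
  have pos: "(\<kappa> has_real_derivative \<kappa>' u) (at u)" if "u > 0" for u
  proof -
    have "((\<lambda>u. u * u / (1 + u)) has_real_derivative \<kappa>' u) (at u)"
      using that by (auto intro!: derivative_eq_intros simp: \<kappa>'_alt power2_eq_square algebra_simps)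
    moreover have "\<forall>\<^sub>F x in nhds u. u * u / (1 + u) = \<kappa> u"
      using that by (simp add: \<kappa>_def)
    ultimately show ?thesis
      using that eventually_nhds_in_open[of "{0<..}" u]
      by (subst DERIV_cong_ev[OF refl _ refl, of _ "\<lambda>u. u * u / (1 + u)"])
        (auto elim!: eventually_mono simp: \<kappa>_def)
  qed
  consider "u > 0" | "u = 0" | "- u > 0" by linarith
  then show ?thesis
  proof cases
    case 2
    have "((\<lambda>h::real. \<bar>h\<bar> / (1 + \<bar>h\<bar>)) \<longlongrightarrow> \<bar>0\<bar> / (1 + \<bar>0\<bar>)) (at 0)"
      by (intro tendsto_intros) auto
    then have "((\<lambda>h::real. \<bar>h\<bar> / (1 + \<bar>h\<bar>)) \<longlongrightarrow> 0) (at 0)" by simp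
    then have "((\<lambda>h. (\<kappa> (0 + h) - \<kappa> 0) / h) \<longlongrightarrow> 0) (at 0)"
      by (rule Lim_transform_eventually) (auto simp: eventually_at_filter \<kappa>_def)
    then show ?thesis using 2 by (simp add: DERIV_def \<kappa>'_def)
  next
    case 3
    have "((\<lambda>u. - \<kappa> (- u)) has_real_derivative \<kappa>' (- u)) (at u)"
      by (rule DERIV_minus[OF DERIV_mirror[THEN iffD1, OF pos[OF 3]], simplified])
    then show ?thesis by (simp add: \<kappa>_minus \<kappa>'_minus)
  qed (rule pos)
qed

lemma continuous_\<kappa>: "continuous_on S \<kappa>"
  by (meson DERIV_isCont \<kappa>_deriv continuous_at_imp_continuous_on)

lemma \<kappa>_strict_mono: "u < v \<Longrightarrow> \<kappa> u < \<kappa> v"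
proof (rule odd_strict_mono[of \<kappa>, OF \<kappa>_minus])
  fix x y :: real assume xy: "0 \<le> x" "x < y"
  show "\<kappa> x < \<kappa> y"
    by (rule DERIV_pos_imp_increasing_open[OF xy(2)])
       (use xy in \<open>auto intro!: exI \<kappa>_deriv \<kappa>'_pos continuous_\<kappa>\<close>)
qed

lemma \<kappa>_eq_iff: "\<kappa> u = \<kappa> v \<longleftrightarrow> u = v"
  using \<kappa>_strict_mono[of u v] \<kappa>_strict_mono[of v u] by (cases u v rule: linorder_cases) auto

lemma \<kappa>_eq_0_iff: "\<kappa> u = 0 \<longleftrightarrow> u = 0"
  using \<kappa>_eq_iff[of u 0] by simp

lemma \<kappa>_pos: "0 < u \<Longrightarrow> 0 < \<kappa> u"
  using \<kappa>_strict_mono[of 0 u] by simp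

lemma \<kappa>_le: "0 \<le> u \<Longrightarrow> \<kappa> u \<le> u"
  unfolding \<kappa>_def by (simp add: field_simps)

lemma \<kappa>_lipschitz: "\<bar>\<kappa> u - \<kappa> v\<bar> \<le> \<bar>u - v\<bar>"
proof -
  have *: "\<bar>\<kappa> u - \<kappa> v\<bar> \<le> \<bar>u - v\<bar>" if lt: "u < v" for u v
  proof -
    obtain z where "\<kappa> v - \<kappa> u = (v - u) * \<kappa>' z" using MVT2[OF lt \<kappa>_deriv] by blast
    moreover have "(v - u) * \<kappa>' z \<le> (v - u) * 1" using lt \<kappa>'_le_1 by (intro mult_left_mono) auto
    ultimately have "\<kappa> v - \<kappa> u \<le> v - u" by simp
    then show ?thesis using \<kappa>_strict_mono[OF lt] lt by simp
  qed
  show ?thesis using *[of u v] *[of v u] by (cases u v rule: linorder_cases) auto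
qed

lemma surj_\<kappa>: "surj \<kappa>"
proof -
  have pos: "\<exists>u. \<kappa> u = x" if "x \<ge> 0" for x
  proof -
    have "\<exists>u. 0 \<le> u \<and> u \<le> 2 * x + 1 \<and> \<kappa> u = x"
    proof (rule IVT')
      have "x * (2 * x + 2) \<le> (2 * x + 1) * (2 * x + 1)" using that by (simp add: algebra_simps)
      then show "x \<le> \<kappa> (2 * x + 1)" using that by (simp add: \<kappa>_def field_simps)
    qed (use that continuous_\<kappa> in auto)
    then show ?thesis by blast
  qed
  have "\<exists>u. \<kappa> u = x" for x
  proof (cases "x \<ge> 0")
    case False
    then obtain u where "\<kappa> u = - x" using pos[of "- x"] by auto
    then have "\<kappa> (- u) = x" by (simp add: \<kappa>_minus)
    then show ?thesis by blast
  qed (rule pos)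
  then show ?thesis unfolding surj_def by metis
qed

section \<open>The signed power and the regularized force term\<close>

definition spow :: "real \<Rightarrow> real \<Rightarrow> real" where
  "spow \<alpha> x = sgn x * \<bar>x\<bar> powr \<alpha>"

lemma spow_minus: "spow \<alpha> (- x) = - spow \<alpha> x"
  by (simp add: spow_def sgn_minus)

lemma spow_pos: "0 < x \<Longrightarrow> spow \<alpha> x = x powr \<alpha>"
  by (simp add: spow_def)

lemma isCont_spow: "x \<noteq> 0 \<Longrightarrow> isCont (spow \<alpha>) x"
  unfolding spow_def by (auto intro!: continuous_intros)

text \<open>Within distance \<open>\<bar>x\<^sub>0\<bar> / 2\<close> the sign is constant, and the
  mean value theorem bounds the slope by \<open>r powr (\<alpha> - 1)\<close>.\<close>

lemma spow_local_lipschitz: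
  assumes \<alpha>: "0 \<le> \<alpha>" "\<alpha> \<le> 1" and "x\<^sub>0 \<noteq> 0"
  obtains M where "M \<ge> 0"
    "\<And>x y. \<bar>x - x\<^sub>0\<bar> \<le> \<bar>x\<^sub>0\<bar> / 2 \<Longrightarrow> \<bar>y - x\<^sub>0\<bar> \<le> \<bar>x\<^sub>0\<bar> / 2 \<Longrightarrow> \<bar>spow \<alpha> x - spow \<alpha> y\<bar> \<le> M * \<bar>x - y\<bar>"
proof -
  define r where "r = \<bar>x\<^sub>0\<bar> / 2"
  have "r > 0" using \<open>x\<^sub>0 \<noteq> 0\<close> by (simp add: r_def)
  define M where "M = r powr (\<alpha> - 1)"
  have lt: "\<bar>spow \<alpha> x - spow \<alpha> y\<bar> \<le> M * \<bar>x - y\<bar>" if "r \<le> x" "x < y" for x y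
  proof -
    have "\<exists>z. x < z \<and> z < y \<and> y powr \<alpha> - x powr \<alpha> = (y - x) * (\<alpha> * z powr (\<alpha> - 1))"
      using that \<open>r > 0\<close> by (intro MVT2) (auto intro!: has_real_derivative_powr)
    then obtain z where z: "x < z" "y powr \<alpha> - x powr \<alpha> = (y - x) * (\<alpha> * z powr (\<alpha> - 1))" by blast
    have "\<alpha> * z powr (\<alpha> - 1) \<le> 1 * M"
      unfolding M_def using \<alpha> z(1) that \<open>r > 0\<close> by (intro mult_mono powr_mono2') auto
    then have "(y - x) * (\<alpha> * z powr (\<alpha> - 1)) \<le> (y - x) * M"
      using that by (intro mult_left_mono) auto
    moreover have "x powr \<alpha> \<le> y powr \<alpha>" using that \<alpha> \<open>r > 0\<close> by (intro powr_mono2) auto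
    ultimately show ?thesis using z(2) that \<open>r > 0\<close> by (simp add: spow_pos mult.commute)
  qed
  have pos: "\<bar>spow \<alpha> x - spow \<alpha> y\<bar> \<le> M * \<bar>x - y\<bar>" if "r \<le> x" "r \<le> y" for x y
    using lt[of x y] lt[of y x] that by (cases x y rule: linorder_cases) (auto simp: abs_minus_commute)
  show thesis
  proof (rule that)
    show "M \<ge> 0" by (simp add: M_def)
    fix x y assume xy: "\<bar>x - x\<^sub>0\<bar> \<le> \<bar>x\<^sub>0\<bar> / 2" "\<bar>y - x\<^sub>0\<bar> \<le> \<bar>x\<^sub>0\<bar> / 2"
    then have "r \<le> x \<and> r \<le> y \<or> r \<le> - x \<and> r \<le> - y"
      unfolding r_def using \<open>x\<^sub>0 \<noteq> 0\<close> by linarith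
    then show "\<bar>spow \<alpha> x - spow \<alpha> y\<bar> \<le> M * \<bar>x - y\<bar>"
      using pos[of x y] pos[of "- x" "- y"] by (auto simp: spow_minus abs_minus_commute)
  qed
qed

context
  fixes \<alpha> :: real
  assumes \<alpha>: "0 \<le> \<alpha>" "\<alpha> \<le> 1"
begin

lemma powr_le_1_plus: "0 \<le> x \<Longrightarrow> x powr \<alpha> \<le> 1 + x"
  using \<alpha> powr_mono[of \<alpha> 1 x] powr_le1[of \<alpha> x] by (cases "x \<le> 1") auto

text \<open>Mean value theorem away from 0, and direct comparison with the value 0 at the origin,
  where the power need not be differentiable. The slope has two terms: one at most 5, because the
  square of \<kappa>' is at most 1 and at most 4 \<kappa>, and one at most 2, from the second
  derivative of \<kappa>.\<close>

lemma spow_\<kappa>_lipschitz: "\<bar>spow \<alpha> (\<kappa> u) * \<kappa>' u - spow \<alpha> (\<kappa> v) * \<kappa>' v\<bar> \<le> 7 * \<bar>u - v\<bar>"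
proof (rule odd_lipschitz)
  show "spow \<alpha> (\<kappa> (- u)) * \<kappa>' (- u) = - (spow \<alpha> (\<kappa> u) * \<kappa>' u)" for u
    by (simp add: \<kappa>_minus \<kappa>'_minus spow_minus)
  fix u v :: real assume uv: "0 \<le> u" "u < v"
  show "\<bar>spow \<alpha> (\<kappa> u) * \<kappa>' u - spow \<alpha> (\<kappa> v) * \<kappa>' v\<bar> \<le> 7 * \<bar>u - v\<bar>"
  proof (cases "u = 0")
    case True
    have "\<kappa> v powr \<alpha> * \<kappa>' v \<le> (1 + \<kappa> v) * \<kappa>' v"
      using powr_le_1_plus \<kappa>_pos[of v] uv \<kappa>'_nonneg by (intro mult_right_mono) auto
    also have "\<dots> \<le> (1 + v) * \<kappa>' v" using \<kappa>_le[of v] uv \<kappa>'_nonneg by (intro mult_right_mono) auto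
    also have "\<dots> = v * ((2 + v) / (1 + v))"
      using uv by (simp add: \<kappa>'_alt power2_eq_square)
    also have "\<dots> \<le> v * 7" using uv by (intro mult_left_mono) (auto simp: field_simps)
    finally have "\<kappa> v powr \<alpha> * \<kappa>' v \<le> 7 * v" by simp
    then show ?thesis using True uv \<kappa>_pos[of v] \<kappa>'_nonneg[of v] by (simp add: spow_pos spow_def)
  next
    case False
    define H' where "H' z = (\<alpha> * \<kappa> z powr (\<alpha> - 1) * \<kappa>' z) * \<kappa>' z + \<kappa> z powr \<alpha> * (2 / (1 + z) ^ 3)" for z
    have "\<exists>z. u < z \<and> z < v \<and> \<kappa> v powr \<alpha> * \<kappa>' v - \<kappa> u powr \<alpha> * \<kappa>' u = (v - u) * H' z"
    proof (rule MVT2[OF \<open>u < v\<close>])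
      fix z assume "u \<le> z" "z \<le> v"
      then have "z > 0" using uv False by simp
      have d1: "((\<lambda>z. \<kappa> z powr \<alpha>) has_real_derivative \<alpha> * \<kappa> z powr (\<alpha> - 1) * \<kappa>' z) (at z)"
        by (rule DERIV_chain2[OF has_real_derivative_powr[OF \<kappa>_pos[OF \<open>z > 0\<close>]] \<kappa>_deriv])
      have "((\<lambda>z. 1 - 1 / (1 + z)\<^sup>2) has_real_derivative - ((0 * (1 + z)\<^sup>2 - 1 * (2 * (1 + z))) / ((1 + z)\<^sup>2 * (1 + z)\<^sup>2))) (at z)"
        using \<open>z > 0\<close> by (auto intro!: derivative_eq_intros)
      also have "- ((0 * (1 + z)\<^sup>2 - 1 * (2 * (1 + z))) / ((1 + z)\<^sup>2 * (1 + z)\<^sup>2))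
          = 2 * (1 + z) / ((1 + z) ^ 3 * (1 + z))"
        by (simp add: power2_eq_square power3_eq_cube del: distrib_left_numeral)
      also have "\<dots> = 2 / (1 + z) ^ 3" using \<open>z > 0\<close> by (simp del: distrib_left_numeral)
      finally have "((\<lambda>z. 1 - 1 / (1 + z)\<^sup>2) has_real_derivative 2 / (1 + z) ^ 3) (at z)" .
      then have d2: "(\<kappa>' has_real_derivative 2 / (1 + z) ^ 3) (at z)"
        using \<open>z > 0\<close> eventually_nhds_in_open[of "{0<..}" z]
        by (subst DERIV_cong_ev[OF refl _ refl, of _ "\<lambda>z. 1 - 1 / (1 + z)\<^sup>2"])
          (auto elim!: eventually_mono simp: \<kappa>'_def)
      show "((\<lambda>z. \<kappa> z powr \<alpha> * \<kappa>' z) has_real_derivative H' z) (at z)"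
        unfolding H'_def using DERIV_mult[OF d1 d2] by (simp add: mult.commute add.commute)
    qed
    then obtain z where z: "u < z" "\<kappa> v powr \<alpha> * \<kappa>' v - \<kappa> u powr \<alpha> * \<kappa>' u = (v - u) * H' z" by blast
    have "z > 0" using z uv by simp
    note \<kappa>z = \<kappa>_pos[OF \<open>z > 0\<close>]
    \<comment> \<open>One bound for all exponents: the power is at most
      \<open>1 / \<kappa> z\<close> if \<open>\<kappa> z \<le> 1\<close>, and at most 1
      otherwise.\<close>
    have p: "\<kappa> z powr (\<alpha> - 1) \<le> 1 + 1 / \<kappa> z"
    proof (cases "\<kappa> z \<le> 1")
      case True
      have "\<kappa> z powr (\<alpha> - 1) \<le> \<kappa> z powr (- 1)" using True \<alpha> \<kappa>z by (intro powr_mono') auto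
      then show ?thesis using \<kappa>z by (simp add: powr_minus_divide)
    next
      case False
      then have "\<kappa> z powr (\<alpha> - 1) \<le> \<kappa> z powr 0" using \<alpha> by (intro powr_mono) auto
      also have "\<kappa> z powr 0 = 1" using \<kappa>z by simp
      also have "1 \<le> 1 + 1 / \<kappa> z" using \<kappa>z by simp
      finally show ?thesis .
    qed
    have q: "1 / \<kappa> z * (\<kappa>' z * \<kappa>' z) \<le> 4"
    proof -
      have "1 / \<kappa> z * (\<kappa>' z * \<kappa>' z) = ((2 + z) / (1 + z))\<^sup>2 / (1 + z)"
      proof -
        have "\<kappa>' z = z * (2 + z) / (1 + z)\<^sup>2" "\<kappa> z = z * z / (1 + z)"
          using \<open>z > 0\<close> by (auto simp: \<kappa>'_alt \<kappa>_def)
        then show ?thesis using \<open>z > 0\<close> by (simp add: power2_eq_square power_divide)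
      qed
      also have "\<dots> \<le> ((2 + z) / (1 + z))\<^sup>2" using \<open>z > 0\<close> by (simp add: divide_le_eq mult_le_cancel_left1)
      also have "\<dots> \<le> 2\<^sup>2" using \<open>z > 0\<close> by (intro power_mono) (auto simp: field_simps)
      finally show ?thesis by simp
    qed
    have "(\<alpha> * \<kappa> z powr (\<alpha> - 1) * \<kappa>' z) * \<kappa>' z \<le> 5"
    proof -
      have "(\<alpha> * \<kappa> z powr (\<alpha> - 1) * \<kappa>' z) * \<kappa>' z = \<alpha> * (\<kappa> z powr (\<alpha> - 1) * (\<kappa>' z * \<kappa>' z))" by simp
      also have "\<dots> \<le> 1 * ((1 + 1 / \<kappa> z) * (\<kappa>' z * \<kappa>' z))"
        using \<alpha> p \<kappa>'_nonneg \<kappa>z by (intro mult_mono) auto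
      also have "\<dots> = \<kappa>' z * \<kappa>' z + 1 / \<kappa> z * (\<kappa>' z * \<kappa>' z)" by (simp add: algebra_simps)
      also have "\<dots> \<le> 1 + 4" using q \<kappa>'_nonneg \<kappa>'_le_1 by (intro add_mono) (auto intro: mult_le_one)
      finally show ?thesis by simp
    qed
    moreover have "\<kappa> z powr \<alpha> * (2 / (1 + z) ^ 3) \<le> 2"
    proof -
      have "\<kappa> z powr \<alpha> * (2 / (1 + z) ^ 3) \<le> (1 + z) * (2 / (1 + z) ^ 3)"
        using powr_le_1_plus[of "\<kappa> z"] \<kappa>z \<kappa>_le[of z] \<open>z > 0\<close> by (intro mult_right_mono) auto
      also have "\<dots> = 2 / (1 + z)\<^sup>2"
        using \<open>z > 0\<close> by (simp add: power2_eq_square power3_eq_cube del: distrib_left_numeral distrib_right_numeral)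
      also have "\<dots> \<le> 2" using one_le_power[of "1 + z" 2] \<open>z > 0\<close> by (simp add: divide_le_eq)
      finally show ?thesis .
    qed
    ultimately have "H' z \<le> 7" by (simp add: H'_def)
    moreover have "0 \<le> H' z" unfolding H'_def using \<alpha> \<kappa>'_nonneg \<open>z > 0\<close> by (intro add_nonneg_nonneg mult_nonneg_nonneg) auto
    ultimately have "\<bar>H' z\<bar> \<le> 7" by simp
    then have "\<bar>v - u\<bar> * \<bar>H' z\<bar> \<le> \<bar>v - u\<bar> * 7" by (rule mult_left_mono) simp
    then have "\<bar>(v - u) * H' z\<bar> \<le> 7 * \<bar>u - v\<bar>" by (simp add: abs_mult abs_minus_commute)
    moreover have "spow \<alpha> (\<kappa> u) = \<kappa> u powr \<alpha>" "spow \<alpha> (\<kappa> v) = \<kappa> v powr \<alpha>"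
      using uv False by (auto intro!: spow_pos \<kappa>_pos)
    ultimately show ?thesis using z(2) by (simp add: abs_minus_commute)
  qed
qed

text \<open>The power is constant on the positive half-line when \<alpha> = 0; strictness comes from
  \<kappa>', which increases strictly there.\<close>

lemma spow_\<kappa>_strict_mono:
  assumes "u < v"
  shows "spow \<alpha> (\<kappa> u) * \<kappa>' u < spow \<alpha> (\<kappa> v) * \<kappa>' v"
  using _ _ assms
proof (rule odd_strict_mono)
  show "spow \<alpha> (\<kappa> (- u)) * \<kappa>' (- u) = - (spow \<alpha> (\<kappa> u) * \<kappa>' u)" for u
    by (simp add: \<kappa>_minus \<kappa>'_minus spow_minus)
  fix u v :: real assume uv: "0 \<le> u" "u < v"
  show "spow \<alpha> (\<kappa> u) * \<kappa>' u < spow \<alpha> (\<kappa> v) * \<kappa>' v"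
  proof (cases "u = 0")
    case True
    then show ?thesis using uv \<kappa>_pos[of v] \<kappa>'_pos[of v] by (simp add: spow_pos spow_def)
  next
    case False
    have "\<kappa> u powr \<alpha> * \<kappa>' u < \<kappa> v powr \<alpha> * \<kappa>' v"
    proof (rule mult_le_less_imp_less)
      show "\<kappa> u powr \<alpha> \<le> \<kappa> v powr \<alpha>"
        using \<alpha> \<kappa>_pos[of u] \<kappa>_strict_mono[OF uv(2)] uv False by (intro powr_mono2) auto
      have "(1 + \<bar>u\<bar>)\<^sup>2 < (1 + \<bar>v\<bar>)\<^sup>2" using uv by (intro power_strict_mono) auto
      then show "\<kappa>' u < \<kappa>' v" using uv by (simp add: \<kappa>'_def divide_strict_left_mono)
    qed (use \<kappa>_pos[of u] \<kappa>'_nonneg uv False in auto)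
    then show ?thesis using uv False by (simp add: spow_pos \<kappa>_pos)
  qed
qed

end

section \<open>Trajectories of the singular field\<close>

text \<open>The flow of the linear saddle in its eigencoordinates, the common model for all
  parameters.\<close>

definition saddle :: "real \<Rightarrow> real \<times> real \<Rightarrow> real \<times> real" where
  "saddle t q = (exp t * fst q, exp (- t) * snd q)"

text \<open>Some coordinate of the limit is nonzero, and the logarithm of the corresponding quotient
  recovers the time.\<close>

lemma saddle_limit:
  assumes lim: "((\<lambda>t. saddle (s t) q) \<longlongrightarrow> q') F" and "F \<noteq> bot" "q' \<noteq> 0"
  obtains r where "(s \<longlongrightarrow> r) F"
proof -
  have coord: "\<exists>r. (s \<longlongrightarrow> r) F" if "((\<lambda>t. exp (s t) * y) \<longlongrightarrow> y') F" "y' \<noteq> 0" for s and y y' :: real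
  proof -
    have "y \<noteq> 0"
    proof
      assume "y = 0"
      then show False using that tendsto_unique[OF \<open>F \<noteq> bot\<close> that(1), of 0] by simp
    qed
    then have "((\<lambda>t. exp (s t)) \<longlongrightarrow> y' / y) F"
      using tendsto_divide[OF that(1) tendsto_const[of y]] by simp
    then have "((\<lambda>t. ln (exp (s t))) \<longlongrightarrow> ln (y' / y)) F"
      using that(2) \<open>y \<noteq> 0\<close> by (intro tendsto_ln) auto
    then show ?thesis by auto
  qed
  consider "fst q' \<noteq> 0" | "snd q' \<noteq> 0" using \<open>q' \<noteq> 0\<close> by (auto simp: prod_eq_iff)
  then show thesis
  proof cases
    case 1
    then show thesis using coord[of s "fst q" "fst q'"] tendsto_fst[OF lim] that by (auto simp: saddle_def)
  next
    case 2
    then obtain r where "((\<lambda>t. - s t) \<longlongrightarrow> r) F"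
      using coord[of "\<lambda>t. - s t" "snd q" "snd q'"] tendsto_snd[OF lim] by (auto simp: saddle_def)
    then show thesis using that[of "- r"] tendsto_minus by fastforce
  qed
qed

locale singular_saddle =
  fixes \<Lambda> \<alpha> c :: real
  assumes c: "c \<ge> 0" and \<alpha>: "0 \<le> \<alpha>" "\<alpha> \<le> 1" and \<Lambda>: "\<Lambda> > 0"
begin

abbreviation X :: "real \<times> real \<Rightarrow> real \<times> real" where
  "X \<equiv> XE \<Lambda> \<alpha> c"

definition k :: real where
  "k = c / \<Lambda>"

lemma k_nonneg: "k \<ge> 0"
  using c \<Lambda> by (simp add: k_def)

definition G :: "real \<Rightarrow> real" where
  "G u = k * \<kappa> u"

definition h :: "real \<Rightarrow> real" where
  "h u = spow \<alpha> (\<kappa> u) * \<kappa>' u / \<Lambda>"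

text \<open>\<open>k\<close> bounds the slope of \<open>G\<close> and \<open>7 / \<Lambda>\<close>
  that of \<open>h\<close>, with 7 taken from \<open>spow_\<kappa>_lipschitz\<close>; the summand 1
  ensures \<open>K \<ge> 1\<close>.\<close>

definition K :: real where
  "K = 1 + k + 7 / \<Lambda>"

text \<open>In the Lienard coordinate \<open>w = y - k x\<close> and with \<open>x = \<kappa> u\<close>, the field \<open>X\<close> is the following
  one divided by \<open>\<kappa>' u\<close>; the factor absorbs the singularity of \<open>X\<close> along the \<open>y\<close>-axis.\<close>

sublocale lienard G h K
proof
  show "K \<ge> 1" using k_nonneg \<Lambda> by (simp add: K_def)
  show "\<bar>G x - G y\<bar> \<le> K * \<bar>x - y\<bar>" for x y
  proof -
    have "\<bar>G x - G y\<bar> = k * \<bar>\<kappa> x - \<kappa> y\<bar>"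
      using k_nonneg by (simp add: G_def abs_mult flip: right_diff_distrib)
    also have "\<dots> \<le> K * \<bar>x - y\<bar>"
      using k_nonneg \<Lambda> \<kappa>_lipschitz by (intro mult_mono) (auto simp: K_def)
    finally show ?thesis .
  qed
  show "\<bar>h x - h y\<bar> \<le> K * \<bar>x - y\<bar>" for x y
  proof -
    have "\<bar>h x - h y\<bar> = \<bar>spow \<alpha> (\<kappa> x) * \<kappa>' x - spow \<alpha> (\<kappa> y) * \<kappa>' y\<bar> / \<Lambda>"
      using \<Lambda> by (simp add: h_def flip: diff_divide_distrib)
    also have "\<dots> \<le> 7 * \<bar>x - y\<bar> / \<Lambda>"
      using \<Lambda> spow_\<kappa>_lipschitz[OF \<alpha>] by (intro divide_right_mono) auto
    also have "\<dots> = 7 / \<Lambda> * \<bar>x - y\<bar>" by simp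
    also have "\<dots> \<le> K * \<bar>x - y\<bar>" using k_nonneg by (intro mult_right_mono) (auto simp: K_def)
    finally show ?thesis .
  qed
  show "h x < h y" if "x < y" for x y
    using spow_\<kappa>_strict_mono[OF \<alpha> that] \<Lambda> by (simp add: h_def divide_strict_right_mono)
qed (auto simp: G_def h_def \<kappa>_minus \<kappa>'_minus spow_minus)

lemma X_eq: "X p = (snd p, k * snd p + spow \<alpha> (fst p) / \<Lambda>)"
  by (cases p) (simp add: XE_def spow_def k_def add_divide_distrib)

lemma X_eq_0_iff: "X p = 0 \<longleftrightarrow> p = 0"
  using XE_eq_0_iff[OF \<Lambda>] by (simp add: zero_prod_def)

lemma isCont_X_iff: "isCont X p \<longleftrightarrow> isCont (spow \<alpha>) (fst p)"
proof
  assume *: "isCont X p"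
  have "isCont (\<lambda>x. (x, snd p)) (fst p)" by (intro continuous_intros)
  then have "isCont (\<lambda>x. X (x, snd p)) (fst p)"
    by (rule isCont_o2) (use * in simp)
  then have "isCont (\<lambda>x. \<Lambda> * (snd (X (x, snd p)) - k * snd p)) (fst p)" by (intro continuous_intros)
  then show "isCont (spow \<alpha>) (fst p)" using \<Lambda> by (simp add: X_eq)
next
  assume *: "isCont (spow \<alpha>) (fst p)"
  have "isCont (\<lambda>p. spow \<alpha> (fst p)) p" by (rule isCont_o2[where g = "spow \<alpha>"]) (use * in \<open>auto intro!: continuous_intros\<close>)
  then have "isCont (\<lambda>p. (snd p, k * snd p + spow \<alpha> (fst p) / \<Lambda>)) p"
    using \<Lambda> by (intro continuous_intros) auto
  then show "isCont X p" by (simp add: X_eq[abs_def])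
qed

lemma X_local_lipschitz:
  assumes "x\<^sub>0 \<noteq> 0"
  obtains M where
    "\<And>p q. \<bar>fst p - x\<^sub>0\<bar> \<le> \<bar>x\<^sub>0\<bar> / 2 \<Longrightarrow> \<bar>fst q - x\<^sub>0\<bar> \<le> \<bar>x\<^sub>0\<bar> / 2 \<Longrightarrow> norm (X p - X q) \<le> M * norm (p - q)"
proof -
  obtain N where "N \<ge> 0" and
    N: "\<And>x y. \<bar>x - x\<^sub>0\<bar> \<le> \<bar>x\<^sub>0\<bar> / 2 \<Longrightarrow> \<bar>y - x\<^sub>0\<bar> \<le> \<bar>x\<^sub>0\<bar> / 2 \<Longrightarrow> \<bar>spow \<alpha> x - spow \<alpha> y\<bar> \<le> N * \<bar>x - y\<bar>"
    using spow_local_lipschitz[OF \<alpha> assms] by blast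
  show thesis
  proof (rule that)
    fix p q :: "real \<times> real"
    assume pq: "\<bar>fst p - x\<^sub>0\<bar> \<le> \<bar>x\<^sub>0\<bar> / 2" "\<bar>fst q - x\<^sub>0\<bar> \<le> \<bar>x\<^sub>0\<bar> / 2"
    let ?dx = "fst p - fst q" and ?dy = "snd p - snd q" and ?dg = "spow \<alpha> (fst p) - spow \<alpha> (fst q)"
    have le: "\<bar>?dx\<bar> \<le> norm (p - q)" "\<bar>?dy\<bar> \<le> norm (p - q)"
      using norm_fst_le[of "fst (p - q)" "snd (p - q)"] norm_snd_le[of "snd (p - q)" "fst (p - q)"]
      by (simp_all add: minus_prod_def)
    have "X p - X q = (?dy, k * ?dy + ?dg / \<Lambda>)"
      by (simp add: X_eq diff_divide_distrib algebra_simps)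
    then have "norm (X p - X q) \<le> \<bar>?dy\<bar> + \<bar>k * ?dy + ?dg / \<Lambda>\<bar>"
      using norm_Pair_le[of ?dy "k * ?dy + ?dg / \<Lambda>"] by simp
    also have "\<bar>k * ?dy + ?dg / \<Lambda>\<bar> \<le> k * \<bar>?dy\<bar> + \<bar>?dg\<bar> / \<Lambda>"
      using abs_triangle_ineq[of "k * ?dy" "?dg / \<Lambda>"] k_nonneg \<Lambda> c by (simp add: abs_mult)
    also have "k * \<bar>?dy\<bar> \<le> k * norm (p - q)" using le k_nonneg by (intro mult_left_mono) auto
    also have "\<bar>?dg\<bar> / \<Lambda> \<le> N / \<Lambda> * norm (p - q)"
    proof -
      have "\<bar>?dg\<bar> \<le> N * norm (p - q)"
        using N[OF pq] mult_left_mono[OF le(1) \<open>N \<ge> 0\<close>] by linarith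
      then show ?thesis using \<Lambda> by (simp add: divide_right_mono)
    qed
    finally show "norm (X p - X q) \<le> (1 + k + N / \<Lambda>) * norm (p - q)"
      using le by (simp add: algebra_simps)
  qed
qed

section \<open>Change of coordinates and of time\<close>

definition \<Theta> :: "real \<times> real \<Rightarrow> real \<times> real" where
  "\<Theta> p = (\<kappa> (fst p), snd p + k * \<kappa> (fst p))"

definition \<Phi> :: "real \<times> real \<Rightarrow> real \<times> real" where
  "\<Phi> = inv \<Theta>"

lemma bij_\<Theta>: "bij \<Theta>"
proof (rule bijI)
  show "inj \<Theta>" by (auto simp: inj_on_def \<Theta>_def \<kappa>_eq_iff)
  show "surj \<Theta>"
  proof -
    have "\<exists>p. \<Theta> p = (x, y)" for x y
    proof -
      obtain u where "\<kappa> u = x" using surj_\<kappa> by (metis surjD)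
      then show ?thesis by (intro exI[of _ "(u, y - k * x)"]) (simp add: \<Theta>_def)
    qed
    then show ?thesis unfolding surj_def by (metis surj_pair)
  qed
qed

lemma \<Theta>_\<Phi> [simp]: "\<Theta> (\<Phi> p) = p" and \<Phi>_\<Theta> [simp]: "\<Phi> (\<Theta> p) = p"
  using bij_\<Theta> by (auto simp: \<Phi>_def bij_is_surj surj_f_inv_f bij_is_inj)

lemma continuous_\<Theta>: "continuous_on S \<Theta>"
proof -
  have "continuous_on S (\<lambda>p. \<kappa> (fst p))"
    by (rule continuous_on_compose2[OF continuous_\<kappa>[of UNIV]]) (auto intro: continuous_intros)
  then show ?thesis unfolding \<Theta>_def by (intro continuous_intros)
qed

lemma homeomorphism_\<Theta>: "homeomorphism UNIV UNIV \<Theta> \<Phi>"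
proof -
  obtain g where "homeomorphism UNIV (range \<Theta>) \<Theta> g"
    by (rule invariance_of_domain_homeomorphism[OF open_UNIV continuous_\<Theta> _ bij_is_inj[OF bij_\<Theta>]]) auto
  moreover have "g = \<Phi>"
  proof
    fix y
    have "\<Theta> (g y) = y" using calculation bij_is_surj[OF bij_\<Theta>] unfolding homeomorphism_def by blast
    then show "g y = \<Phi> y" by (metis \<Phi>_\<Theta>)
  qed
  ultimately show ?thesis by (simp add: bij_is_surj[OF bij_\<Theta>])
qed

lemma continuous_\<Phi>: "continuous_on S \<Phi>"
  using homeomorphism_\<Theta> by (auto simp: homeomorphism_def intro: continuous_on_subset)

lemma \<Theta>_0 [simp]: "\<Theta> 0 = 0"
  by (simp add: \<Theta>_def zero_prod_def)

lemma \<Phi>_eq_0_iff [simp]: "\<Phi> p = 0 \<longleftrightarrow> p = 0" and \<Theta>_eq_0_iff [simp]: "\<Theta> p = 0 \<longleftrightarrow> p = 0"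
  by (metis \<Theta>_0 \<Theta>_\<Phi> \<Phi>_\<Theta>)+

lemma fst_\<Theta>_eq_0_iff: "fst (\<Theta> p) = 0 \<longleftrightarrow> fst p = 0"
  by (simp add: \<Theta>_def \<kappa>_eq_0_iff)

lemma \<Theta>_flow_deriv:
  "((\<lambda>s. \<Theta> (flow s p)) has_vector_derivative \<kappa>' (fst (flow s p)) *\<^sub>R X (\<Theta> (flow s p))) (at s)"
proof -
  let ?u = "\<lambda>s. fst (flow s p)" and ?w = "\<lambda>s. snd (flow s p)"
  have d1: "((\<lambda>s. \<kappa> (?u s)) has_real_derivative \<kappa>' (?u s) * (?w s + k * \<kappa> (?u s))) (at s)"
    using DERIV_chain2[OF \<kappa>_deriv fst_flow_deriv] by (simp add: G_def)
  have d2: "((\<lambda>s. ?w s + k * \<kappa> (?u s)) has_real_derivative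
      spow \<alpha> (\<kappa> (?u s)) * \<kappa>' (?u s) / \<Lambda> + k * (\<kappa>' (?u s) * (?w s + k * \<kappa> (?u s)))) (at s)"
    using DERIV_add[OF snd_flow_deriv DERIV_cmult[OF d1]] by (simp add: h_def)
  have "((\<lambda>s. \<Theta> (flow s p)) has_vector_derivative
      (\<kappa>' (?u s) * (?w s + k * \<kappa> (?u s)),
       spow \<alpha> (\<kappa> (?u s)) * \<kappa>' (?u s) / \<Lambda> + k * (\<kappa>' (?u s) * (?w s + k * \<kappa> (?u s))))) (at s)"
    unfolding \<Theta>_def using d1 d2
    by (intro has_vector_derivative_Pair) (auto simp: has_real_derivative_iff_has_vector_derivative)
  moreover have "(\<kappa>' (?u s) * (?w s + k * \<kappa> (?u s)),
       spow \<alpha> (\<kappa> (?u s)) * \<kappa>' (?u s) / \<Lambda> + k * (\<kappa>' (?u s) * (?w s + k * \<kappa> (?u s))))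
      = \<kappa>' (?u s) *\<^sub>R X (\<Theta> (flow s p))"
    by (simp add: X_eq \<Theta>_def algebra_simps)
  ultimately show ?thesis by simp
qed

text \<open>On the axis the first component has velocity \<open>snd (flow s p)\<close>, which is
  nonzero away from the origin.\<close>

lemma flow_axis_isolated:
  assumes "p \<noteq> 0" "fst (flow s p) = 0"
  shows "\<forall>\<^sub>F r in at s. fst (flow r p) \<noteq> 0"
proof -
  have "flow s p \<noteq> 0" using assms(1) by simp
  then have "snd (flow s p) + G (fst (flow s p)) \<noteq> 0" using assms(2) by (simp add: prod_eq_iff)
  from eventually_ne_of_deriv[OF fst_flow_deriv this] show ?thesis by (simp add: assms(2))
qed

text \<open>The original time elapsed along an orbit of the desingularized flow.\<close>

definition clock :: "real \<times> real \<Rightarrow> real \<Rightarrow> real" where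
  "clock p = (SOME F. F 0 = 0 \<and> (\<forall>s. (F has_real_derivative \<kappa>' (fst (flow s p))) (at s)))"

lemma clock_0 [simp]: "clock p 0 = 0"
  and clock_deriv: "(clock p has_real_derivative \<kappa>' (fst (flow s p))) (at s)"
proof -
  have "continuous_on UNIV (\<lambda>s. \<kappa>' (fst (flow s p)))"
    by (rule continuous_on_compose2[OF continuous_\<kappa>'[of UNIV] continuous_fst_flow]) auto
  then have "\<exists>F. F 0 = 0 \<and> (\<forall>s. (F has_real_derivative \<kappa>' (fst (flow s p))) (at s))"
    using antiderivative_UNIV unfolding has_real_derivative_iff_has_vector_derivative by metis
  from someI_ex[OF this] show "clock p 0 = 0" "(clock p has_real_derivative \<kappa>' (fst (flow s p))) (at s)"
    unfolding clock_def by auto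
qed

lemma clock_add: "clock p (s + t) = clock p t + clock (flow t p) s"
proof -
  have "((\<lambda>s. clock p (s + t) - clock (flow t p) s) has_real_derivative 0) (at s)" for s
  proof -
    have "((\<lambda>s. clock p (s + t)) has_real_derivative \<kappa>' (fst (flow (s + t) p)) * 1) (at s)"
      by (rule DERIV_chain2[OF clock_deriv]) (auto intro!: derivative_eq_intros)
    from DERIV_diff[OF this clock_deriv[of "flow t p" s]] show ?thesis by (simp add: flow_add)
  qed
  then have "clock p (s + t) - clock (flow t p) s = clock p (0 + t) - clock (flow t p) 0"
    by (intro DERIV_isconst_all) auto
  then show ?thesis by simp
qed

text \<open>The clock stops only on the axis. If it were constant on an interval, the orbit would
  stay on the axis there, whereas it meets the axis at isolated times only.\<close>

lemma clock_strict_mono: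
  assumes "p \<noteq> 0" "s < t"
  shows "clock p s < clock p t"
proof -
  have mono: "clock p a \<le> clock p b" if "a \<le> b" for a b
    using that by (rule DERIV_nonneg_imp_nondecreasing) (use clock_deriv \<kappa>'_nonneg in blast)
  have "clock p s \<noteq> clock p t"
  proof
    assume eq: "clock p s = clock p t"
    have zero: "fst (flow r p) = 0" if "s < r" "r < t" for r
    proof -
      have "clock p r = clock p y" if "\<bar>r - y\<bar> < min (r - s) (t - r)" for y
      proof -
        have "s \<le> y" "y \<le> t" using that by (auto simp: abs_less_iff)
        then show ?thesis using \<open>s < r\<close> \<open>r < t\<close> mono[of s r] mono[of r t] mono[of s y] mono[of y t] eq by linarith
      qed
      then have "\<kappa>' (fst (flow r p)) = 0"
        using that by (intro DERIV_local_const[OF clock_deriv, of "min (r - s) (t - r)"]) auto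
      then show ?thesis by (simp add: \<kappa>'_eq_0_iff)
    qed
    define r where "r = (s + t) / 2"
    have r: "s < r" "r < t" using \<open>s < t\<close> by (auto simp: r_def)
    have "\<forall>\<^sub>F y in at r. s < y \<and> y < t"
      using r by (intro eventually_at_in_open'[of "{s<..<t}", simplified]) auto
    then have "\<forall>\<^sub>F y in at r. False"
      using flow_axis_isolated[OF assms(1) zero[OF r]] by eventually_elim (use zero in auto)
    then show False by simp
  qed
  then show ?thesis using mono[of s t] \<open>s < t\<close> by simp
qed

lemma continuous_clock: "continuous_on S (clock p)"
  by (meson DERIV_isCont clock_deriv continuous_at_imp_continuous_on)

text \<open>Lying on the same orbit of the flow, \<tau> units of original time later. As a relation
  it is closed under composition, inversion and limits, so comparisons of trajectories with orbits
  can be patched together.\<close>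

definition reach :: "real \<times> real \<Rightarrow> real \<Rightarrow> real \<times> real \<Rightarrow> bool" where
  "reach p \<tau> q \<longleftrightarrow> (\<exists>s. q = flow s p \<and> \<tau> = clock p s)"

lemma reach_refl: "reach p 0 p"
  unfolding reach_def by (intro exI[of _ 0]) simp

lemma reach_trans: "reach p \<sigma> q \<Longrightarrow> reach q \<tau> r \<Longrightarrow> reach p (\<sigma> + \<tau>) r"
  unfolding reach_def by (metis flow_add clock_add)

lemma reach_sym: "reach p \<tau> q \<Longrightarrow> reach q (- \<tau>) p"
proof -
  assume "reach p \<tau> q"
  then obtain s where s: "q = flow s p" "\<tau> = clock p s" by (auto simp: reach_def)
  have "clock p (- s + s) = clock p s + clock q (- s)" unfolding s(1) by (rule clock_add)
  then show ?thesis unfolding reach_def using s by (intro exI[of _ "- s"]) simp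
qed

text \<open>An orbit of the flow cannot reach a nonzero limit point only asymptotically, as its image under
  the conjugacy \<open>C\<close> is an orbit of a linear saddle.\<close>

lemma reach_limit:
  assumes "F \<noteq> bot" and ev: "\<forall>\<^sub>F t in F. reach p (f t) (\<zeta> t)"
    and \<zeta>: "(\<zeta> \<longlongrightarrow> q) F" and f: "(f \<longlongrightarrow> \<tau>) F" and "q \<noteq> 0"
  shows "reach p \<tau> q"
proof -
  have "\<forall>\<^sub>F t in F. \<exists>s. \<zeta> t = flow s p \<and> f t = clock p s"
    using ev by (simp add: reach_def)
  then obtain s where s: "\<forall>\<^sub>F t in F. \<zeta> t = flow (s t) p \<and> f t = clock p (s t)"
    unfolding eventually_ex by blast
  have isC: "isCont g x" if "continuous_on UNIV g" for g :: "'x::t2_space \<Rightarrow> 'y::topological_space" and x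
    using that by (simp add: continuous_on_eq_continuous_at)
  have "((\<lambda>t. C (\<zeta> t)) \<longlongrightarrow> C q) F"
    by (rule isCont_tendsto_compose[OF isC[OF continuous_C] \<zeta>])
  then have "((\<lambda>t. saddle (s t) (C p)) \<longlongrightarrow> C q) F"
    by (rule Lim_transform_eventually) (use s in \<open>auto elim!: eventually_mono simp: C_flow saddle_def\<close>)
  moreover have "C q \<noteq> 0" using \<open>q \<noteq> 0\<close> by (simp add: C_eq_0_iff)
  ultimately obtain r where r: "(s \<longlongrightarrow> r) F" using saddle_limit[OF _ \<open>F \<noteq> bot\<close>] by blast
  have "((\<lambda>t. flow (s t) p) \<longlongrightarrow> flow r p) F"
    by (rule isCont_tendsto_compose[OF isC[OF continuous_flow_time] r])
  then have "(\<zeta> \<longlongrightarrow> flow r p) F"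
    by (rule Lim_transform_eventually) (use s in \<open>auto elim!: eventually_mono\<close>)
  then have "q = flow r p" using tendsto_unique[OF \<open>F \<noteq> bot\<close> \<zeta>] by blast
  have "((\<lambda>t. clock p (s t)) \<longlongrightarrow> clock p r) F"
    by (rule isCont_tendsto_compose[OF isC[OF continuous_clock] r])
  then have "(f \<longlongrightarrow> clock p r) F"
    by (rule Lim_transform_eventually) (use s in \<open>auto elim!: eventually_mono\<close>)
  then have "\<tau> = clock p r" using tendsto_unique[OF \<open>F \<noteq> bot\<close> f] by blast
  with \<open>q = flow r p\<close> show ?thesis by (auto simp: reach_def)
qed

text \<open>The orbit is read through the inverse \<open>g\<close> of the clock, started at
  \<open>t\<^sub>0\<close>. Being the range of the clock, \<open>J\<close> may be bounded on a side
  where the orbit tends to the origin in finite original time.\<close>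

lemma orbit_trajectory:
  assumes "p \<noteq> 0"
  obtains J \<delta> g where "trajectory X J \<delta>" "J = range (\<lambda>s. t\<^sub>0 + clock p s)"
    "strict_mono_on J g" "g ` J = UNIV"
    "\<And>t. \<delta> t = \<Theta> (flow (g t) p)" "\<And>s. g (t\<^sub>0 + clock p s) = s"
proof -
  define f where "f s = t\<^sub>0 + clock p s" for s
  define J where "J = range f"
  have f_mono: "f s < f t" if "s < t" for s t using clock_strict_mono[OF assms that] by (simp add: f_def)
  have inj_f: "inj f" by (metis f_mono injI less_irrefl linorder_neqE_linordered_idom)
  have cont_f: "continuous_on UNIV f" unfolding f_def by (intro continuous_intros continuous_clock)
  obtain g where "homeomorphism UNIV J f g"
    unfolding J_def by (rule invariance_of_domain_homeomorphism[OF open_UNIV cont_f _ inj_f]) auto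
  then have gf [simp]: "g (f s) = s" and fg: "t \<in> J \<Longrightarrow> f (g t) = t" and cont_g: "continuous_on J g" for s t
    by (auto simp: homeomorphism_def)
  have "open J" unfolding J_def by (rule invariance_of_domain[OF cont_f open_UNIV inj_f])
  have "is_interval J"
    unfolding J_def is_interval_connected_1 by (rule connected_continuous_image[OF cont_f connected_UNIV])
  have isCont_g: "isCont g t" if "t \<in> J" for t
    using cont_g \<open>open J\<close> that by (simp add: continuous_on_eq_continuous_at)
  define \<delta> where "\<delta> t = \<Theta> (flow (g t) p)" for t
  have cont_\<delta>: "continuous_on J \<delta>"
    unfolding \<delta>_def
    by (rule continuous_on_compose2[OF continuous_\<Theta>[of UNIV]], rule continuous_on_compose2[OF continuous_flow_time[of UNIV] cont_g]) auto
  have regular: "(\<delta> has_vector_derivative X (\<delta> t)) (at t)" if t: "t \<in> J" "fst (\<delta> t) \<noteq> 0" for t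
  proof -
    let ?D = "\<kappa>' (fst (flow (g t) p))"
    have "?D \<noteq> 0" using t(2) by (simp add: \<delta>_def fst_\<Theta>_eq_0_iff \<kappa>'_eq_0_iff)
    obtain e where "e > 0" and e: "ball t e \<subseteq> J" using \<open>open J\<close> t(1) openE by blast
    have "(g has_real_derivative inverse ?D) (at t)"
    proof (rule DERIV_inverse_function[where f = f and a = "t - e" and b = "t + e"])
      show "(f has_real_derivative ?D) (at (g t))"
        unfolding f_def using DERIV_add[OF DERIV_const[of "t\<^sub>0"] clock_deriv[of p "g t"]] by simp
      show "f (g y) = y" if "t - e < y" "y < t + e" for y
        using that e by (intro fg) (auto simp: subset_eq dist_real_def)
    qed (use \<open>?D \<noteq> 0\<close> \<open>e > 0\<close> isCont_g[OF t(1)] in auto)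
    then have "(g has_vector_derivative inverse ?D) (at t)"
      by (simp add: has_real_derivative_iff_has_vector_derivative)
    from vector_diff_chain_at[OF this \<Theta>_flow_deriv[of p "g t"]]
    show ?thesis using \<open>?D \<noteq> 0\<close> by (simp add: o_def \<delta>_def[abs_def])
  qed
  have "trajectory X J \<delta>"
    unfolding trajectory_def
  proof (intro conjI ballI)
    show "J \<noteq> {}" by (simp add: J_def)
    show "X (\<delta> t) \<noteq> 0" for t using assms by (simp add: X_eq_0_iff \<delta>_def)
    fix t assume t: "t \<in> J"
    show "if isCont X (\<delta> t) then (\<delta> has_vector_derivative X (\<delta> t)) (at t) else (\<forall>\<^sub>F s in at t. isCont X (\<delta> s))"
    proof (cases "fst (\<delta> t) = 0")
      case False
      then show ?thesis using regular[OF t] by (simp add: isCont_X_iff isCont_spow)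
    next
      case True
      have "(g \<longlongrightarrow> g t) (at t)" using isCont_g[OF t] by (simp add: isCont_def)
      moreover have ev_J: "\<forall>\<^sub>F s in at t. s \<in> J" using eventually_at_in_open'[OF \<open>open J\<close> t] .
      then have "\<forall>\<^sub>F s in at t. g s \<noteq> g t"
        using eventually_neq_at_within[of t t UNIV] by eventually_elim (metis fg t)
      ultimately have "filterlim g (at (g t)) (at t)" by (simp add: filterlim_at)
      moreover have "\<forall>\<^sub>F r in at (g t). fst (flow r p) \<noteq> 0"
        using True by (intro flow_axis_isolated[OF assms]) (simp add: \<delta>_def fst_\<Theta>_eq_0_iff)
      ultimately have "\<forall>\<^sub>F s in at t. fst (flow (g s) p) \<noteq> 0"
        by (rule eventually_compose_filterlim[rotated])
      then have ev: "\<forall>\<^sub>F s in at t. fst (\<delta> s) \<noteq> 0" by (simp add: \<delta>_def fst_\<Theta>_eq_0_iff)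
      have isC: "isCont \<delta> t" using cont_\<delta> \<open>open J\<close> t by (simp add: continuous_on_eq_continuous_at)
      show ?thesis
      proof (cases "isCont X (\<delta> t)")
        case True
        \<comment> \<open>On the axis the clock has speed 0, so \<open>g\<close> has no derivative
          there and the chain rule fails; the derivative is obtained as a limit from nearby regular
          times.\<close>
        have "(\<delta> has_vector_derivative X (\<delta> t)) (at t)"
        proof (rule has_vector_derivative_of_limit[OF isC])
          show "\<forall>\<^sub>F r in at t. (\<delta> has_vector_derivative X (\<delta> r)) (at r)"
            using ev ev_J by eventually_elim (rule regular)
          show "((\<lambda>r. X (\<delta> r)) \<longlongrightarrow> X (\<delta> t)) (at t)"
            using isCont_o2[OF isC True] by (simp add: isCont_def)
        qed
        then show ?thesis using True by simp
      next
        case False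
        have "\<forall>\<^sub>F s in at t. isCont X (\<delta> s)"
          using ev by (rule eventually_mono) (simp add: isCont_X_iff isCont_spow)
        then show ?thesis using False by simp
      qed
    qed
  qed fact+
  moreover have "strict_mono_on J g"
  proof (rule strict_mono_onI)
    fix x y assume xy: "x \<in> J" "y \<in> J" "x < y"
    then show "g x < g y" using fg[of x] fg[of y] f_mono[of "g y" "g x"]
      by (cases "g x" "g y" rule: linorder_cases) auto
  qed
  moreover have "g ` J = UNIV" unfolding J_def by (auto simp: image_image)
  ultimately show thesis
    using that[of J \<delta> g] gf by (auto simp: J_def \<delta>_def f_def[abs_def])
qed

text \<open>Where \<open>X\<close> is continuous, the first component has derivative
  \<open>snd (\<gamma> t)\<close>, nonzero off the origin. Where it is not, nearby points are points
  of continuity by the definition of a trajectory, while the whole axis consists of discontinuities,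
  as continuity depends on the first coordinate only.\<close>

lemma axis_crossing_isolated:
  assumes \<gamma>: "trajectory X I \<gamma>" and "t \<in> I" "fst (\<gamma> t) = 0"
  shows "\<forall>\<^sub>F s in at t. fst (\<gamma> s) \<noteq> 0"
proof (cases "isCont X (\<gamma> t)")
  case True
  then have "(\<gamma> has_vector_derivative X (\<gamma> t)) (at t)" using \<gamma> \<open>t \<in> I\<close> by (auto simp: trajectory_def)
  from has_derivative_fst[OF this[unfolded has_vector_derivative_def]]
  have "((\<lambda>s. fst (\<gamma> s)) has_real_derivative snd (\<gamma> t)) (at t)"
    by (simp add: has_field_derivative_def X_eq mult_commute_abs)
  moreover have "snd (\<gamma> t) \<noteq> 0"
    using \<gamma> \<open>t \<in> I\<close> assms(3) unfolding trajectory_def X_eq_0_iff by (metis prod_eq_iff fst_zero snd_zero)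
  ultimately show ?thesis using eventually_ne_of_deriv assms(3) by fastforce
next
  case False
  then have "\<forall>\<^sub>F s in at t. isCont X (\<gamma> s)" using \<gamma> \<open>t \<in> I\<close> by (auto simp: trajectory_def)
  then show ?thesis
    by (rule eventually_mono) (use False in \<open>auto simp: isCont_X_iff assms(3)\<close>)
qed

section \<open>Trajectories follow orbits of the flow\<close>

definition locally_reaches :: "(real \<Rightarrow> real \<times> real) \<Rightarrow> real \<Rightarrow> bool" where
  "locally_reaches \<gamma> t \<longleftrightarrow> (\<exists>d>0. \<forall>s. \<bar>s - t\<bar> < d \<longrightarrow> reach (\<Phi> (\<gamma> t)) (s - t) (\<Phi> (\<gamma> s)))"

text \<open>Off the axis \<open>X\<close> is locally Lipschitz, so Gronwall's inequality identifies
  the given trajectory with the one coming from the flow through the same point.\<close>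

lemma locally_reaches_regular:
  assumes \<gamma>: "trajectory X I \<gamma>" and "t\<^sub>0 \<in> I" "fst (\<gamma> t\<^sub>0) \<noteq> 0"
  shows "locally_reaches \<gamma> t\<^sub>0"
proof -
  define x\<^sub>0 where "x\<^sub>0 = fst (\<gamma> t\<^sub>0)"
  define p where "p = \<Phi> (\<gamma> t\<^sub>0)"
  have "\<gamma> t\<^sub>0 \<noteq> 0" using assms(3) by auto
  then have "p \<noteq> 0" by (simp add: p_def)
  obtain J \<delta> g where \<delta>: "trajectory X J \<delta>" "J = range (\<lambda>s. t\<^sub>0 + clock p s)"
    "\<And>t. \<delta> t = \<Theta> (flow (g t) p)" "\<And>s. g (t\<^sub>0 + clock p s) = s"
    by (rule orbit_trajectory[OF \<open>p \<noteq> 0\<close>, where t\<^sub>0 = t\<^sub>0]) blast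
  have "t\<^sub>0 \<in> J" unfolding \<delta>(2) by (rule range_eqI[of _ _ 0]) simp
  have "g t\<^sub>0 = 0" using \<delta>(4)[of 0] by simp
  then have "\<delta> t\<^sub>0 = \<gamma> t\<^sub>0" by (simp add: \<delta>(3) p_def)
  obtain M where M: "\<And>p q. \<bar>fst p - x\<^sub>0\<bar> \<le> \<bar>x\<^sub>0\<bar> / 2 \<Longrightarrow> \<bar>fst q - x\<^sub>0\<bar> \<le> \<bar>x\<^sub>0\<bar> / 2 \<Longrightarrow> norm (X p - X q) \<le> M * norm (p - q)"
    using X_local_lipschitz[of x\<^sub>0] assms(3) unfolding x\<^sub>0_def by blast
  have ev: "\<forall>\<^sub>F t in nhds t\<^sub>0. t \<in> L \<and> \<bar>fst (\<epsilon> t) - x\<^sub>0\<bar> < \<bar>x\<^sub>0\<bar> / 2"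
    if \<epsilon>: "trajectory X L \<epsilon>" "t\<^sub>0 \<in> L" "\<epsilon> t\<^sub>0 = \<gamma> t\<^sub>0" for L \<epsilon>
  proof -
    have "open L" "continuous_on L \<epsilon>" using \<epsilon>(1) by (auto simp: trajectory_def)
    then have "isCont (\<lambda>t. fst (\<epsilon> t)) t\<^sub>0"
      using \<epsilon>(2) by (intro continuous_fst) (simp add: continuous_on_eq_continuous_at)
    then have "((\<lambda>t. fst (\<epsilon> t)) \<longlongrightarrow> x\<^sub>0) (nhds t\<^sub>0)"
      using \<epsilon>(3) tendsto_at_iff_tendsto_nhds[of "\<lambda>t. fst (\<epsilon> t)" t\<^sub>0] by (simp add: x\<^sub>0_def isCont_def)
    then have "\<forall>\<^sub>F t in nhds t\<^sub>0. dist (fst (\<epsilon> t)) x\<^sub>0 < \<bar>x\<^sub>0\<bar> / 2"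
      using assms(3) by (intro tendstoD) (auto simp: x\<^sub>0_def)
    moreover have "\<forall>\<^sub>F t in nhds t\<^sub>0. t \<in> L" using \<open>open L\<close> \<epsilon>(2) by (rule eventually_nhds_in_open)
    ultimately show ?thesis by eventually_elim (simp add: dist_real_def)
  qed
  obtain d where "d > 0" and d: "\<And>t. dist t t\<^sub>0 < d \<Longrightarrow>
      (t \<in> I \<and> \<bar>fst (\<gamma> t) - x\<^sub>0\<bar> < \<bar>x\<^sub>0\<bar> / 2) \<and> (t \<in> J \<and> \<bar>fst (\<delta> t) - x\<^sub>0\<bar> < \<bar>x\<^sub>0\<bar> / 2)"
    using eventually_conj[OF ev[OF \<gamma> \<open>t\<^sub>0 \<in> I\<close> refl] ev[OF \<delta>(1) \<open>t\<^sub>0 \<in> J\<close> \<open>\<delta> t\<^sub>0 = \<gamma> t\<^sub>0\<close>]]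
    unfolding eventually_nhds_metric by blast
  have deriv: "(\<epsilon> has_vector_derivative X (\<epsilon> t)) (at t)"
    if "trajectory X L \<epsilon>" "t \<in> L" "\<bar>fst (\<epsilon> t) - x\<^sub>0\<bar> < \<bar>x\<^sub>0\<bar> / 2" for L \<epsilon> t
  proof -
    have "fst (\<epsilon> t) \<noteq> 0" using that(3) by auto
    then show ?thesis using that(1,2) by (auto simp: trajectory_def isCont_X_iff isCont_spow)
  qed
  have eq: "\<gamma> t = \<delta> t" if t: "dist t t\<^sub>0 < d" for t
  proof -
    have D: "((\<lambda>t. \<gamma> t - \<delta> t) has_vector_derivative X (\<gamma> s) - X (\<delta> s)) (at s)"
      and B: "norm (X (\<gamma> s) - X (\<delta> s)) \<le> M * norm (\<gamma> s - \<delta> s)" if "dist s t\<^sub>0 < d" for s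
      using d[OF that] by (auto intro!: has_vector_derivative_diff deriv[OF \<gamma>] deriv[OF \<delta>(1)] M)
    have "norm (\<gamma> t - \<delta> t) \<le> exp (M * \<bar>t - t\<^sub>0\<bar>) * norm (\<gamma> t\<^sub>0 - \<delta> t\<^sub>0)"
    proof (cases "t\<^sub>0 \<le> t")
      case True
      then have "norm (\<gamma> t - \<delta> t) \<le> exp (M * (t - t\<^sub>0)) * norm (\<gamma> t\<^sub>0 - \<delta> t\<^sub>0)"
        by (rule gronwall_norm(1)) (use t in \<open>auto intro!: D B simp: dist_real_def\<close>)
      then show ?thesis using True by simp
    next
      case False
      then have "t \<le> t\<^sub>0" by simp
      then have "norm (\<gamma> t - \<delta> t) \<le> exp (M * (t\<^sub>0 - t)) * norm (\<gamma> t\<^sub>0 - \<delta> t\<^sub>0)"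
        by (rule gronwall_norm(2)) (use t in \<open>auto intro!: D B simp: dist_real_def\<close>)
      then show ?thesis using False by simp
    qed
    then show ?thesis using \<open>\<delta> t\<^sub>0 = \<gamma> t\<^sub>0\<close> by simp
  qed
  show ?thesis
    unfolding locally_reaches_def
  proof (intro exI[of _ d] conjI allI impI \<open>d > 0\<close>)
    fix t assume "\<bar>t - t\<^sub>0\<bar> < d"
    then have t: "dist t t\<^sub>0 < d" by (simp add: dist_real_def)
    then obtain s where s: "t = t\<^sub>0 + clock p s" using d \<delta>(2) by blast
    have "\<Phi> (\<gamma> t) = flow s p" using eq[OF t] \<delta>(4)[of s] by (simp add: \<delta>(3) s)
    then show "reach (\<Phi> (\<gamma> t\<^sub>0)) (t - t\<^sub>0) (\<Phi> (\<gamma> t))"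
      unfolding reach_def p_def[symmetric] using s by (intro exI[of _ s]) simp
  qed
qed

text \<open>Local comparisons are joined by bisection (\<open>Bolzano\<close>); an interval around
  \<open>t\<close> is split at \<open>t\<close>, with the left half traversed backwards
  first.\<close>

lemma reach_interval:
  assumes "x \<le> y" and "\<And>t. x \<le> t \<Longrightarrow> t \<le> y \<Longrightarrow> locally_reaches \<gamma> t"
  shows "reach (\<Phi> (\<gamma> x)) (y - x) (\<Phi> (\<gamma> y))"
  using assms(1)
proof (rule Bolzano)
  fix a b c :: real
  assume "reach (\<Phi> (\<gamma> a)) (b - a) (\<Phi> (\<gamma> b))" "reach (\<Phi> (\<gamma> b)) (c - b) (\<Phi> (\<gamma> c))"
  from reach_trans[OF this] show "reach (\<Phi> (\<gamma> a)) (c - a) (\<Phi> (\<gamma> c))" by simp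
next
  fix t assume "x \<le> t" "t \<le> y"
  then obtain d where "d > 0" and d: "\<And>s. \<bar>s - t\<bar> < d \<Longrightarrow> reach (\<Phi> (\<gamma> t)) (s - t) (\<Phi> (\<gamma> s))"
    using assms(2) unfolding locally_reaches_def by blast
  show "\<exists>d>0. \<forall>a b. a \<le> t \<and> t \<le> b \<and> b - a < d \<longrightarrow> reach (\<Phi> (\<gamma> a)) (b - a) (\<Phi> (\<gamma> b))"
  proof (intro exI[of _ d] conjI allI impI \<open>d > 0\<close>)
    fix a b assume ab: "a \<le> t \<and> t \<le> b \<and> b - a < d"
    have "reach (\<Phi> (\<gamma> a)) (- (a - t) + (b - t)) (\<Phi> (\<gamma> b))"
      by (rule reach_trans[OF reach_sym[OF d] d]) (use ab in auto)
    then show "reach (\<Phi> (\<gamma> a)) (b - a) (\<Phi> (\<gamma> b))" by simp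
  qed
qed

text \<open>Uniqueness at a crossing of the axis. Nearby times are regular, so from any of them the
  trajectory follows one orbit of the flow up to, but not including, the crossing;
  \<open>reach_limit\<close> adds the crossing point, and \<open>reach_sym\<close> turns the
  statement around.\<close>

lemma trajectory_locally_reaches:
  assumes \<gamma>: "trajectory X I \<gamma>" and "t\<^sub>0 \<in> I"
  shows "locally_reaches \<gamma> t\<^sub>0"
proof (cases "fst (\<gamma> t\<^sub>0) = 0")
  case True
  have "open I" and cont: "continuous_on I \<gamma>" using \<gamma> by (simp_all add: trajectory_def)
  have "\<forall>\<^sub>F t in at t\<^sub>0. t \<in> I \<and> fst (\<gamma> t) \<noteq> 0"
    using axis_crossing_isolated[OF \<gamma> \<open>t\<^sub>0 \<in> I\<close> True] eventually_at_in_open'[OF \<open>open I\<close> \<open>t\<^sub>0 \<in> I\<close>]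
    by eventually_elim simp
  then obtain d where "d > 0" and d: "\<And>t. t \<noteq> t\<^sub>0 \<Longrightarrow> dist t t\<^sub>0 < d \<Longrightarrow> t \<in> I \<and> fst (\<gamma> t) \<noteq> 0"
    by (auto simp: eventually_at)
  have loc: "locally_reaches \<gamma> t" if "t \<noteq> t\<^sub>0" "dist t t\<^sub>0 < d" for t
    using d[OF that] by (blast intro: locally_reaches_regular[OF \<gamma>])
  have "isCont \<gamma> t\<^sub>0" using cont \<open>open I\<close> \<open>t\<^sub>0 \<in> I\<close> by (simp add: continuous_on_eq_continuous_at)
  then have "isCont (\<lambda>t. \<Phi> (\<gamma> t)) t\<^sub>0"
    by (rule isCont_o2) (use continuous_\<Phi>[of UNIV] continuous_on_eq_continuous_at[OF open_UNIV] in blast)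
  then have lim: "((\<lambda>t. \<Phi> (\<gamma> t)) \<longlongrightarrow> \<Phi> (\<gamma> t\<^sub>0)) (at t\<^sub>0 within S)" for S
    by (auto simp: isCont_def intro: tendsto_within_subset)
  have "\<Phi> (\<gamma> t\<^sub>0) \<noteq> 0" using \<gamma> \<open>t\<^sub>0 \<in> I\<close> by (auto simp: trajectory_def X_eq_0_iff)
  have towards: "reach (\<Phi> (\<gamma> t)) (t\<^sub>0 - t) (\<Phi> (\<gamma> t\<^sub>0))" if t: "dist t t\<^sub>0 < d" for t
  proof -
    consider "t = t\<^sub>0" | "t < t\<^sub>0" | "t\<^sub>0 < t" by linarith
    then show ?thesis
    proof cases
      case 1
      then show ?thesis by (simp add: reach_refl)
    next
      case 2
      show ?thesis
      proof (rule reach_limit[OF _ _ lim _ \<open>\<Phi> (\<gamma> t\<^sub>0) \<noteq> 0\<close>])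
        show "at_left t\<^sub>0 \<noteq> bot" by simp
        show "((\<lambda>s. s - t) \<longlongrightarrow> t\<^sub>0 - t) (at_left t\<^sub>0)" by (intro tendsto_intros)
        have "\<forall>\<^sub>F s in at_left t\<^sub>0. s \<in> {t<..<t\<^sub>0}" using eventually_at_left_real[OF 2] .
        then show "\<forall>\<^sub>F s in at_left t\<^sub>0. reach (\<Phi> (\<gamma> t)) (s - t) (\<Phi> (\<gamma> s))"
          by (rule eventually_mono) (use t in \<open>auto intro!: reach_interval loc simp: dist_real_def\<close>)
      qed
    next
      case 3
      show ?thesis
      proof (rule reach_limit[OF _ _ lim _ \<open>\<Phi> (\<gamma> t\<^sub>0) \<noteq> 0\<close>])
        show "at_right t\<^sub>0 \<noteq> bot" by simp
        show "((\<lambda>s. s - t) \<longlongrightarrow> t\<^sub>0 - t) (at_right t\<^sub>0)" by (intro tendsto_intros)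
        have "\<forall>\<^sub>F s in at_right t\<^sub>0. s \<in> {t\<^sub>0<..<t}" using eventually_at_right_real[OF 3] .
        then show "\<forall>\<^sub>F s in at_right t\<^sub>0. reach (\<Phi> (\<gamma> t)) (s - t) (\<Phi> (\<gamma> s))"
        proof (rule eventually_mono)
          fix s assume s: "s \<in> {t\<^sub>0<..<t}"
          have "reach (\<Phi> (\<gamma> s)) (t - s) (\<Phi> (\<gamma> t))"
            using s t by (auto intro!: reach_interval loc simp: dist_real_def)
          from reach_sym[OF this] show "reach (\<Phi> (\<gamma> t)) (s - t) (\<Phi> (\<gamma> s))" by simp
        qed
      qed
    qed
  qed
  show ?thesis
    unfolding locally_reaches_def
  proof (intro exI[of _ d] conjI allI impI \<open>d > 0\<close>)
    fix t assume "\<bar>t - t\<^sub>0\<bar> < d"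
    then have "dist t t\<^sub>0 < d" by (simp add: dist_real_def)
    from reach_sym[OF towards[OF this]] show "reach (\<Phi> (\<gamma> t\<^sub>0)) (t - t\<^sub>0) (\<Phi> (\<gamma> t))" by simp
  qed
qed (rule locally_reaches_regular[OF assms])

lemma trajectory_reach:
  assumes \<gamma>: "trajectory X I \<gamma>" and "x \<in> I" "y \<in> I"
  shows "reach (\<Phi> (\<gamma> x)) (y - x) (\<Phi> (\<gamma> y))"
proof -
  have *: "reach (\<Phi> (\<gamma> x)) (y - x) (\<Phi> (\<gamma> y))" if "x \<in> I" "y \<in> I" "x \<le> y" for x y
    using that(3)
  proof (rule reach_interval)
    fix t assume "x \<le> t" "t \<le> y"
    then have "t \<in> I" using \<gamma> that(1,2) unfolding trajectory_def is_interval_1 by blast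
    then show "locally_reaches \<gamma> t" by (rule trajectory_locally_reaches[OF \<gamma>])
  qed
  show ?thesis
  proof (cases "x \<le> y")
    case False
    then have "reach (\<Phi> (\<gamma> y)) (x - y) (\<Phi> (\<gamma> x))" using assms by (intro *) auto
    from reach_sym[OF this] show ?thesis by simp
  qed (use * assms in auto)
qed

section \<open>Maximal trajectories as orbits of the linear saddle\<close>

definition \<Psi> :: "real \<times> real \<Rightarrow> real \<times> real" where
  "\<Psi> = C \<circ> \<Phi>"

lemma \<Psi>_\<Theta>_flow: "\<Psi> (\<Theta> (flow t p)) = saddle t (C p)"
  by (simp add: \<Psi>_def C_flow saddle_def)

text \<open>The trajectory given by the complete orbit of the flow through
  \<open>\<Phi> (\<gamma> t\<^sub>0)\<close> extends \<gamma>, hence has the same domain by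
  maximality, and its time change runs through all reals.\<close>

lemma maximal_trajectory_saddle:
  assumes max: "maximal_trajectory X I \<gamma>"
  obtains q \<sigma> where "q \<noteq> 0" "strict_mono_on I \<sigma>" "\<sigma> ` I = UNIV" "\<And>t. t \<in> I \<Longrightarrow> \<Psi> (\<gamma> t) = saddle (\<sigma> t) q"
proof -
  have \<gamma>: "trajectory X I \<gamma>" using max by (simp add: maximal_trajectory_def)
  then obtain t\<^sub>0 where "t\<^sub>0 \<in> I" by (auto simp: trajectory_def)
  define p where "p = \<Phi> (\<gamma> t\<^sub>0)"
  have "p \<noteq> 0" using \<gamma> \<open>t\<^sub>0 \<in> I\<close> by (auto simp: p_def trajectory_def X_eq_0_iff)
  obtain J \<delta> g where \<delta>: "trajectory X J \<delta>" "J = range (\<lambda>s. t\<^sub>0 + clock p s)"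
    "strict_mono_on J g" "g ` J = UNIV"
    "\<And>t. \<delta> t = \<Theta> (flow (g t) p)" "\<And>s. g (t\<^sub>0 + clock p s) = s"
    by (rule orbit_trajectory[OF \<open>p \<noteq> 0\<close>, where t\<^sub>0 = t\<^sub>0]) blast
  have *: "t \<in> J \<and> \<delta> t = \<gamma> t" if t: "t \<in> I" for t
  proof -
    obtain s where s: "\<Phi> (\<gamma> t) = flow s p" "t - t\<^sub>0 = clock p s"
      using trajectory_reach[OF \<gamma> \<open>t\<^sub>0 \<in> I\<close> t] by (auto simp: reach_def p_def)
    then have "t = t\<^sub>0 + clock p s" by simp
    moreover have "\<delta> (t\<^sub>0 + clock p s) = \<gamma> t" by (simp add: \<delta>(5,6) flip: s(1))
    ultimately show ?thesis by (auto simp: \<delta>(2))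
  qed
  then have "J = I" using max \<delta>(1) unfolding maximal_trajectory_def by blast
  show thesis
  proof (rule that[of "C p" g])
    show "\<Psi> (\<gamma> t) = saddle (g t) (C p)" if "t \<in> I" for t
    proof -
      have "\<gamma> t = \<Theta> (flow (g t) p)" using *[OF that] \<delta>(5)[of t] by simp
      then show ?thesis by (simp only: \<Psi>_\<Theta>_flow)
    qed
  qed (use \<open>J = I\<close> \<delta> \<open>p \<noteq> 0\<close> in \<open>auto simp: C_eq_0_iff\<close>)
qed

text \<open>Any extension of the trajectory of a complete orbit still follows that orbit by
  \<open>trajectory_reach\<close>, so all its times are values of the clock and lie in
  \<open>J\<close> already.\<close>

lemma saddle_maximal_trajectory:
  assumes "q \<noteq> 0"
  obtains I \<gamma> \<sigma> where "maximal_trajectory X I \<gamma>" "strict_mono_on I \<sigma>" "\<sigma> ` I = UNIV"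
    "\<And>t. t \<in> I \<Longrightarrow> \<Psi> (\<gamma> t) = saddle (\<sigma> t) q"
proof -
  obtain p where p: "C p = q" using surj_C by (metis surjD)
  then have "p \<noteq> 0" using assms C_eq_0_iff[of p] by simp
  obtain J \<delta> g where \<delta>: "trajectory X J \<delta>" "J = range (\<lambda>s. 0 + clock p s)"
    "strict_mono_on J g" "g ` J = UNIV"
    "\<And>t. \<delta> t = \<Theta> (flow (g t) p)" "\<And>s. g (0 + clock p s) = s"
    by (rule orbit_trajectory[OF \<open>p \<noteq> 0\<close>, where t\<^sub>0 = 0]) blast
  have "0 \<in> J" unfolding \<delta>(2) by (rule range_eqI[of _ _ 0]) simp
  have "g 0 = 0" using \<delta>(6)[of 0] by simp
  have "maximal_trajectory X J \<delta>"
    unfolding maximal_trajectory_def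
  proof (intro conjI allI impI)
    fix J' \<delta>' assume ext: "trajectory X J' \<delta>' \<and> J \<subseteq> J' \<and> (\<forall>t\<in>J. \<delta>' t = \<delta> t)"
    have "\<Phi> (\<delta>' 0) = p" using ext \<open>0 \<in> J\<close> \<open>g 0 = 0\<close> by (simp add: \<delta>(5))
    have "t \<in> J" if "t \<in> J'" for t
    proof -
      have "reach (\<Phi> (\<delta>' 0)) (t - 0) (\<Phi> (\<delta>' t))"
        using ext \<open>0 \<in> J\<close> that by (intro trajectory_reach) auto
      then show ?thesis unfolding \<open>\<Phi> (\<delta>' 0) = p\<close> \<delta>(2) reach_def by auto
    qed
    then show "J' = J" using ext by blast
  qed (rule \<delta>)
  then show thesis
    by (rule that[of J \<delta> g]) (use \<delta> \<Psi>_\<Theta>_flow p in auto)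
qed

lemma homeomorphism_\<Psi>: obtains \<Psi>' where "homeomorphism UNIV UNIV \<Psi> \<Psi>'"
proof -
  obtain C' where "homeomorphism UNIV UNIV C C'" by (rule homeomorphism_C)
  from homeomorphism_compose[OF homeomorphism_sym[THEN iffD1, OF homeomorphism_\<Theta>] this]
  have "homeomorphism UNIV UNIV \<Psi> (\<Theta> \<circ> C')" by (simp only: \<Psi>_def)
  then show thesis by (rule that)
qed

lemma \<Psi>_eq_0_iff: "\<Psi> p = 0 \<longleftrightarrow> X p = 0"
  by (simp add: \<Psi>_def C_eq_0_iff X_eq_0_iff)

end

section \<open>Topological equivalence within the family\<close>

lemma topologically_equivalentI:
  assumes hom: "homeomorphism UNIV UNIV H H'"
    and eq: "\<And>p. Y (H p) = 0 \<longleftrightarrow> X p = 0"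
    and pres: "preserves_time_orientation X Y H" "preserves_time_orientation Y X H'"
  shows "topologically_equivalent X Y"
proof -
  have inv: "H (H' q) = q" "H' (H p) = p" for p q using hom unfolding homeomorphism_def by blast+
  have sub: "H ` O' \<in> orbits Y" if Q: "O' \<in> orbits X" and pres: "preserves_time_orientation X Y H" and eq: "\<And>p. X p = 0 \<Longrightarrow> Y (H p) = 0"
    for X Y H and O' :: "'a set"
  proof -
    consider p where "O' = {p}" "X p = 0" | I \<gamma> where "O' = \<gamma> ` I" "maximal_trajectory X I \<gamma>"
      using Q by (auto simp: orbits_def)
    then show ?thesis
    proof cases
      case 1
      then show ?thesis using eq by (auto simp: orbits_def)
    next
      case 2
      then obtain J \<delta> h where J: "maximal_trajectory Y J \<delta>" "h ` I = J" "\<forall>t\<in>I. H (\<gamma> t) = \<delta> (h t)"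
        using pres unfolding preserves_time_orientation_def by blast
      have "H ` O' = \<delta> ` J" unfolding 2(1) J(2)[symmetric] image_image using J(3) by (intro image_cong) auto
      then show ?thesis using J(1) by (auto simp: orbits_def)
    qed
  qed
  have "(`) H ` orbits X = orbits Y"
  proof (intro equalityI subsetI)
    fix Q assume "Q \<in> (`) H ` orbits X"
    then show "Q \<in> orbits Y" using sub[OF _ pres(1)] eq by auto
  next
    fix Q assume "Q \<in> orbits Y"
    then have "H' ` Q \<in> orbits X" by (rule sub[OF _ pres(2)]) (metis eq inv(1))
    moreover have "Q = H ` H' ` Q" by (simp add: image_image inv)
    ultimately show "Q \<in> (`) H ` orbits X" by blast
  qed
  then show ?thesis unfolding topologically_equivalent_def using hom pres by blast
qed

text \<open>A maximal trajectory of either field runs once through a saddle orbit, with an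
  increasing time change onto the reals. The time change between the fields is the one of the first
  followed by the inverse of the other.\<close>

lemma XE_preserves_time_orientation:
  assumes "singular_saddle \<Lambda> \<alpha> c" "singular_saddle \<Lambda>' \<alpha>' c'"
    and H: "\<And>p. singular_saddle.\<Psi> \<Lambda>' \<alpha>' c' (H p) = singular_saddle.\<Psi> \<Lambda> \<alpha> c p"
  shows "preserves_time_orientation (XE \<Lambda> \<alpha> c) (XE \<Lambda>' \<alpha>' c') H"
proof -
  interpret X: singular_saddle \<Lambda> \<alpha> c by fact
  interpret Y: singular_saddle \<Lambda>' \<alpha>' c' by fact
  obtain \<Psi>' where "homeomorphism UNIV UNIV Y.\<Psi> \<Psi>'" by (rule Y.homeomorphism_\<Psi>)
  then have inj: "Y.\<Psi> p = Y.\<Psi> q \<Longrightarrow> p = q" for p q by (metis UNIV_I homeomorphism_apply1)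
  show ?thesis
    unfolding preserves_time_orientation_def
  proof (intro allI impI)
    fix I \<gamma> assume "maximal_trajectory X.X I \<gamma>"
    then obtain q \<sigma> where \<sigma>: "q \<noteq> 0" "strict_mono_on I \<sigma>" "\<sigma> ` I = UNIV"
      "\<And>t. t \<in> I \<Longrightarrow> X.\<Psi> (\<gamma> t) = saddle (\<sigma> t) q"
      by (rule X.maximal_trajectory_saddle) blast
    obtain J \<delta> \<tau> where \<tau>: "maximal_trajectory Y.X J \<delta>" "strict_mono_on J \<tau>" "\<tau> ` J = UNIV"
      "\<And>t. t \<in> J \<Longrightarrow> Y.\<Psi> (\<delta> t) = saddle (\<tau> t) q"
      by (rule Y.saddle_maximal_trajectory[OF \<sigma>(1)]) blast
    define h where "h t = inv_into J \<tau> (\<sigma> t)" for t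
    have h: "h t \<in> J" "\<tau> (h t) = \<sigma> t" for t
      unfolding h_def using \<tau>(3) by (auto intro: inv_into_into f_inv_into_f)
    have "strict_mono_on I h"
    proof (rule strict_mono_onI)
      fix s t assume "s \<in> I" "t \<in> I" "s < t"
      then have "\<tau> (h s) < \<tau> (h t)" using \<sigma>(2) by (simp add: h strict_mono_onD)
      then show "h s < h t" using strict_mono_on_less[OF \<tau>(2) h(1) h(1)] by simp
    qed
    moreover have "h ` I = J"
    proof (intro equalityI subsetI)
      fix t assume "t \<in> J"
      obtain s where s: "s \<in> I" "\<sigma> s = \<tau> t" using \<sigma>(3) by (metis UNIV_I imageE)
      then have "h s = t"
        unfolding h_def using strict_mono_on_imp_inj_on[OF \<tau>(2)] \<open>t \<in> J\<close> by simp
      then show "t \<in> h ` I" using s(1) by blast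
    qed (use h in auto)
    moreover have "H (\<gamma> t) = \<delta> (h t)" if "t \<in> I" for t
      by (rule inj) (simp only: H h(2) \<sigma>(4)[OF that] \<tau>(4)[OF h(1)])
    ultimately show "\<exists>J \<delta> h. maximal_trajectory Y.X J \<delta> \<and> strict_mono_on I h \<and> h ` I = J \<and> (\<forall>t\<in>I. H (\<gamma> t) = \<delta> (h t))"
      using \<tau>(1) by blast
  qed
qed

lemma XE_topologically_equivalent:
  assumes "singular_saddle \<Lambda> \<alpha> c" "singular_saddle \<Lambda>' \<alpha>' c'"
  shows "topologically_equivalent (XE \<Lambda> \<alpha> c) (XE \<Lambda>' \<alpha>' c')"
proof -
  interpret X: singular_saddle \<Lambda> \<alpha> c by fact
  interpret Y: singular_saddle \<Lambda>' \<alpha>' c' by fact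
  obtain P where P: "homeomorphism UNIV UNIV X.\<Psi> P" by (rule X.homeomorphism_\<Psi>)
  obtain Q where Q: "homeomorphism UNIV UNIV Y.\<Psi> Q" by (rule Y.homeomorphism_\<Psi>)
  have inv: "X.\<Psi> (P p) = p" "Y.\<Psi> (Q p) = p" for p using P Q unfolding homeomorphism_def by blast+
  show ?thesis
  proof (rule topologically_equivalentI)
    show "homeomorphism UNIV UNIV (Q \<circ> X.\<Psi>) (P \<circ> Y.\<Psi>)"
      by (rule homeomorphism_compose[OF P homeomorphism_sym[THEN iffD1, OF Q]])
    show "Y.X ((Q \<circ> X.\<Psi>) p) = 0 \<longleftrightarrow> X.X p = 0" for p
      by (simp add: inv flip: Y.\<Psi>_eq_0_iff X.\<Psi>_eq_0_iff)
    show "preserves_time_orientation X.X Y.X (Q \<circ> X.\<Psi>)"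
      by (rule XE_preserves_time_orientation[OF assms]) (simp add: inv)
    show "preserves_time_orientation Y.X X.X (P \<circ> Y.\<Psi>)"
      by (rule XE_preserves_time_orientation[OF assms(2,1)]) (simp add: inv)
  qed
qed

theorem proposition4p3:
  fixes \<Lambda> \<alpha> c :: real
  assumes "c \<ge> 0" and "0 \<le> \<alpha>" and "\<alpha> \<le> 1" and "\<Lambda> > 0"
  shows "(\<forall>\<Lambda>' \<alpha>' c'. c' \<ge> 0 \<and> 0 \<le> \<alpha>' \<and> \<alpha>' \<le> 1 \<and> \<Lambda>' > 0 \<longrightarrow>
           phase_portrait (XE \<Lambda> \<alpha> c) = phase_portrait (XE \<Lambda>' \<alpha>' c')) \<and>
         topologically_equivalent (XE \<Lambda> \<alpha> c) X0"
proof (intro conjI allI impI)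
  have X: "singular_saddle \<Lambda> \<alpha> c" using assms by unfold_locales
  show "topologically_equivalent (XE \<Lambda> \<alpha> c) X0"
    unfolding XE_eq_X0[symmetric] by (rule XE_topologically_equivalent[OF X]) (unfold_locales, auto)
  fix \<Lambda>' \<alpha>' c' :: real
  assume "c' \<ge> 0 \<and> 0 \<le> \<alpha>' \<and> \<alpha>' \<le> 1 \<and> \<Lambda>' > 0"
  then have Y: "singular_saddle \<Lambda>' \<alpha>' c'" by unfold_locales auto
  show "phase_portrait (XE \<Lambda> \<alpha> c) = phase_portrait (XE \<Lambda>' \<alpha>' c')"
    using equivp_topologically_equivalent XE_topologically_equivalent[OF X Y]
    unfolding phase_portrait_def equivp_def by metis
qed

end
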